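(* Let $(M,J)$ be a compact connected almost complex $2m$-manifold. For every choice of $J$-compatible metric $g$ one has $h^0_{d+d^c}=1$ and $h^{2m}_{d+d^c}=1$, and the number $h^1_{d+d^c}$ is independent of the choice of $J$-compatible metric.
   Context: A $J$-compatible metric is a Riemannian metric $g$ with $g(J\cdot,J\cdot)=g(\cdot,\cdot)$; $M$ is oriented by $J$ and $*$ is the $\mathbb C$-linear Hodge operator. $A^k$ is the space of smooth complex $k$-forms; $J$ acts on forms by $J\alpha=i^{p-q}\alpha$ for $\alpha\in A^{p,q}$; $d^c:=J^{-1}dJ$. Put $P^*:=-*P*$, so that $(dd^c)^*\alpha=0$ means $dd^c*\alpha=0$. The space of $(d+d^c)$-harmonic $k$-forms is $$\mathcal H^k_{d+d^c}=\{\alpha\in A^k:d\alpha=0,\ d^c\alpha=0,\ (dd^c)^*\alpha=0\},$$ and $h^k_{d+d^c}:=\dim_{\mathbb C}\mathcal H^k_{d+d^c}$. *)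

theory Defs
  imports
    "HOL-Analysis.Analysis"
    "HOL-Combinatorics.Permutations"
    "HOL-Library.Function_Algebras"
    "HOL-Library.Extended_Nat"
begin

section \<open>Smooth maps and smooth manifolds\<close>

text \<open>Intended for open \<open>S\<close>: all iterated directional derivatives up to order \<open>k\<close> exist and
  are continuous on \<open>S\<close>.\<close>

primrec Ck_on :: "nat \<Rightarrow> 'e set \<Rightarrow> ('e::euclidean_space \<Rightarrow> 'b::real_normed_vector) \<Rightarrow> bool" where
  "Ck_on 0 S f \<longleftrightarrow> continuous_on S f"
| "Ck_on (Suc k) S f \<longleftrightarrow>
     (\<forall>x\<in>S. f differentiable (at x)) \<and> (\<forall>v. Ck_on k S (\<lambda>x. frechet_derivative f (at x) v))"

definition smooth_on :: "'e set \<Rightarrow> ('e::euclidean_space \<Rightarrow> 'b::real_normed_vector) \<Rightarrow> bool" where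
  "smooth_on S f \<longleftrightarrow> (\<forall>k. Ck_on k S f)"

text \<open>The manifold is the whole type \<open>'a\<close>, modelled on \<open>'e\<close>. A chart is a pair of its domain and
  its coordinate map; the values of the coordinate map outside the domain are irrelevant.\<close>

type_synonym ('a, 'e) chart = "'a set \<times> ('a \<Rightarrow> 'e)"

definition chart_inv :: "('a, 'e) chart \<Rightarrow> 'e \<Rightarrow> 'a" where
  "chart_inv c = inv_into (fst c) (snd c)"

definition is_chart :: "('a::topological_space, 'e::euclidean_space) chart \<Rightarrow> bool" where
  "is_chart c \<longleftrightarrow> open (fst c) \<and> open (snd c ` fst c) \<and>
     homeomorphism (fst c) (snd c ` fst c) (snd c) (chart_inv c)"

definition smooth_atlas :: "('a::{t2_space,second_countable_topology}, 'e::euclidean_space) chart set \<Rightarrow> bool" where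
  "smooth_atlas A \<longleftrightarrow> (\<forall>c\<in>A. is_chart c) \<and> (\<Union>c\<in>A. fst c) = UNIV \<and>
     (\<forall>c\<in>A. \<forall>c'\<in>A. smooth_on (snd c ` (fst c \<inter> fst c')) (snd c' \<circ> chart_inv c))"

text \<open>The change of coordinates for tangent vectors at \<open>p\<close>, from the chart \<open>c\<close> to the chart \<open>c'\<close>.\<close>

definition coord_change :: "('a, 'e::euclidean_space) chart \<Rightarrow> ('a, 'e) chart \<Rightarrow> 'a \<Rightarrow> 'e \<Rightarrow> 'e" where
  "coord_change c c' p = frechet_derivative (snd c' \<circ> chart_inv c) (at (snd c p))"

text \<open>Tensor fields are given by their local expressions in the charts of the atlas, subject to the
  transformation law: a chart \<open>c\<close> identifies the tangent space at each point \<open>p\<close> of its domain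
  with \<open>'e\<close>, and the third argument of a field is evaluated on vectors of \<open>'e\<close>.\<close>

type_synonym ('a, 'e) endo_field = "('a, 'e) chart \<Rightarrow> 'a \<Rightarrow> 'e \<Rightarrow> 'e"
type_synonym ('a, 'e) metric_field = "('a, 'e) chart \<Rightarrow> 'a \<Rightarrow> 'e \<Rightarrow> 'e \<Rightarrow> real"

definition almost_complex_structure ::
  "('a, 'e::euclidean_space) chart set \<Rightarrow> ('a, 'e) endo_field \<Rightarrow> bool" where
  "almost_complex_structure A J \<longleftrightarrow>
     (\<forall>c\<in>A. \<forall>p\<in>fst c. linear (J c p) \<and> (\<forall>v. J c p (J c p v) = - v)) \<and>
     (\<forall>c\<in>A. \<forall>v. smooth_on (snd c ` fst c) (\<lambda>x. J c (chart_inv c x) v)) \<and>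
     (\<forall>c\<in>A. \<forall>c'\<in>A. \<forall>p\<in>fst c \<inter> fst c'. \<forall>v.
        J c' p (coord_change c c' p v) = coord_change c c' p (J c p v))"

definition riemannian_metric ::
  "('a, 'e::euclidean_space) chart set \<Rightarrow> ('a, 'e) metric_field \<Rightarrow> bool" where
  "riemannian_metric A g \<longleftrightarrow>
     (\<forall>c\<in>A. \<forall>p\<in>fst c. bilinear (g c p) \<and> (\<forall>v w. g c p v w = g c p w v) \<and>
        (\<forall>v. v \<noteq> 0 \<longrightarrow> g c p v v > 0)) \<and>
     (\<forall>c\<in>A. \<forall>v w. smooth_on (snd c ` fst c) (\<lambda>x. g c (chart_inv c x) v w)) \<and>
     (\<forall>c\<in>A. \<forall>c'\<in>A. \<forall>p\<in>fst c \<inter> fst c'. \<forall>v w.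
        g c' p (coord_change c c' p v) (coord_change c c' p w) = g c p v w)"

definition compatible_metric ::
  "('a, 'e::euclidean_space) chart set \<Rightarrow> ('a, 'e) endo_field \<Rightarrow> ('a, 'e) metric_field \<Rightarrow> bool" where
  "compatible_metric A J g \<longleftrightarrow> riemannian_metric A g \<and>
     (\<forall>c\<in>A. \<forall>p\<in>fst c. \<forall>v w. g c p (J c p v) (J c p w) = g c p v w)"

section \<open>Complex exterior algebra of a vector space\<close>

text \<open>A complex-valued \<open>k\<close>-covector is evaluated on lists of \<open>k\<close> vectors, and is zero on lists of
  any other length.\<close>

type_synonym 'e covec = "'e list \<Rightarrow> complex"

definition alt_covec :: "nat \<Rightarrow> 'e::euclidean_space covec set" where
  "alt_covec k = {\<alpha>.
     (\<forall>vs. length vs \<noteq> k \<longrightarrow> \<alpha> vs = 0) \<and>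
     (\<forall>vs i. length vs = k \<longrightarrow> i < k \<longrightarrow> linear (\<lambda>x. \<alpha> (vs[i := x]))) \<and>
     (\<forall>vs. \<not> distinct vs \<longrightarrow> \<alpha> vs = 0)}"

text \<open>The wedge product of a list of 1-covectors, normalised as \<open>det (\<theta>\<^sub>i v\<^sub>j)\<close>.\<close>

definition wedge :: "('e \<Rightarrow> complex) list \<Rightarrow> 'e covec" where
  "wedge \<theta>s vs = (if length vs = length \<theta>s
     then \<Sum>\<sigma> | \<sigma> permutes {..<length \<theta>s}.
            of_int (sign \<sigma>) * (\<Prod>i<length \<theta>s. (\<theta>s ! i) (vs ! \<sigma> i))
     else 0)"

definition covec_scale :: "complex \<Rightarrow> 'e covec \<Rightarrow> 'e covec" where
  "covec_scale z \<alpha> = (\<lambda>vs. z * \<alpha> vs)"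

interpretation covec: vector_space "covec_scale :: complex \<Rightarrow> 'e covec \<Rightarrow> 'e covec"
  by unfold_locales (auto simp: covec_scale_def fun_eq_iff algebra_simps)

definition covec10 :: "('e::euclidean_space \<Rightarrow> 'e) \<Rightarrow> ('e \<Rightarrow> complex) set" where
  "covec10 J = {\<theta>. linear \<theta> \<and> (\<forall>v. \<theta> (J v) = \<i> * \<theta> v)}"

definition covec01 :: "('e::euclidean_space \<Rightarrow> 'e) \<Rightarrow> ('e \<Rightarrow> complex) set" where
  "covec01 J = {\<theta>. linear \<theta> \<and> (\<forall>v. \<theta> (J v) = - \<i> * \<theta> v)}"

text \<open>Covectors of bidegree \<open>(p,q)\<close>.\<close>

definition covec_pq :: "('e::euclidean_space \<Rightarrow> 'e) \<Rightarrow> nat \<Rightarrow> nat \<Rightarrow> 'e covec set" where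
  "covec_pq J p q = covec.span {wedge (\<theta>s @ \<eta>s) |\<theta>s \<eta>s.
     length \<theta>s = p \<and> set \<theta>s \<subseteq> covec10 J \<and> length \<eta>s = q \<and> set \<eta>s \<subseteq> covec01 J}"

text \<open>The action of \<open>J\<close> on \<open>k\<close>-covectors: multiplication by \<open>\<i>\<^bsup>p-q\<^esup>\<close> in bidegree \<open>(p,q)\<close>.
  Here \<open>a p\<close> is the component of bidegree \<open>(p, k-p)\<close>.\<close>

definition J_covec :: "('e::euclidean_space \<Rightarrow> 'e) \<Rightarrow> nat \<Rightarrow> 'e covec \<Rightarrow> 'e covec" where
  "J_covec J k \<alpha> = (THE \<beta>. \<exists>a. (\<forall>p\<le>k. a p \<in> covec_pq J p (k - p)) \<and>
     \<alpha> = (\<Sum>p\<le>k. a p) \<and>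
     \<beta> = (\<Sum>p\<le>k. covec_scale (\<i> powi (int p - int (k - p))) (a p)))"

definition J_covec_inv :: "('e::euclidean_space \<Rightarrow> 'e) \<Rightarrow> nat \<Rightarrow> 'e covec \<Rightarrow> 'e covec" where
  "J_covec_inv J k = inv_into (alt_covec k) (J_covec J k)"

text \<open>An orthonormal basis of the form \<open>u\<^sub>1, J u\<^sub>1, \<dots>, u\<^sub>m, J u\<^sub>m\<close>. It is positively
  oriented, because the orientation is the one induced by \<open>J\<close>.\<close>

definition unitary_frame ::
  "('e::euclidean_space \<Rightarrow> 'e) \<Rightarrow> ('e \<Rightarrow> 'e \<Rightarrow> real) \<Rightarrow> 'e list \<Rightarrow> bool" where
  "unitary_frame J g es \<longleftrightarrow> length es = DIM('e) \<and>
     (\<forall>i<DIM('e). \<forall>j<DIM('e). g (es ! i) (es ! j) = (if i = j then 1 else 0)) \<and>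
     (\<forall>i. 2 * i + 1 < DIM('e) \<longrightarrow> es ! (2 * i + 1) = J (es ! (2 * i)))"

text \<open>The Riemannian volume form: the wedge product of the coframe dual to a frame \<open>es\<close>.\<close>

definition vol_covec :: "('e \<Rightarrow> 'e \<Rightarrow> real) \<Rightarrow> 'e list \<Rightarrow> 'e covec" where
  "vol_covec g es = wedge (map (\<lambda>e v. complex_of_real (g e v)) es)"

text \<open>The complex linear Hodge operator, normalised by \<open>\<alpha> \<and> *\<beta> = g(\<alpha>,\<beta>) vol\<close> with \<open>g\<close> extended
  complex bilinearly; explicitly \<open>*\<alpha> = (\<Sum>I. \<alpha>(e\<^sub>I) vol(e\<^sub>I, _, \<dots>, _))\<close>, where \<open>I\<close> runs over the
  increasing multi-indices. The result does not depend on the chosen frame.\<close>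

definition hodge_covec ::
  "('e::euclidean_space \<Rightarrow> 'e) \<Rightarrow> ('e \<Rightarrow> 'e \<Rightarrow> real) \<Rightarrow> 'e covec \<Rightarrow> 'e covec" where
  "hodge_covec J g \<alpha> vs =
     (let es = (SOME es. unitary_frame J g es)
      in \<Sum>I | I \<subseteq> {..<DIM('e)} \<and> card I + length vs = DIM('e).
           \<alpha> (nths es I) * vol_covec g es (nths es I @ vs))"

section \<open>Complex differential forms\<close>

type_synonym ('a, 'e) cform = "('a, 'e) chart \<Rightarrow> 'a \<Rightarrow> 'e covec"

definition cform_scale :: "complex \<Rightarrow> ('a, 'e) cform \<Rightarrow> ('a, 'e) cform" where
  "cform_scale z \<alpha> = (\<lambda>c p vs. z * \<alpha> c p vs)"

interpretation cform: vector_space "cform_scale :: complex \<Rightarrow> ('a, 'e) cform \<Rightarrow> ('a, 'e) cform"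
  by unfold_locales (auto simp: cform_scale_def fun_eq_iff algebra_simps)

text \<open>\<open>on_charts A \<alpha>\<close> normalises the irrelevant values of \<open>\<alpha>\<close> (outside the atlas, and outside
  the chart domains) to zero, so that a form is determined by its local expressions.\<close>

definition on_charts :: "('a, 'e) chart set \<Rightarrow> ('a, 'e) cform \<Rightarrow> ('a, 'e) cform" where
  "on_charts A \<alpha> = (\<lambda>c p. if c \<in> A \<and> p \<in> fst c then \<alpha> c p else 0)"

definition cforms :: "('a, 'e::euclidean_space) chart set \<Rightarrow> nat \<Rightarrow> ('a, 'e) cform set" where
  "cforms A k = {\<alpha>. on_charts A \<alpha> = \<alpha> \<and>
     (\<forall>c\<in>A. \<forall>p\<in>fst c. \<alpha> c p \<in> alt_covec k) \<and>
     (\<forall>c\<in>A. \<forall>vs. smooth_on (snd c ` fst c) (\<lambda>x. \<alpha> c (chart_inv c x) vs)) \<and>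
     (\<forall>c\<in>A. \<forall>c'\<in>A. \<forall>p\<in>fst c \<inter> fst c'. \<forall>vs.
        \<alpha> c p vs = \<alpha> c' p (map (coord_change c c' p) vs))}"

text \<open>The exterior derivative
  \<open>d\<alpha>(v\<^sub>0, \<dots>, v\<^sub>k) = \<Sum>i. (-1)\<^sup>i D\<^bsub>v\<^sub>i\<^esub> \<alpha>(v\<^sub>0, \<dots>, (omit v\<^sub>i), \<dots>, v\<^sub>k)\<close> in each chart.\<close>

definition ext_d :: "('a, 'e::euclidean_space) chart set \<Rightarrow> ('a, 'e) cform \<Rightarrow> ('a, 'e) cform" where
  "ext_d A \<alpha> = on_charts A (\<lambda>c p vs. \<Sum>i<length vs. (- 1) ^ i *
     frechet_derivative (\<lambda>x. \<alpha> c (chart_inv c x) (take i vs @ drop (Suc i) vs))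
       (at (snd c p)) (vs ! i))"

definition J_form ::
  "('a, 'e::euclidean_space) chart set \<Rightarrow> ('a, 'e) endo_field \<Rightarrow> nat \<Rightarrow> ('a, 'e) cform \<Rightarrow> ('a, 'e) cform"
  where "J_form A J k \<alpha> = on_charts A (\<lambda>c p. J_covec (J c p) k (\<alpha> c p))"

definition J_form_inv ::
  "('a, 'e::euclidean_space) chart set \<Rightarrow> ('a, 'e) endo_field \<Rightarrow> nat \<Rightarrow> ('a, 'e) cform \<Rightarrow> ('a, 'e) cform"
  where "J_form_inv A J k \<alpha> = on_charts A (\<lambda>c p. J_covec_inv (J c p) k (\<alpha> c p))"

text \<open>\<open>d\<^sup>c = J\<^sup>-\<^sup>1 d J\<close>; the argument \<open>k\<close> is the degree of the form it is applied to.\<close>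

definition dc ::
  "('a, 'e::euclidean_space) chart set \<Rightarrow> ('a, 'e) endo_field \<Rightarrow> nat \<Rightarrow> ('a, 'e) cform \<Rightarrow> ('a, 'e) cform"
  where "dc A J k \<alpha> = J_form_inv A J (k + 1) (ext_d A (J_form A J k \<alpha>))"

definition hodge ::
  "('a, 'e::euclidean_space) chart set \<Rightarrow> ('a, 'e) endo_field \<Rightarrow> ('a, 'e) metric_field \<Rightarrow>
     ('a, 'e) cform \<Rightarrow> ('a, 'e) cform" where
  "hodge A J g \<alpha> = on_charts A (\<lambda>c p. hodge_covec (J c p) (g c p) (\<alpha> c p))"

text \<open>\<open>P\<^sup>* = - * P *\<close>.\<close>

definition adj ::
  "('a, 'e::euclidean_space) chart set \<Rightarrow> ('a, 'e) endo_field \<Rightarrow> ('a, 'e) metric_field \<Rightarrow>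
     (('a, 'e) cform \<Rightarrow> ('a, 'e) cform) \<Rightarrow> ('a, 'e) cform \<Rightarrow> ('a, 'e) cform" where
  "adj A J g P \<alpha> = - hodge A J g (P (hodge A J g \<alpha>))"

definition harmonic_forms ::
  "('a, 'e::euclidean_space) chart set \<Rightarrow> ('a, 'e) endo_field \<Rightarrow> ('a, 'e) metric_field \<Rightarrow> nat \<Rightarrow>
     ('a, 'e) cform set" where
  "harmonic_forms A J g k = {\<alpha> \<in> cforms A k. ext_d A \<alpha> = 0 \<and> dc A J k \<alpha> = 0 \<and>
     adj A J g (\<lambda>\<beta>. ext_d A (dc A J (DIM('e) - k) \<beta>)) \<alpha> = 0}"

text \<open>The complex dimension of a subspace, with value \<open>\<infinity>\<close> (rather than the library's default \<open>0\<close>)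
  in the infinite-dimensional case.\<close>

definition cdim :: "('a, 'e) cform set \<Rightarrow> enat" where
  "cdim V = (if \<exists>B. finite B \<and> V \<subseteq> cform.span B then enat (cform.dim V) else \<infinity>)"

definition harmonic_number ::
  "('a, 'e::euclidean_space) chart set \<Rightarrow> ('a, 'e) endo_field \<Rightarrow> ('a, 'e) metric_field \<Rightarrow> nat \<Rightarrow> enat"
  where "harmonic_number A J g k = cdim (harmonic_forms A J g k)"

end

theory Submission
  imports Defs
begin

text \<open>In degree \<open>1\<close> the third harmonicity condition is vacuous: \<open>dd\<^sup>c*\<alpha>\<close> has degree \<open>2m + 1\<close>.
  So \<open>\<H>\<^sup>1\<close> is cut out by \<open>d\<alpha> = 0\<close> and \<open>d\<^sup>c\<alpha> = 0\<close>, which do not involve the metric.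
  In degree \<open>0\<close> the condition \<open>d\<alpha> = 0\<close> leaves the constants, and \<open>d\<^sup>c\<close> vanishes on top forms.
  A top form is \<open>f vol\<close>, and it is harmonic iff \<open>dd\<^sup>cf = 0\<close>. For a vector \<open>v\<close> constant in a chart,
  \<open>dd\<^sup>cf(v, Jv)\<close> is, up to sign, the sum of the second derivatives of \<open>f\<close> along \<open>v\<close> and \<open>Jv\<close>, up to
  first order terms, so the strong maximum principle makes \<open>f\<close> constant.

  Smoothness of \<open>vol\<close> and of \<open>*\<alpha>\<close>, and independence of the choice of the frame, come from
  writing \<open>vol\<close> as the Pfaffian of the fundamental form \<open>\<omega>(v, w) = g(Jv, w)\<close>. Expanding the
  Pfaffian along its first argument gives, for a 1-form \<open>\<alpha>\<close>, a formula for \<open>*\<alpha>\<close> that is polynomial in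
  \<open>\<alpha>\<close>, \<open>J\<close> and \<open>g\<close>.\<close>

section \<open>Alternating functions of lists\<close>

text \<open>Three features of the definitions shape the work. \<open>J_covec\<close> is a definite
  description over bidegree decompositions; it is replaced by the pullback that evaluates a covector
  on J v_1, ..., J v_k. \<open>hodge_covec\<close> picks a unitary frame at each point by
  \<open>SOME\<close>, with no continuity from point to point, while
  \<open>frechet_derivative\<close> says nothing about a function that is not differentiable. So
  even the vanishing of a form of degree 2m + 1 needs care: d of a form is known to be alternating
  only where the form is differentiable. Hence the demand for frame-free formulas; the Pfaffian,
  unlike the square root of a determinant, is polynomial and carries the orientation given by J.
  Finally, derived forms are only required to be alternating and smooth in every chart, since
  vanishing is tested chart by chart; the transformation law is exploited only in degrees 0 and 2m,
  to compare coefficients in two charts.\<close>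

definition omit :: "nat \<Rightarrow> 'b list \<Rightarrow> 'b list" where
  "omit i xs = take i xs @ drop (Suc i) xs"

lemma length_omit [simp]: "i < length xs \<Longrightarrow> length (omit i xs) = length xs - 1"
  by (auto simp: omit_def)

lemma omit_append_Cons:
  "omit l (xs @ x # ys) =
     (if l < length xs then omit l xs @ x # ys
      else if l = length xs then xs @ ys
      else xs @ x # omit (l - length xs - 1) ys)"
proof (cases "l \<le> length xs")
  case False
  then obtain d where "l = length xs + Suc d" by (metis less_iff_Suc_add not_le add_Suc_right)
  then show ?thesis by (simp add: omit_def)
qed (auto simp: omit_def Suc_diff_le)

lemma omit_Cons: "omit l (x # ys) = (if l = 0 then ys else x # omit (l - 1) ys)"
  using omit_append_Cons[of l "[]" x ys] by simp

lemma map_omit: "map f (omit i xs) = omit i (map f xs)"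
  by (simp add: omit_def take_map drop_map)

text \<open>Entries live in an arbitrary abelian group because the notion is applied twice: to
  covectors as functions of vectors, and to \<open>wedge\<close> as a function of its 1-covectors.
  Additivity in each slot is all that the sign rules below need.\<close>

definition alternating :: "nat \<Rightarrow> ('b::ab_group_add list \<Rightarrow> complex) \<Rightarrow> bool" where
  "alternating k f \<longleftrightarrow>
     (\<forall>xs x y ys. length xs + length ys + 1 = k \<longrightarrow>
        f (xs @ (x + y) # ys) = f (xs @ x # ys) + f (xs @ y # ys)) \<and>
     (\<forall>xs x ys. length xs + length ys + 2 = k \<longrightarrow> f (xs @ x # x # ys) = 0)"

text \<open>Polarisation: expand the value 0 on two adjacent entries x + y.\<close>

lemma alternating_swap:
  assumes "alternating k f" "length xs + length ys + 2 = k"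
  shows "f (xs @ x # y # ys) = - f (xs @ y # x # ys)"
proof -
  have add: "f (xs @ (x + y) # zs) = f (xs @ x # zs) + f (xs @ y # zs)"
    if "length xs + length zs + 1 = k" for xs zs x y
    using assms(1) that by (auto simp: alternating_def)
  have z: "f (xs @ x # x # ys) = 0" for x
    using assms by (auto simp: alternating_def)
  have e: "f (xs @ u # (x + y) # ys) = f (xs @ u # x # ys) + f (xs @ u # y # ys)" for u
    using add[of "xs @ [u]" ys x y] assms(2) by simp
  have "0 = f (xs @ (x + y) # (x + y) # ys)" using z by simp
  also have "\<dots> = f (xs @ x # (x + y) # ys) + f (xs @ y # (x + y) # ys)"
    using add[of xs "(x + y) # ys" x y] assms(2) by simp
  also have "\<dots> = f (xs @ x # y # ys) + f (xs @ y # x # ys)"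
    by (simp add: e z)
  finally show ?thesis by (simp add: eq_neg_iff_add_eq_0)
qed

lemma alternating_move:
  assumes "alternating k f" "length xs + length zs + length ys + 1 = k"
  shows "f (xs @ zs @ x # ys) = (- 1) ^ length zs * f (xs @ x # zs @ ys)"
  using assms(2)
proof (induction zs arbitrary: xs)
  case (Cons z zs)
  have "f (xs @ z # zs @ x # ys) = (- 1) ^ length zs * f (xs @ z # x # zs @ ys)"
    using Cons.IH[of "xs @ [z]"] Cons.prems by simp
  also have "f (xs @ z # x # zs @ ys) = - f (xs @ x # z # zs @ ys)"
    using alternating_swap[OF assms(1), of xs "zs @ ys" z x] Cons.prems by simp
  finally show ?case by simp
qed simp

lemma alternating_not_distinct:
  assumes "alternating k f" "length vs = k" "\<not> distinct vs"
  shows "f vs = 0"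
proof -
  obtain xs ys zs y where vs: "vs = xs @ y # ys @ y # zs"
    using not_distinct_decomp[OF assms(3)] by auto
  have "f vs = (- 1) ^ length ys * f (xs @ y # y # ys @ zs)"
    using alternating_move[OF assms(1), of "xs @ [y]" ys zs y] assms(2) vs by simp
  also have "f (xs @ y # y # ys @ zs) = 0"
    using assms vs by (auto simp: alternating_def)
  finally show ?thesis by simp
qed

text \<open>Each entry of \<open>xs\<close> is matched by pulling its copy to the front of
  \<open>ys\<close> at the cost of a sign; \<open>zs\<close> collects the entries already matched.
  The sign stays undetermined because only vanishing or non-vanishing of a value is ever read
  off.\<close>

lemma alternating_mset:
  assumes "alternating k f" "mset xs = mset ys" "length zs + length xs = k"
  shows "f (zs @ xs) = f (zs @ ys) \<or> f (zs @ xs) = - f (zs @ ys)"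
  using assms(2,3)
proof (induction xs arbitrary: ys zs)
  case (Cons x xs)
  then have "x \<in> set ys" by (metis list.set_intros(1) mset_eq_setD)
  then obtain as bs where ys: "ys = as @ x # bs" by (meson split_list)
  have m: "mset xs = mset (as @ bs)" using Cons.prems ys by simp
  then have len: "length xs = length as + length bs"
    by (metis length_append size_mset)
  have "f (zs @ ys) = (- 1) ^ length as * f (zs @ x # as @ bs)"
    using alternating_move[OF assms(1), of zs as bs x] Cons.prems len ys by simp
  moreover have "f ((zs @ [x]) @ xs) = f ((zs @ [x]) @ as @ bs) \<or>
      f ((zs @ [x]) @ xs) = - f ((zs @ [x]) @ as @ bs)"
    using Cons.IH[OF m, of "zs @ [x]"] Cons.prems by simp
  ultimately show ?case
    by (cases "even (length as)") auto
qed simp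

text \<open>Deleting any entry other than the two equal ones leaves a repetition. The two remaining
  terms have the same arguments and opposite signs. Keeping the removed entry and the rest as
  separate arguments of \<open>f\<close> fits both the Pfaffian expansion and the exterior
  derivative.\<close>

lemma sum_omit_adjacent_eq_0:
  fixes f :: "'b \<Rightarrow> 'b list \<Rightarrow> complex"
  assumes "\<And>u l. \<not> distinct l \<Longrightarrow> length l = length xs + length ys + 1 \<Longrightarrow> f u l = 0"
    and "vs = xs @ x # x # ys"
  shows "(\<Sum>l<length vs. (- 1) ^ l * f (vs ! l) (omit l vs)) = 0"
proof -
  let ?a = "length xs"
  have "(\<Sum>l<length vs. (- 1) ^ l * f (vs ! l) (omit l vs)) =
      (\<Sum>l\<in>{?a, Suc ?a}. (- 1) ^ l * f (vs ! l) (omit l vs))"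
  proof (rule sum.mono_neutral_right)
    show "\<forall>l\<in>{..<length vs} - {?a, Suc ?a}. (- 1) ^ l * f (vs ! l) (omit l vs) = 0"
    proof
      fix l assume l: "l \<in> {..<length vs} - {?a, Suc ?a}"
      have "length (omit l vs) = length xs + length ys + 1"
        using l assms(2) by auto
      moreover have "\<not> distinct (omit l vs)"
        using l unfolding assms(2) omit_append_Cons
        by (auto simp: omit_Cons)
      ultimately show "(- 1) ^ l * f (vs ! l) (omit l vs) = 0"
        using assms(1) by simp
    qed
  qed (auto simp: assms(2))
  also have "\<dots> = 0"
    by (simp add: assms(2) omit_append_Cons omit_Cons nth_append)
  finally show ?thesis .
qed

lemma alt_covec_linear:
  assumes "\<alpha> \<in> alt_covec k" "length xs + length ys + 1 = k"
  shows "linear (\<lambda>x. \<alpha> (xs @ x # ys))"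
proof -
  have "linear (\<lambda>z. \<alpha> (vs[i := z]))" if "length vs = k" "i < k" for vs i
    using assms(1) that by (auto simp: alt_covec_def)
  from this[of "xs @ undefined # ys" "length xs"] assms(2) show ?thesis by simp
qed

lemma alt_covec_alternating: "\<alpha> \<in> alt_covec k \<Longrightarrow> alternating k \<alpha>"
  unfolding alternating_def
  by (intro conjI allI impI) (simp add: alt_covec_linear[THEN linear_add], simp add: alt_covec_def)

lemma alt_covec_length: "\<alpha> \<in> alt_covec k \<Longrightarrow> length vs \<noteq> k \<Longrightarrow> \<alpha> vs = 0"
  by (auto simp: alt_covec_def)

lemma alt_covec_not_distinct: "\<alpha> \<in> alt_covec k \<Longrightarrow> \<not> distinct vs \<Longrightarrow> \<alpha> vs = 0"
  by (auto simp: alt_covec_def)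

text \<open>The sign rules carry a repetition at a distance to an adjacent one, so only the latter
  has to be checked.\<close>

lemma alt_covecI:
  fixes \<alpha> :: "'e::euclidean_space covec"
  assumes "\<And>vs. length vs \<noteq> k \<Longrightarrow> \<alpha> vs = 0"
    and lin: "\<And>xs ys. length xs + length ys + 1 = k \<Longrightarrow> linear (\<lambda>x. \<alpha> (xs @ x # ys))"
    and "\<And>xs x ys. length xs + length ys + 2 = k \<Longrightarrow> \<alpha> (xs @ x # x # ys) = 0"
  shows "\<alpha> \<in> alt_covec k"
proof -
  have "alternating k \<alpha>"
    unfolding alternating_def using lin[THEN linear_add] assms(3) by blast
  then have "\<alpha> vs = 0" if "\<not> distinct vs" for vs
    using alternating_not_distinct[of k \<alpha> vs] assms(1)[of vs] that by blast
  moreover have "linear (\<lambda>x. \<alpha> (vs[i := x]))" if "length vs = k" "i < k" for vs i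
    using lin[of "take i vs" "drop (Suc i) vs"] that by (simp add: upd_conv_take_nth_drop)
  ultimately show ?thesis using assms(1) by (auto simp: alt_covec_def)
qed

lemma alt_covec_add:
  assumes "\<alpha> \<in> alt_covec k" "\<beta> \<in> alt_covec k"
  shows "\<alpha> + \<beta> \<in> alt_covec k"
  unfolding plus_fun_def
proof (rule alt_covecI)
  show "linear (\<lambda>x. \<alpha> (xs @ x # ys) + \<beta> (xs @ x # ys))" if "length xs + length ys + 1 = k" for xs ys
    using assms[THEN alt_covec_linear, OF that] by (rule linear_compose_add)
qed (use assms in \<open>auto simp: alt_covec_length alt_covec_not_distinct\<close>)

lemma linear_mult_left: "linear f \<Longrightarrow> linear (\<lambda>x. (c::complex) * f x)"
  by (simp add: linear_iff distrib_left)

lemma alt_covec_scale: "\<alpha> \<in> alt_covec k \<Longrightarrow> covec_scale c \<alpha> \<in> alt_covec k"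
  unfolding covec_scale_def
  by (rule alt_covecI)
    (auto simp: alt_covec_length alt_covec_not_distinct intro!: linear_mult_left alt_covec_linear)

lemma alt_covec_zero: "0 \<in> alt_covec k"
  by (rule alt_covecI) (auto simp: linear_iff)

lemma alt_covec_sum: "(\<And>i. i \<in> S \<Longrightarrow> f i \<in> alt_covec k) \<Longrightarrow> sum f S \<in> alt_covec k"
  by (induction S rule: infinite_finite_induct) (auto simp: alt_covec_zero alt_covec_add)

lemma alt_covec_diff: "\<alpha> \<in> alt_covec k \<Longrightarrow> \<beta> \<in> alt_covec k \<Longrightarrow> \<alpha> - \<beta> \<in> alt_covec k"
  using alt_covec_add[OF _ alt_covec_scale[of \<beta> k "-1"], of \<alpha>]
  by (simp add: covec_scale_def fun_diff_def plus_fun_def)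

text \<open>Multilinearity reduces to arguments from \<open>es\<close>, and the sign rules to
  increasing ones. The sublists \<open>nths es I\<close> are the form in which
  \<open>hodge_covec\<close> evaluates its argument.\<close>

lemma alt_covec_eq_0I:
  fixes \<alpha> :: "'e::euclidean_space covec"
  assumes a: "\<alpha> \<in> alt_covec k" and sp: "span (set es) = UNIV" and d: "distinct es"
    and z: "\<And>I. I \<subseteq> {..<length es} \<Longrightarrow> card I = k \<Longrightarrow> \<alpha> (nths es I) = 0"
  shows "\<alpha> = 0"
proof -
  have base: "\<alpha> ys = 0" if ys: "set ys \<subseteq> set es" "length ys = k" for ys
  proof (cases "distinct ys")
    case True
    define I where "I = {i. i < length es \<and> es ! i \<in> set ys}"
    have s: "set (nths es I) = set ys"
      using ys(1) by (auto simp: set_nths I_def in_set_conv_nth subset_iff) (metis in_set_conv_nth)+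
    have m: "mset ys = mset (nths es I)"
      using s True d by (metis distinct_nthsI set_eq_iff_mset_eq_distinct)
    have "card I = length (nths es I)"
      by (simp add: length_nths I_def)
    also have "\<dots> = k" using m ys(2) by (metis size_mset)
    finally have "\<alpha> (nths es I) = 0" by (intro z) (auto simp: I_def)
    then show ?thesis
      using alternating_mset[OF alt_covec_alternating[OF a] m, of "[]"] ys(2) by auto
  qed (rule alt_covec_not_distinct[OF a])
  \<comment> \<open>The suffix \<open>ys\<close> already consists of members of \<open>es\<close>;
    each step moves the last entry of \<open>xs\<close> into it by linearity in that slot.\<close>
  have "\<alpha> (xs @ ys) = 0" if "length xs + length ys = k" "set ys \<subseteq> set es" for xs ys
    using that
  proof (induction xs arbitrary: ys rule: rev_induct)
    case (snoc x xs)
    have lin: "linear (\<lambda>x. \<alpha> (xs @ x # ys))"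
      using snoc.prems by (intro alt_covec_linear[OF a]) simp
    have "\<alpha> (xs @ x # ys) = 0"
    proof (rule linear_eq_0_on_span[OF lin])
      show "\<alpha> (xs @ b # ys) = 0" if "b \<in> set es" for b
        using snoc.IH[of "b # ys"] snoc.prems that by simp
    qed (simp add: sp)
    then show ?case by simp
  qed (simp add: base)
  from this[of _ "[]"] show ?thesis
    using alt_covec_length[OF a] by (auto simp: fun_eq_iff)
qed

text \<open>A basis has no k-element index set, so the criterion above holds vacuously. This is the
  source of the vanishing in degree 2m + 1.\<close>

lemma alt_covec_above_dim:
  fixes \<alpha> :: "'e::euclidean_space covec"
  assumes "\<alpha> \<in> alt_covec k" "DIM('e) < k"
  shows "\<alpha> = 0"
proof -
  obtain es :: "'e list" where es: "set es = Basis" "distinct es"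
    using finite_distinct_list[OF finite_Basis] by blast
  then have l: "length es = DIM('e)" by (metis distinct_card)
  show ?thesis
  proof (rule alt_covec_eq_0I[OF assms(1) _ es(2)])
    fix I assume "I \<subseteq> {..<length es}" "card I = k"
    then have "k \<le> length es" by (metis card_lessThan card_mono finite_lessThan)
    then show "\<alpha> (nths es I) = 0" using l assms(2) by simp
  qed (simp add: es)
qed

section \<open>Smooth functions\<close>

lemma frechet_derivative_cong_open:
  assumes "open S" "x \<in> S" "\<And>y. y \<in> S \<Longrightarrow> f y = g y"
  shows "frechet_derivative f (at x) = frechet_derivative g (at x)"
proof -
  have "(f has_derivative D) (at x) \<longleftrightarrow> (g has_derivative D) (at x)" for D
    using has_derivative_transform_within_open[of _ D x UNIV S] assms by metis
  then show ?thesis by (simp add: frechet_derivative_def)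
qed

lemma differentiable_cong_open:
  assumes "f differentiable (at x)" "open S" "x \<in> S" "\<And>y. y \<in> S \<Longrightarrow> f y = g y"
  shows "g differentiable (at x)"
  using assms has_derivative_transform_within_open[of f _ x UNIV S g] 
  unfolding differentiable_def by metis

lemma Ck_on_cong:
  assumes "Ck_on k S f" "open S" "\<And>x. x \<in> S \<Longrightarrow> f x = g x"
  shows "Ck_on k S g"
  using assms(1,3)
proof (induction k arbitrary: f g)
  case 0
  then show ?case using continuous_on_cong by (auto cong: continuous_on_cong)
next
  case (Suc k)
  have "g differentiable (at x)" if "x \<in> S" for x
    using differentiable_cong_open[OF _ assms(2) that Suc.prems(2)] Suc.prems(1) that by auto
  moreover have "Ck_on k S (\<lambda>x. frechet_derivative g (at x) v)" for v
  proof (rule Suc.IH)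
    show "Ck_on k S (\<lambda>x. frechet_derivative f (at x) v)" using Suc.prems by simp
    show "frechet_derivative f (at x) v = frechet_derivative g (at x) v" if "x \<in> S" for x
      using frechet_derivative_cong_open[OF assms(2) that Suc.prems(2)] by simp
  qed
  ultimately show ?case by simp
qed

lemma Ck_on_SucD: "Ck_on (Suc k) S f \<Longrightarrow> Ck_on k S f"
proof (induction k arbitrary: f)
  case 0
  then show ?case
    by (auto intro!: continuous_at_imp_continuous_on differentiable_imp_continuous_within)
qed auto

lemma Ck_on_const: "Ck_on k S (\<lambda>x. c)"
  by (induction k arbitrary: c) auto

text \<open>Lets a product or quotient rule supply the derivative \<open>D\<close> as a formula;
  uniqueness of derivatives identifies it with \<open>frechet_derivative\<close>, on which
  \<open>Ck_on\<close> recurses.\<close>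

lemma Ck_on_SucI:
  assumes "open S" "\<And>x. x \<in> S \<Longrightarrow> (f has_derivative D x) (at x)"
    and "\<And>v. Ck_on k S (\<lambda>x. D x v)"
  shows "Ck_on (Suc k) S f"
proof -
  have "frechet_derivative f (at x) v = D x v" if "x \<in> S" for x v
    using frechet_derivative_at[OF assms(2)[OF that]] by simp
  then have "Ck_on k S (\<lambda>x. frechet_derivative f (at x) v)" for v
    by (intro Ck_on_cong[OF assms(3)[of v] assms(1)]) simp
  then show ?thesis using assms(2) by (auto simp: differentiable_def)
qed

lemma Ck_on_add:
  assumes "open S"
  shows "Ck_on k S f \<Longrightarrow> Ck_on k S g \<Longrightarrow> Ck_on k S (\<lambda>x. f x + g x)"
proof (induction k arbitrary: f g)
  case (Suc k)
  show ?case
    by (rule Ck_on_SucI[OF assms, where D = "\<lambda>x v. frechet_derivative f (at x) v + frechet_derivative g (at x) v"])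
      (use Suc in \<open>auto intro!: has_derivative_add simp: frechet_derivative_works\<close>)
qed (auto intro: continuous_on_add)

lemma Ck_on_bounded_linear:
  assumes "open S" "bounded_linear h"
  shows "Ck_on k S f \<Longrightarrow> Ck_on k S (\<lambda>x. h (f x))"
proof (induction k arbitrary: f)
  case 0
  then show ?case using assms(2) by (auto intro: bounded_linear.continuous_on)
next
  case (Suc k)
  show ?case
    by (rule Ck_on_SucI[OF assms(1), where D = "\<lambda>x v. h (frechet_derivative f (at x) v)"])
      (use Suc in \<open>auto intro!: bounded_linear.has_derivative[OF assms(2)] simp: frechet_derivative_works\<close>)
qed

lemma Ck_on_mult:
  fixes f g :: "'e::euclidean_space \<Rightarrow> 'b::real_normed_algebra"
  assumes "open S"
  shows "Ck_on k S f \<Longrightarrow> Ck_on k S g \<Longrightarrow> Ck_on k S (\<lambda>x. f x * g x)"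
proof (induction k arbitrary: f g)
  case (Suc k)
  have "Ck_on k S f" "Ck_on k S g" using Suc.prems Ck_on_SucD by blast+
  then show ?case
    by (intro Ck_on_SucI[OF assms, where D = "\<lambda>x v. f x * frechet_derivative g (at x) v + frechet_derivative f (at x) v * g x"])
      (use Suc in \<open>auto intro!: has_derivative_mult Ck_on_add assms simp: frechet_derivative_works\<close>)
qed (auto intro: continuous_on_mult)

text \<open>Besides f', the derivative of 1/f involves only 1/f itself, which is of class k by the
  induction hypothesis.\<close>

lemma Ck_on_inverse:
  fixes f :: "'e::euclidean_space \<Rightarrow> 'b::real_normed_field"
  assumes "open S" "\<And>x. x \<in> S \<Longrightarrow> f x \<noteq> 0"
  shows "Ck_on k S f \<Longrightarrow> Ck_on k S (\<lambda>x. inverse (f x))"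
proof (induction k)
  case (Suc k)
  have "Ck_on k S (\<lambda>x. inverse (f x))" using Suc Ck_on_SucD by blast
  moreover have "Ck_on k S (\<lambda>x. frechet_derivative f (at x) v)" for v using Suc by simp
  ultimately show ?case
    by (intro Ck_on_SucI[OF assms(1), where D = "\<lambda>x v. - (inverse (f x) * frechet_derivative f (at x) v * inverse (f x))"])
      (use Suc assms in \<open>auto intro!: has_derivative_inverse Ck_on_bounded_linear[where h = uminus] Ck_on_mult bounded_linear_minus bounded_linear_ident simp: frechet_derivative_works\<close>)
qed (use assms(2) in \<open>auto intro!: continuous_on_inverse\<close>)

lemma smooth_on_cong:
  "smooth_on S f \<Longrightarrow> open S \<Longrightarrow> (\<And>x. x \<in> S \<Longrightarrow> f x = g x) \<Longrightarrow> smooth_on S g"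
  unfolding smooth_on_def using Ck_on_cong by blast

lemma smooth_on_const: "smooth_on S (\<lambda>x. c)"
  by (simp add: smooth_on_def Ck_on_const)

lemma smooth_on_add:
  "open S \<Longrightarrow> smooth_on S f \<Longrightarrow> smooth_on S g \<Longrightarrow> smooth_on S (\<lambda>x. f x + g x)"
  by (simp add: smooth_on_def Ck_on_add)

lemma smooth_on_mult:
  fixes f g :: "'e::euclidean_space \<Rightarrow> 'b::real_normed_algebra"
  shows "open S \<Longrightarrow> smooth_on S f \<Longrightarrow> smooth_on S g \<Longrightarrow> smooth_on S (\<lambda>x. f x * g x)"
  by (simp add: smooth_on_def Ck_on_mult)

lemma smooth_on_inverse:
  fixes f :: "'e::euclidean_space \<Rightarrow> 'b::real_normed_field"
  shows "open S \<Longrightarrow> smooth_on S f \<Longrightarrow> (\<And>x. x \<in> S \<Longrightarrow> f x \<noteq> 0) \<Longrightarrow> smooth_on S (\<lambda>x. inverse (f x))"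
  by (simp add: smooth_on_def Ck_on_inverse)

lemma smooth_on_bounded_linear:
  "open S \<Longrightarrow> bounded_linear h \<Longrightarrow> smooth_on S f \<Longrightarrow> smooth_on S (\<lambda>x. h (f x))"
  by (simp add: smooth_on_def Ck_on_bounded_linear)

lemma smooth_on_sum:
  "open S \<Longrightarrow> (\<And>i. i \<in> I \<Longrightarrow> smooth_on S (f i)) \<Longrightarrow> smooth_on S (\<lambda>x. \<Sum>i\<in>I. f i x)"
  by (induction I rule: infinite_finite_induct) (auto intro: smooth_on_const smooth_on_add)

lemma smooth_on_frechet_derivative:
  "smooth_on S f \<Longrightarrow> smooth_on S (\<lambda>x. frechet_derivative f (at x) v)"
  unfolding smooth_on_def by (metis Ck_on.simps(2))

lemma smooth_on_differentiable: "smooth_on S f \<Longrightarrow> x \<in> S \<Longrightarrow> f differentiable (at x)"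
  unfolding smooth_on_def by (metis Ck_on.simps(2))

lemma smooth_on_continuous: "smooth_on S f \<Longrightarrow> continuous_on S f"
  unfolding smooth_on_def by (metis Ck_on.simps(1))

section \<open>Pfaffians\<close>

lemma nth_omit:
  "i < length xs \<Longrightarrow> k < length xs - 1 \<Longrightarrow> omit i xs ! k = (if k < i then xs ! k else xs ! Suc k)"
  by (auto simp: omit_def nth_append min_def)

text \<open>Once entry j is gone, position k \<ge> j of the shorter list is position k + 1 of the
  original.\<close>

lemma omit_omit:
  assumes "j \<le> k" "Suc k < length xs"
  shows "omit k (omit j xs) = omit j (omit (Suc k) xs)"
  using assms by (intro nth_equalityI) (auto simp: nth_omit)

lemma length_omit_le: "length (omit i xs) \<le> length xs"
  by (simp add: omit_def)

text \<open>The Pfaffian of the matrix of values w(v_i, v_j), which for an alternating bilinear w is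
  the value of w^m / m! on 2m vectors. On lists of odd length the recursion ends in an empty sum, so
  the value is 0.\<close>

function pf :: "('b \<Rightarrow> 'b \<Rightarrow> complex) \<Rightarrow> 'b list \<Rightarrow> complex" where
  "pf w [] = 1"
| "pf w (v # vs) = (\<Sum>j<length vs. (- 1) ^ j * (w v (vs ! j) * pf w (omit j vs)))"
  by pat_completeness auto
termination
  by (relation "Wellfounded.measure (length \<circ> snd)") (auto simp: le_imp_less_Suc length_omit_le)

lemma pf_map: "pf w (map f vs) = pf (\<lambda>x y. w (f x) (f y)) vs"
proof (induction "\<lambda>x y. w (f x) (f y)" vs rule: pf.induct)
  case (2 v vs)
  then show ?case by (simp add: map_omit[symmetric])
qed simp

lemma linear_mult_right: "linear f \<Longrightarrow> linear (\<lambda>x. f x * (c::complex))"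
  by (simp add: linear_iff distrib_right)

text \<open>In each summand x is either the extracted entry, where \<open>f2\<close> applies, or
  still in the remaining list, where \<open>f1\<close> applies. Serves Pfaffians and the exterior
  derivative alike.\<close>

lemma linear_sum_omit:
  fixes f :: "'e::euclidean_space \<Rightarrow> 'e list \<Rightarrow> complex"
  assumes f1: "\<And>u xs ys. length xs + length ys + 1 = k \<Longrightarrow> linear (\<lambda>x. f u (xs @ x # ys))"
    and f2: "\<And>us. linear (\<lambda>u. f u us)" and k: "length xs + length ys = k"
  shows "linear (\<lambda>x. \<Sum>i<length (xs @ x # ys). (- 1) ^ i * f ((xs @ x # ys) ! i) (omit i (xs @ x # ys)))"
proof -
  have "linear (\<lambda>x. (- 1) ^ i * f ((xs @ x # ys) ! i) (omit i (xs @ x # ys)))" if i: "i < k + 1" for i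
  proof -
    define d where "d = i - length xs - 1"
    consider "i < length xs" | "i = length xs" | "i = length xs + Suc d" "d < length ys"
      using i k unfolding d_def by fastforce
    then show ?thesis
    proof cases
      case 1
      then have "linear (\<lambda>x. f (xs ! i) (omit i xs @ x # ys))" using k by (intro f1) simp
      then show ?thesis using 1
        by (auto simp: nth_append omit_append_Cons intro!: linear_mult_left)
    next
      case 2
      then show ?thesis
        by (auto simp: nth_append omit_append_Cons intro!: linear_mult_left f2)
    next
      case 3
      then have "linear (\<lambda>x. f (ys ! d) (xs @ x # omit d ys))" using k by (intro f1) simp
      then show ?thesis using 3
        by (auto simp: nth_append omit_append_Cons intro!: linear_compose_neg linear_mult_left)
    qed
  qed
  then have "linear (\<lambda>x. \<Sum>i<k + 1. (- 1) ^ i * f ((xs @ x # ys) ! i) (omit i (xs @ x # ys)))"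
    by (intro linear_compose_sum) simp
  then show ?thesis using k by simp
qed

lemma linear_pf:
  fixes w :: "'e::euclidean_space \<Rightarrow> 'e \<Rightarrow> complex"
  assumes l1: "\<And>y. linear (\<lambda>x. w x y)" and l2: "\<And>x. linear (w x)"
  shows "linear (\<lambda>x. pf w (xs @ x # ys))"
proof (induction "length xs + length ys" arbitrary: xs ys rule: less_induct)
  case less
  show ?case
  proof (cases xs)
    case Nil
    then show ?thesis
      by (auto intro!: linear_compose_sum linear_mult_left linear_mult_right l1)
  next
    case (Cons z zs)
    have "linear (\<lambda>x. \<Sum>i<length (zs @ x # ys). (- 1) ^ i *
       (w z ((zs @ x # ys) ! i) * pf w (omit i (zs @ x # ys))))"
      by (rule linear_sum_omit[where f = "\<lambda>u l. w z u * pf w l" and k = "length zs + length ys"])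
        (use less Cons in \<open>auto intro: linear_mult_left linear_mult_right l2\<close>)
    then show ?thesis using Cons by simp
  qed
qed

text \<open>Deleting two entries in either order leaves the same list and the same product of values
  of \<open>a\<close>, with opposite signs: the cancellation behind the boundary of a
  boundary.\<close>

lemma sum_omit_omit_eq_0:
  fixes a :: "'b \<Rightarrow> complex"
  shows "(\<Sum>j<length ys. (- 1) ^ j * (a (ys ! j) *
     (\<Sum>k<length ys - 1. (- 1) ^ k * (a (omit j ys ! k) * q (omit k (omit j ys)))))) = 0"
proof -
  let ?n = "length ys"
  define T where "T = (\<lambda>(j, k). (- 1) ^ (j + k) * (a (ys ! j) * a (omit j ys ! k)) * q (omit k (omit j ys)))"
  let ?A = "{(j, k). j < ?n \<and> k < ?n - 1 \<and> k < j}" and ?B = "{(j, k). j < ?n \<and> k < ?n - 1 \<and> j \<le> k}"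
  have fin: "finite ?A" "finite ?B"
    by (rule finite_subset[of _ "{..<?n} \<times> {..<?n - 1}"], auto)+
  have "(\<Sum>j<?n. (- 1) ^ j * (a (ys ! j) * (\<Sum>k<?n - 1. (- 1) ^ k * (a (omit j ys ! k) * q (omit k (omit j ys)))))) =
     (\<Sum>j<?n. \<Sum>k<?n - 1. T (j, k))"
    by (simp add: T_def sum_distrib_left power_add mult_ac)
  also have "\<dots> = sum T ({..<?n} \<times> {..<?n - 1})"
    by (simp add: sum.cartesian_product)
  also have "{..<?n} \<times> {..<?n - 1} = ?A \<union> ?B" by auto
  also have "sum T (?A \<union> ?B) = sum T ?A + sum T ?B"
    by (rule sum.union_disjoint[OF fin]) auto
  \<comment> \<open>Deletions (j, k) with j \<le> k correspond to (k + 1, j): entry k of the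
    shortened list is entry k + 1 of the full one, and the exponent of -1 changes by one.\<close>
  also have "sum T ?B = (\<Sum>p\<in>?A. - T p)"
  proof (rule sum.reindex_bij_witness[where j = "\<lambda>(j, k). (Suc k, j)" and i = "\<lambda>(j, k). (k, j - 1)"])
    fix p assume p: "p \<in> ?B"
    then obtain j k where "p = (j, k)" "j \<le> k" "Suc k < ?n" by auto
    then show "- T (case p of (j, k) \<Rightarrow> (Suc k, j)) = T p"
      by (simp add: T_def nth_omit omit_omit mult_ac add_ac)
  qed auto
  also have "sum T ?A + (\<Sum>p\<in>?A. - T p) = 0" by (simp add: sum_negf)
  finally show ?thesis .
qed

text \<open>A repetition behind the first argument survives in all but two terms of the expansion,
  and those two cancel. A repetition at the front is invisible after one expansion and needs a
  second.\<close>

lemma pf_alt_covec: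
  fixes w :: "'e::euclidean_space \<Rightarrow> 'e \<Rightarrow> complex"
  assumes l1: "\<And>y. linear (\<lambda>x. w x y)" and l2: "\<And>x. linear (w x)" and z: "\<And>x. w x x = 0"
  shows "(\<lambda>vs. if length vs = k then pf w vs else 0) \<in> alt_covec k"
proof (induction k rule: less_induct)
  case (less k)
  have "pf w (xs @ x # x # ys) = 0" if k: "length xs + length ys + 2 = k" for xs ys x
  proof (cases xs)
    case Nil
    let ?f = "\<lambda>j. (- 1) ^ j * (w x ((x # ys) ! j) * pf w (omit j (x # ys)))"
    \<comment> \<open>The term j = 0 vanishes by \<open>z\<close>. In the others the second x leads
      the remaining list, so expanding again gives an antisymmetric double sum.\<close>
    have "pf w (x # x # ys) = (\<Sum>j<length ys. ?f (Suc j))"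
      by (simp add: sum.lessThan_Suc_shift z del: sum.lessThan_Suc)
    also have "\<dots> = - (\<Sum>j<length ys. (- 1) ^ j * (w x (ys ! j) *
        (\<Sum>k<length ys - 1. (- 1) ^ k * (w x (omit j ys ! k) * pf w (omit k (omit j ys))))))"
      by (simp add: omit_Cons sum_negf[symmetric] del: sum.lessThan_Suc)
    also have "\<dots> = 0" by (subst sum_omit_omit_eq_0) simp
    finally show ?thesis using Nil by simp
  next
    case (Cons u us)
    have "pf w l = 0" if "\<not> distinct l" "length l = length us + length ys + 1" for l
      using less.IH[of "length l"] alt_covec_not_distinct[of _ "length l" l] that k Cons by fastforce
    then show ?thesis
      using sum_omit_adjacent_eq_0[of us ys "\<lambda>v l. w u v * pf w l" "us @ x # x # ys" x] Cons by simp
  qed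
  then show ?case
    by (intro alt_covecI) (simp_all add: linear_pf[OF l1 l2])
qed

text \<open>Along the first entry only its partner contributes, and removing the pair leaves the
  same pattern. The expansion only ever reads rows of even index and entries to their right.\<close>

lemma pf_frame:
  assumes "length es = 2 * m"
    and "\<And>i j. i < m \<Longrightarrow> 2 * i < j \<Longrightarrow> j < 2 * m \<Longrightarrow> w (es ! (2 * i)) (es ! j) = (if j = 2 * i + 1 then 1 else 0)"
  shows "pf w es = 1"
  using assms
proof (induction m arbitrary: es)
  case (Suc m)
  then obtain a b r where es: "es = a # b # r" "length r = 2 * m"
    by (auto simp: length_Suc_conv numeral_2_eq_2)
  have z: "w a (r ! j) = 0" if "j < length r" for j
    using Suc.prems(2)[of 0 "Suc (Suc j)"] that es by simp
  have "w a b = 1" using Suc.prems(2)[of 0 1] es by simp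
  moreover have "pf w r = 1"
  proof (rule Suc.IH[OF es(2)])
    fix i j assume "i < m" "2 * i < j" "j < 2 * m"
    then show "w (r ! (2 * i)) (r ! j) = (if j = 2 * i + 1 then 1 else 0)"
      using Suc.prems(2)[of "Suc i" "Suc (Suc j)"] es by simp
  qed
  ultimately show ?case
    by (simp add: es sum.lessThan_Suc_shift z omit_Cons del: sum.lessThan_Suc)
qed simp

section \<open>Wedge products as determinants\<close>

text \<open>For each permutation exactly one factor sees slot x. The covectors are arbitrary
  functions here, so that the lemma also applies with vectors and covectors exchanged.\<close>

lemma wedge_expand_slot:
  assumes "length \<theta>s = length xs + length ys + 1"
  shows "\<exists>c \<iota>. (\<forall>\<sigma>. \<sigma> permutes {..<length \<theta>s} \<longrightarrow> \<iota> \<sigma> < length \<theta>s) \<and>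
     (\<forall>x. wedge \<theta>s (xs @ x # ys) = (\<Sum>\<sigma> | \<sigma> permutes {..<length \<theta>s}. c \<sigma> * (\<theta>s ! \<iota> \<sigma>) x))"
proof -
  let ?n = "length \<theta>s" and ?a = "length xs"
  \<comment> \<open>The factor that sees slot \<open>length xs\<close> is the one whose index
    \<sigma> sends there. The value \<open>undefined\<close> in \<open>c\<close> is never evaluated,
    because that factor is left out.\<close>
  define \<iota> where "\<iota> \<sigma> = inv \<sigma> ?a" for \<sigma> :: "nat \<Rightarrow> nat"
  define c where "c \<sigma> = of_int (sign \<sigma>) * (\<Prod>i\<in>{..<?n} - {\<iota> \<sigma>}. (\<theta>s ! i) ((xs @ undefined # ys) ! \<sigma> i))" for \<sigma>
  have \<iota>: "\<iota> \<sigma> < ?n" if "\<sigma> permutes {..<?n}" for \<sigma>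
    using permutes_in_image[OF permutes_inv[OF that], of ?a] assms by (simp add: \<iota>_def)
  have "wedge \<theta>s (xs @ x # ys) = (\<Sum>\<sigma> | \<sigma> permutes {..<?n}. c \<sigma> * (\<theta>s ! \<iota> \<sigma>) x)" for x
  proof -
    have "(\<Prod>i<?n. (\<theta>s ! i) ((xs @ x # ys) ! \<sigma> i)) =
       (\<theta>s ! \<iota> \<sigma>) x * (\<Prod>i\<in>{..<?n} - {\<iota> \<sigma>}. (\<theta>s ! i) ((xs @ undefined # ys) ! \<sigma> i))"
      if \<sigma>: "\<sigma> permutes {..<?n}" for \<sigma>
    proof -
      have a: "\<sigma> (\<iota> \<sigma>) = ?a" using \<sigma> by (simp add: \<iota>_def permutes_inverses)
      have "(\<theta>s ! i) ((xs @ x # ys) ! \<sigma> i) = (\<theta>s ! i) ((xs @ undefined # ys) ! \<sigma> i)" if "i \<noteq> \<iota> \<sigma>" for i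
      proof -
        have "\<sigma> i \<noteq> ?a" using a that permutes_inj[OF \<sigma>] by (metis injD)
        then show ?thesis by (auto simp: nth_append nth_Cons')
      qed
      then show ?thesis
        using \<iota>[OF \<sigma>] a by (subst prod.remove[of _ "\<iota> \<sigma>"]) (auto intro!: prod.cong)
    qed
    then show ?thesis
      using assms by (simp add: wedge_def c_def mult_ac)
  qed
  with \<iota> show ?thesis by blast
qed

text \<open>Composition with the transposition of two positions carrying equal entries is a
  sign-reversing bijection of the permutations.\<close>

lemma wedge_not_distinct:
  assumes "\<not> distinct vs"
  shows "wedge \<theta>s vs = 0"
proof (cases "length vs = length \<theta>s")
  case True
  let ?n = "length \<theta>s"
  obtain a b where ab: "a < ?n" "b < ?n" "a \<noteq> b" "vs ! a = vs ! b"
    using assms True by (auto simp: distinct_conv_nth)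
  let ?f = "\<lambda>\<sigma>. of_int (sign \<sigma>) * (\<Prod>i<?n. (\<theta>s ! i) (vs ! \<sigma> i)) :: complex"
  let ?t = "Transposition.transpose a b"
  have t: "?t permutes {..<?n}" using ab by (intro permutes_swap_id) auto
  have nt: "vs ! ?t k = vs ! k" for k using ab(4) by (auto simp: Transposition.transpose_def)
  have "sum ?f {\<sigma>. \<sigma> permutes {..<?n}} = (\<Sum>\<sigma> | \<sigma> permutes {..<?n}. ?f (?t \<circ> \<sigma>))"
    by (rule setum_permutations_compose_left[OF t])
  also have "\<dots> = (\<Sum>\<sigma> | \<sigma> permutes {..<?n}. - ?f \<sigma>)"
  proof (rule sum.cong[OF refl])
    fix \<sigma> assume "\<sigma> \<in> {\<sigma>. \<sigma> permutes {..<?n}}"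
    then have "permutation \<sigma>" using permutation_permutes by blast
    then have "sign (?t \<circ> \<sigma>) = - sign \<sigma>"
      using ab(3) by (simp add: sign_compose sign_swap_id permutation_swap_id)
    then show "?f (?t \<circ> \<sigma>) = - ?f \<sigma>" by (simp add: nt)
  qed
  finally have "sum ?f {\<sigma>. \<sigma> permutes {..<?n}} = 0" by (simp add: sum_negf)
  then show ?thesis using True by (simp add: wedge_def)
qed (simp add: wedge_def)

text \<open>Invariance of determinants under transposition; a vector is read as the evaluation
  functional on 1-covectors. This turns facts about vector slots into facts about covector
  slots.\<close>

lemma wedge_transpose: "wedge \<theta>s vs = wedge (map (\<lambda>v \<theta>. \<theta> v) vs) \<theta>s"
proof (cases "length vs = length \<theta>s")
  case True
  let ?n = "length \<theta>s"
  have "(\<Sum>\<sigma> | \<sigma> permutes {..<?n}. of_int (sign \<sigma>) * (\<Prod>i<?n. (\<theta>s ! i) (vs ! \<sigma> i))) =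
     (\<Sum>\<sigma> | \<sigma> permutes {..<?n}. of_int (sign (inv \<sigma>)) * (\<Prod>i<?n. (\<theta>s ! i) (vs ! inv \<sigma> i)))"
    by (rule sum_permutations_inverse)
  also have "\<dots> = (\<Sum>\<sigma> | \<sigma> permutes {..<?n}. of_int (sign \<sigma>) * (\<Prod>i<?n. (\<theta>s ! \<sigma> i) (vs ! i)) :: complex)"
  proof (rule sum.cong[OF refl])
    fix \<sigma> assume "\<sigma> \<in> {\<sigma>. \<sigma> permutes {..<?n}}"
    then have \<sigma>: "\<sigma> permutes {..<?n}" by simp
    have "sign (inv \<sigma>) = sign \<sigma>" using \<sigma> permutation_permutes by (metis finite_lessThan sign_inverse)
    moreover have "(\<Prod>i<?n. (\<theta>s ! i) (vs ! inv \<sigma> i)) = (\<Prod>i<?n. (\<theta>s ! \<sigma> i) (vs ! i))"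
      by (subst prod.permute[OF \<sigma>]) (simp add: permutes_inverses[OF \<sigma>])
    ultimately show "of_int (sign (inv \<sigma>)) * (\<Prod>i<?n. (\<theta>s ! i) (vs ! inv \<sigma> i)) =
        (of_int (sign \<sigma>) * (\<Prod>i<?n. (\<theta>s ! \<sigma> i) (vs ! i)) :: complex)" by simp
  qed
  finally show ?thesis using True by (simp add: wedge_def)
qed (simp add: wedge_def)

section \<open>Wedge products and bidegree\<close>

lemma sum_fun_apply: "sum f S x = (\<Sum>i\<in>S. f i x)"
  by (induction S rule: infinite_finite_induct) auto

lemma wedge_alt_covec:
  fixes \<theta>s :: "('e::euclidean_space \<Rightarrow> complex) list"
  assumes "\<And>\<theta>. \<theta> \<in> set \<theta>s \<Longrightarrow> linear \<theta>"
  shows "wedge \<theta>s \<in> alt_covec (length \<theta>s)"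
proof (rule alt_covecI)
  fix xs ys :: "'e list" assume "length xs + length ys + 1 = length \<theta>s"
  from wedge_expand_slot[OF this[symmetric]] obtain c \<iota> where \<iota>: "\<forall>\<sigma>. \<sigma> permutes {..<length \<theta>s} \<longrightarrow> \<iota> \<sigma> < length \<theta>s"
    and eq: "\<forall>x. wedge \<theta>s (xs @ x # ys) = (\<Sum>\<sigma> | \<sigma> permutes {..<length \<theta>s}. c \<sigma> * (\<theta>s ! \<iota> \<sigma>) x)"
    by (elim exE conjE)
  show "linear (\<lambda>x. wedge \<theta>s (xs @ x # ys))"
    unfolding eq[rule_format] using \<iota> assms by (auto intro!: linear_compose_sum linear_mult_left)
qed (simp add: wedge_def, simp add: wedge_not_distinct)

lemma wedge_add_slot:
  assumes "length vs = length xs + length ys + 1"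
  shows "wedge (xs @ (\<theta> + \<eta>) # ys) vs = wedge (xs @ \<theta> # ys) vs + wedge (xs @ \<eta> # ys) vs"
proof -
  let ?vs = "map (\<lambda>v \<theta>. \<theta> v) vs :: (('a \<Rightarrow> complex) \<Rightarrow> complex) list"
  have "length ?vs = length xs + length ys + 1" using assms by simp
  from wedge_expand_slot[OF this] obtain c \<iota> where
    \<iota>: "\<forall>\<sigma>. \<sigma> permutes {..<length ?vs} \<longrightarrow> \<iota> \<sigma> < length ?vs"
    and eq: "\<forall>x. wedge ?vs (xs @ x # ys) = (\<Sum>\<sigma> | \<sigma> permutes {..<length ?vs}. c \<sigma> * (?vs ! \<iota> \<sigma>) x)"
    by (elim exE conjE)
  have "(?vs ! \<iota> \<sigma>) (\<theta> + \<eta>) = (?vs ! \<iota> \<sigma>) \<theta> + (?vs ! \<iota> \<sigma>) \<eta>"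
    if "\<sigma> permutes {..<length ?vs}" for \<sigma>
    using \<iota> that by simp
  then show ?thesis
    unfolding wedge_transpose[of _ vs] eq[rule_format] by (simp add: distrib_left sum.distrib)
qed

lemma alternating_wedge: "alternating (length vs) (\<lambda>\<theta>s. wedge \<theta>s vs)"
  unfolding alternating_def
proof (intro conjI allI impI)
  fix xs ys :: "('a \<Rightarrow> complex) list" and x
  have "wedge (map (\<lambda>v \<theta>. \<theta> v) vs) (xs @ x # x # ys) = 0"
    by (rule wedge_not_distinct) simp
  then show "wedge (xs @ x # x # ys) vs = 0" by (subst wedge_transpose)
qed (simp add: wedge_add_slot)

lemma wedge_dual_self:
  assumes "\<And>x y. x \<in> set xs \<Longrightarrow> y \<in> set xs \<Longrightarrow> d x y = (if x = y then 1 else 0)" "distinct xs"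
  shows "wedge (map d xs) xs = 1"
proof -
  let ?n = "length xs"
  have "(\<Prod>i<?n. (map d xs ! i) (xs ! \<sigma> i)) = (if \<sigma> = id then 1 else 0)"
    if "\<sigma> permutes {..<?n}" for \<sigma>
  proof (cases "\<sigma> = id")
    case True
    then show ?thesis using assms by simp
  next
    case False
    then obtain i where i: "\<sigma> i \<noteq> i" by (auto simp: fun_eq_iff)
    then have i: "i < ?n" "\<sigma> i \<noteq> i" using permutes_not_in[OF that, of i] by auto
    have si: "\<sigma> i < ?n" using permutes_in_image[OF that, of i] i by simp
    have "(map d xs ! i) (xs ! \<sigma> i) = 0"
      using assms i si by (simp add: nth_eq_iff_index_eq)
    then show ?thesis using i False by (auto intro!: prod_zero)
  qed
  then have "wedge (map d xs) xs = (\<Sum>\<sigma> | \<sigma> permutes {..<?n}. if \<sigma> = id then 1 else 0)"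
    unfolding wedge_def by (auto intro!: sum.cong)
  also have "\<dots> = 1" by (simp add: sum.delta' finite_permutations permutes_id)
  finally show ?thesis .
qed

text \<open>Some covector in the list is dual to a vector missing from \<open>ys\<close>, so it
  kills every entry and each product contains a zero.\<close>

lemma wedge_dual_other:
  assumes d: "\<And>x y. x \<in> set xs \<Longrightarrow> y \<in> set ys \<Longrightarrow> d x y = (if x = y then 1 else 0)"
    and l: "length xs = length ys" and n: "\<not> set xs \<subseteq> set ys"
  shows "wedge (map d xs) ys = 0"
proof -
  obtain i where i: "i < length xs" "xs ! i \<notin> set ys"
    using n by (auto simp: in_set_conv_nth subset_iff)
  have "(\<Prod>i<length xs. (map d xs ! i) (ys ! \<sigma> i)) = 0" if "\<sigma> permutes {..<length xs}" for \<sigma>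
  proof -
    have "\<sigma> i < length ys" using permutes_in_image[OF that, of i] i l by simp
    then have m: "ys ! \<sigma> i \<in> set ys" by simp
    then have "xs ! i \<noteq> ys ! \<sigma> i" using i(2) by metis
    then have "(map d xs ! i) (ys ! \<sigma> i) = 0"
      using d[OF nth_mem[OF i(1)] m] i(1) by simp
    then show ?thesis using i by (auto intro!: prod_zero)
  qed
  then show ?thesis unfolding wedge_def by (auto intro!: sum.neutral)
qed

lemma set_nths_subset_imp:
  assumes "distinct es" "I \<subseteq> {..<length es}" "set (nths es I) \<subseteq> set (nths es K)"
  shows "I \<subseteq> K"
proof
  fix i assume i: "i \<in> I"
  then have "i < length es" using assms(2) by auto
  then have "es ! i \<in> set (nths es K)" using i assms(3) by (auto simp: set_nths)
  then show "i \<in> K" using \<open>i < length es\<close> assms(1) by (auto simp: set_nths nth_eq_iff_index_eq)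
qed

lemma length_nths_card: "I \<subseteq> {..<length es} \<Longrightarrow> length (nths es I) = card I"
  by (simp add: length_nths) (intro arg_cong[of _ _ card], auto)

text \<open>Both sides agree on increasing lists of basis vectors by duality. The purpose is to
  reach wedges of single 1-covectors, which can be split by type.\<close>

lemma alt_covec_eq_sum_wedge:
  fixes \<alpha> :: "'e::euclidean_space covec"
  assumes a: "\<alpha> \<in> alt_covec k" and es: "set es = Basis" "distinct es"
  shows "\<alpha> = (\<Sum>I | I \<subseteq> {..<length es} \<and> card I = k.
     covec_scale (\<alpha> (nths es I)) (wedge (map (\<lambda>e v. complex_of_real (e \<bullet> v)) (nths es I))))"
    (is "\<alpha> = ?S")
proof -
  let ?d = "\<lambda>e v. complex_of_real (e \<bullet> v)"
  let ?C = "{I. I \<subseteq> {..<length es} \<and> card I = k}"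
  have d: "?d x y = (if x = y then 1 else 0)" if "x \<in> set (nths es I)" "y \<in> set (nths es K)" for x y I K
    using in_set_nthsD[OF that(1)] in_set_nthsD[OF that(2)] es(1) by (simp add: inner_Basis)
  have len: "length (nths es I) = k" if "I \<in> ?C" for I
    using that by (simp add: length_nths_card)
  have lin: "linear (?d x)" for x :: 'e
    by (simp add: linear_iff inner_add_right scaleR_conv_of_real)
  have S: "?S \<in> alt_covec k"
  proof (intro alt_covec_sum alt_covec_scale)
    fix I assume "I \<in> ?C"
    then have "length (map ?d (nths es I)) = k" using len by simp
    then show "wedge (map ?d (nths es I)) \<in> alt_covec k"
      using wedge_alt_covec[of "map ?d (nths es I)"] lin by auto
  qed
  have "\<alpha> - ?S = 0"
  proof (rule alt_covec_eq_0I[OF alt_covec_diff[OF a S] _ es(2)])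
    fix K assume K: "K \<subseteq> {..<length es}" "card K = k"
    have fin: "finite ?C" by (rule finite_subset[of _ "Pow {..<length es}"]) auto
    have w: "wedge (map ?d (nths es I)) (nths es K) = (if I = K then 1 else 0)" if I: "I \<in> ?C" for I
    proof (cases "I = K")
      case True
      then show ?thesis using wedge_dual_self[of "nths es K" ?d] d es(2) by simp
    next
      case False
      have "\<not> I \<subseteq> K" 
        using False I K card_subset_eq[of K I] finite_subset[OF K(1)] by auto
      then have "\<not> set (nths es I) \<subseteq> set (nths es K)"
        using set_nths_subset_imp[OF es(2)] I by blast
      then show ?thesis
        using False wedge_dual_other[of "nths es I" "nths es K" ?d] d I K by (simp add: length_nths_card)
    qed
    have "?S (nths es K) = (\<Sum>I\<in>?C. \<alpha> (nths es I) * wedge (map ?d (nths es I)) (nths es K))"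
      unfolding sum_fun_apply covec_scale_def ..
    also have "\<dots> = (\<Sum>I\<in>?C. if I = K then \<alpha> (nths es K) else 0)"
      by (rule sum.cong) (auto simp: w)
    also have "\<dots> = \<alpha> (nths es K)" using fin K by simp
    finally show "(\<alpha> - ?S) (nths es K) = 0" by simp
  qed (simp add: es)
  then show ?thesis by simp
qed

section \<open>Bidegree and the action of J on covectors\<close>

text \<open>The covectors that have a decomposition of the kind \<open>J_covec\<close> ranges over;
  the aim is to reach all of \<open>alt_covec k\<close>. Uniqueness of the result is settled
  separately, through \<open>covec_pq_map\<close>.\<close>

definition bideg_sum :: "('e::euclidean_space \<Rightarrow> 'e) \<Rightarrow> nat \<Rightarrow> 'e covec set" where
  "bideg_sum J k = {\<alpha>. \<exists>a. (\<forall>p\<le>k. a p \<in> covec_pq J p (k - p)) \<and> \<alpha> = (\<Sum>p\<le>k. a p)}"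

lemma bideg_sum_add:
  assumes "\<alpha> \<in> bideg_sum J k" "\<beta> \<in> bideg_sum J k"
  shows "\<alpha> + \<beta> \<in> bideg_sum J k"
proof -
  obtain a b where "\<forall>p\<le>k. a p \<in> covec_pq J p (k - p)" "\<alpha> = (\<Sum>p\<le>k. a p)"
    "\<forall>p\<le>k. b p \<in> covec_pq J p (k - p)" "\<beta> = (\<Sum>p\<le>k. b p)"
    using assms unfolding bideg_sum_def by blast
  then have "(\<forall>p\<le>k. a p + b p \<in> covec_pq J p (k - p)) \<and> \<alpha> + \<beta> = (\<Sum>p\<le>k. a p + b p)"
    unfolding covec_pq_def by (simp add: covec.span_add sum.distrib)
  then show ?thesis unfolding bideg_sum_def by (intro CollectI exI[of _ "\<lambda>p. a p + b p"])
qed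

lemma bideg_sum_scale:
  assumes "\<alpha> \<in> bideg_sum J k"
  shows "covec_scale c \<alpha> \<in> bideg_sum J k"
proof -
  obtain a where "\<forall>p\<le>k. a p \<in> covec_pq J p (k - p)" "\<alpha> = (\<Sum>p\<le>k. a p)"
    using assms unfolding bideg_sum_def by blast
  then have "(\<forall>p\<le>k. covec_scale c (a p) \<in> covec_pq J p (k - p)) \<and>
      covec_scale c \<alpha> = (\<Sum>p\<le>k. covec_scale c (a p))"
    unfolding covec_pq_def by (simp add: covec.span_scale covec.scale_sum_right)
  then show ?thesis unfolding bideg_sum_def by (intro CollectI exI[of _ "\<lambda>p. covec_scale c (a p)"])
qed

lemma bideg_sum_zero: "0 \<in> bideg_sum J k"
  unfolding bideg_sum_def covec_pq_def
  by (intro CollectI exI[of _ "\<lambda>p. 0"]) (simp add: covec.span_zero)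

lemma bideg_sum_sum: "(\<And>i. i \<in> S \<Longrightarrow> f i \<in> bideg_sum J k) \<Longrightarrow> sum f S \<in> bideg_sum J k"
  by (induction S rule: infinite_finite_induct) (auto simp: bideg_sum_zero bideg_sum_add)

lemma wedge_pure_bideg_sum:
  assumes "set as \<subseteq> covec10 J" "set bs \<subseteq> covec01 J" "length as + length bs = k"
  shows "wedge (as @ bs) \<in> bideg_sum J k"
proof -
  let ?a = "\<lambda>p. if p = length as then wedge (as @ bs) else 0"
  have "wedge (as @ bs) \<in> covec_pq J (length as) (k - length as)"
    unfolding covec_pq_def using assms by (intro covec.span_base CollectI exI[of _ as] exI[of _ bs]) auto
  then have "\<forall>p\<le>k. ?a p \<in> covec_pq J p (k - p)"
    by (simp add: covec_pq_def covec.span_zero)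
  moreover have "wedge (as @ bs) = (\<Sum>p\<le>k. ?a p)" using assms(3) by simp
  ultimately show ?thesis unfolding bideg_sum_def by (intro CollectI exI[of _ ?a] conjI)
qed

text \<open>Induction on the 1-covectors not yet split: the (1,0) part of the next one joins
  \<open>as\<close> in place, the (0,1) part is carried past the others to \<open>bs\<close>, which
  costs the sign \<open>(- 1) ^ length \<theta>s\<close>.\<close>

lemma wedge_bideg_sum:
  fixes J :: "'e::euclidean_space \<Rightarrow> 'e"
  assumes J: "linear J" "\<And>v. J (J v) = - v"
    and "\<And>\<theta>. \<theta> \<in> set \<theta>s \<Longrightarrow> linear \<theta>" "set as \<subseteq> covec10 J" "set bs \<subseteq> covec01 J"
    "length as + length \<theta>s + length bs = k"
  shows "wedge (as @ \<theta>s @ bs) \<in> bideg_sum J k"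
  using assms(3-)
proof (induction \<theta>s arbitrary: as bs)
  case Nil
  then show ?case using wedge_pure_bideg_sum[of as J bs k] by simp
next
  case (Cons \<theta> \<theta>s)
  \<comment> \<open>The eigenparts of \<theta> for i and -i under composition with J.\<close>
  define \<theta>1 where "\<theta>1 v = (\<theta> v - \<i> * \<theta> (J v)) / 2" for v
  define \<theta>2 where "\<theta>2 v = (\<theta> v + \<i> * \<theta> (J v)) / 2" for v
  have l: "linear \<theta>" using Cons.prems by simp
  have lJ: "linear (\<lambda>v. \<theta> (J v))" using linear_compose[OF J(1) l] by (simp add: o_def)
  have "\<theta>1 = (\<lambda>v. (1/2) * \<theta> v + (- \<i>/2) * \<theta> (J v))" "\<theta>2 = (\<lambda>v. (1/2) * \<theta> v + (\<i>/2) * \<theta> (J v))"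
    by (auto simp: \<theta>1_def \<theta>2_def field_simps)
  then have lin: "linear \<theta>1" "linear \<theta>2"
    by (simp_all only: linear_compose_add linear_mult_left l lJ)
  have n: "\<theta> (- v) = - \<theta> v" for v using l by (rule linear_neg)
  have m: "\<theta>1 \<in> covec10 J" "\<theta>2 \<in> covec01 J"
    unfolding covec10_def covec01_def using lin
    by (auto simp: \<theta>1_def \<theta>2_def J(2) n field_simps)
  have s: "\<theta> = \<theta>1 + \<theta>2" by (auto simp: \<theta>1_def \<theta>2_def fun_eq_iff field_simps)
  have e1: "wedge (as @ \<theta>1 # \<theta>s @ bs) \<in> bideg_sum J k"
    using Cons.IH[of "as @ [\<theta>1]" bs] Cons.prems m by simp
  have "wedge (as @ \<theta>s @ \<theta>2 # bs) \<in> bideg_sum J k"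
    using Cons.IH[of as "\<theta>2 # bs"] Cons.prems m by simp
  then have e2: "covec_scale ((- 1) ^ length \<theta>s) (wedge (as @ \<theta>s @ \<theta>2 # bs)) \<in> bideg_sum J k"
    by (rule bideg_sum_scale)
  have "wedge (as @ (\<theta> # \<theta>s) @ bs) =
     wedge (as @ \<theta>1 # \<theta>s @ bs) + covec_scale ((- 1) ^ length \<theta>s) (wedge (as @ \<theta>s @ \<theta>2 # bs))"
  proof
    fix vs :: "'e list"
    show "wedge (as @ (\<theta> # \<theta>s) @ bs) vs =
     (wedge (as @ \<theta>1 # \<theta>s @ bs) + covec_scale ((- 1) ^ length \<theta>s) (wedge (as @ \<theta>s @ \<theta>2 # bs))) vs"
    proof (cases "length vs = k")
      case True
      have "wedge (as @ \<theta>s @ \<theta>2 # bs) vs = (- 1) ^ length \<theta>s * wedge (as @ \<theta>2 # \<theta>s @ bs) vs"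
        using True Cons.prems by (intro alternating_move[OF alternating_wedge]) simp
      moreover have "wedge (as @ (\<theta>1 + \<theta>2) # \<theta>s @ bs) vs =
          wedge (as @ \<theta>1 # \<theta>s @ bs) vs + wedge (as @ \<theta>2 # \<theta>s @ bs) vs"
        using True Cons.prems by (intro wedge_add_slot) simp
      ultimately show ?thesis
        by (simp add: s covec_scale_def power_mult_distrib[symmetric] mult.assoc[symmetric])
    next
      case False
      then show ?thesis using Cons.prems by (simp add: wedge_def covec_scale_def)
    qed
  qed
  then show ?case using bideg_sum_add[OF e1 e2] by (simp only:)
qed

lemma alt_covec_bideg_sum:
  fixes J :: "'e::euclidean_space \<Rightarrow> 'e"
  assumes J: "linear J" "\<And>v. J (J v) = - v" and a: "\<alpha> \<in> alt_covec k"
  shows "\<alpha> \<in> bideg_sum J k"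
proof -
  obtain es :: "'e list" where es: "set es = Basis" "distinct es"
    using finite_distinct_list[OF finite_Basis] by blast
  let ?d = "\<lambda>e v. complex_of_real (e \<bullet> v)"
  have lin: "linear (?d x)" for x :: 'e
    by (simp add: linear_iff inner_add_right scaleR_conv_of_real)
  show ?thesis
  proof (subst alt_covec_eq_sum_wedge[OF a es], intro bideg_sum_sum bideg_sum_scale)
    fix I assume "I \<in> {I. I \<subseteq> {..<length es} \<and> card I = k}"
    then have "length (nths es I) = k" by (simp add: length_nths_card)
    then show "wedge (map ?d (nths es I)) \<in> bideg_sum J k"
      using wedge_bideg_sum[OF J, of "map ?d (nths es I)" "[]" "[]" k] lin by auto
  qed
qed

text \<open>Each (1,0) factor contributes i and each (0,1) factor -i = 1/i, so the scalar in the
  definition of the action of J is the eigenvalue of the pullback by J.\<close>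

lemma covec_pq_map:
  fixes J :: "'e::euclidean_space \<Rightarrow> 'e"
  assumes "\<gamma> \<in> covec_pq J p q"
  shows "\<gamma> (map J vs) = \<i> powi (int p - int q) * \<gamma> vs"
  using assms unfolding covec_pq_def
proof (induction rule: covec.span_induct_alt)
  case (step c x y)
  then obtain \<theta>s \<eta>s where x: "x = wedge (\<theta>s @ \<eta>s)" "length \<theta>s = p" "length \<eta>s = q"
    and t: "set \<theta>s \<subseteq> covec10 J" "set \<eta>s \<subseteq> covec01 J" by auto
  have "x (map J vs) = \<i> powi (int p - int q) * x vs"
  proof (cases "length vs = p + q")
    case True
    have "(\<Prod>i<p + q. ((\<theta>s @ \<eta>s) ! i) (map J vs ! \<sigma> i)) =
       \<i> powi (int p - int q) * (\<Prod>i<p + q. ((\<theta>s @ \<eta>s) ! i) (vs ! \<sigma> i))"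
      if \<sigma>: "\<sigma> permutes {..<p + q}" for \<sigma>
    proof -
      have "((\<theta>s @ \<eta>s) ! i) (map J vs ! \<sigma> i) =
          (if i < p then \<i> else inverse \<i>) * ((\<theta>s @ \<eta>s) ! i) (vs ! \<sigma> i)" if i: "i < p + q" for i
      proof -
        have "\<sigma> i < length vs" using permutes_in_image[OF \<sigma>, of i] i True by simp
        moreover have "\<theta>s ! i \<in> covec10 J" if "i < p" using that x t by auto
        moreover have "\<eta>s ! (i - p) \<in> covec01 J" if "\<not> i < p" using that i x t by auto
        ultimately show ?thesis
          using x by (auto simp: nth_append covec10_def covec01_def)
      qed
      then have "(\<Prod>i<p + q. ((\<theta>s @ \<eta>s) ! i) (map J vs ! \<sigma> i)) =
        (\<Prod>i<p + q. (if i < p then \<i> else inverse \<i>)) * (\<Prod>i<p + q. ((\<theta>s @ \<eta>s) ! i) (vs ! \<sigma> i))"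
        by (simp add: prod.distrib)
      also have "(\<Prod>i<p + q. (if i < p then \<i> else inverse \<i>)) = \<i> ^ p * inverse \<i> ^ q"
        by (induction q) auto
      also have "\<dots> = \<i> powi (int p - int q)"
        by (simp add: power_int_diff divide_inverse power_inverse[symmetric] del: power_inverse)
      finally show ?thesis .
    qed
    then show ?thesis using True x by (simp add: wedge_def sum_distrib_left mult_ac)
  qed (simp add: x wedge_def)
  then show ?case using step by (simp add: covec_scale_def algebra_simps)
qed simp

text \<open>Existence comes from the splitting by type. Every admissible decomposition yields the
  pullback by J, so the description has exactly one solution without a proof that the sum over
  bidegrees is direct.\<close>

lemma J_covec_eq:
  fixes J :: "'e::euclidean_space \<Rightarrow> 'e"
  assumes J: "linear J" "\<And>v. J (J v) = - v" and a: "\<alpha> \<in> alt_covec k"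
  shows "J_covec J k \<alpha> = (\<lambda>vs. \<alpha> (map J vs))"
  unfolding J_covec_def
proof (rule the_equality)
  have eq: "(\<Sum>p\<le>k. covec_scale (\<i> powi (int p - int (k - p))) (a p)) = (\<lambda>vs. \<alpha> (map J vs))"
    if "\<forall>p\<le>k. a p \<in> covec_pq J p (k - p)" "\<alpha> = (\<Sum>p\<le>k. a p)" for a
  proof
    fix vs
    have "(\<Sum>p\<le>k. covec_scale (\<i> powi (int p - int (k - p))) (a p)) vs =
        (\<Sum>p\<le>k. \<i> powi (int p - int (k - p)) * a p vs)"
      by (simp add: sum_fun_apply covec_scale_def)
    also have "\<dots> = (\<Sum>p\<le>k. a p (map J vs))"
      using that(1) by (intro sum.cong) (auto simp: covec_pq_map)
    finally show "(\<Sum>p\<le>k. covec_scale (\<i> powi (int p - int (k - p))) (a p)) vs = \<alpha> (map J vs)"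
      by (simp add: that(2) sum_fun_apply)
  qed
  show "\<exists>a. (\<forall>p\<le>k. a p \<in> covec_pq J p (k - p)) \<and> \<alpha> = (\<Sum>p\<le>k. a p) \<and>
     (\<lambda>vs. \<alpha> (map J vs)) = (\<Sum>p\<le>k. covec_scale (\<i> powi (int p - int (k - p))) (a p))"
  proof -
    from alt_covec_bideg_sum[OF J a] obtain a where
      a: "\<forall>p\<le>k. a p \<in> covec_pq J p (k - p)" "\<alpha> = (\<Sum>p\<le>k. a p)"
      unfolding bideg_sum_def by blast
    from a eq[OF a] show ?thesis by (intro exI[of _ a]) auto
  qed
  show "\<beta> = (\<lambda>vs. \<alpha> (map J vs))"
    if "\<exists>a. (\<forall>p\<le>k. a p \<in> covec_pq J p (k - p)) \<and> \<alpha> = (\<Sum>p\<le>k. a p) \<and>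
     \<beta> = (\<Sum>p\<le>k. covec_scale (\<i> powi (int p - int (k - p))) (a p))" for \<beta>
    using that by (elim exE conjE) (simp only: eq)
qed

lemma alt_covec_map:
  fixes J :: "'e::euclidean_space \<Rightarrow> 'e"
  assumes "linear J" "\<alpha> \<in> alt_covec k"
  shows "(\<lambda>vs. \<alpha> (map J vs)) \<in> alt_covec k"
proof (rule alt_covecI)
  fix xs ys :: "'e list" assume "length xs + length ys + 1 = k"
  then have "linear (\<lambda>x. \<alpha> (map J xs @ x # map J ys))" by (intro alt_covec_linear[OF assms(2)]) simp
  from linear_compose[OF assms(1) this] show "linear (\<lambda>x. \<alpha> (map J (xs @ x # ys)))"
    by (simp add: o_def)
qed (use assms in \<open>auto simp: alt_covec_length alt_covec_not_distinct\<close>)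

lemma alt_covec_uminus:
  assumes "\<alpha> \<in> alt_covec k"
  shows "\<alpha> (map uminus vs) = (- 1) ^ k * \<alpha> vs"
proof (cases "length vs = k")
  case True
  have "\<alpha> (xs @ map uminus ys) = (- 1) ^ length ys * \<alpha> (xs @ ys)" if "length xs + length ys = k" for xs ys
    using that
  proof (induction ys arbitrary: xs)
    case (Cons y ys)
    have "linear (\<lambda>x. \<alpha> (xs @ x # map uminus ys))"
      using Cons.prems by (intro alt_covec_linear[OF assms]) simp
    from linear_neg[OF this] Cons.IH[of "xs @ [y]"] Cons.prems show ?case by simp
  qed simp
  from this[of "[]" vs] True show ?thesis by simp
qed (simp add: alt_covec_length[OF assms])

text \<open>Pulling back twice by J is pulling back by -1, that is multiplication by (-1)^k, so the
  pullback is injective and its own inverse up to this sign.\<close>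

lemma J_covec_inv_eq:
  fixes J :: "'e::euclidean_space \<Rightarrow> 'e"
  assumes J: "linear J" "\<And>v. J (J v) = - v" and b: "\<beta> \<in> alt_covec k"
  shows "J_covec_inv J k \<beta> = (\<lambda>vs. (- 1) ^ k * \<beta> (map J vs))"
proof -
  have sq: "\<alpha> (map J (map J vs)) = (- 1) ^ k * \<alpha> vs" if "\<alpha> \<in> alt_covec k" for \<alpha> vs
    using alt_covec_uminus[OF that, of vs] by (simp add: J(2) o_def)
  let ?\<alpha> = "\<lambda>vs. (- 1) ^ k * \<beta> (map J vs)"
  have a: "?\<alpha> \<in> alt_covec k"
    using alt_covec_scale[OF alt_covec_map[OF J(1) b], of "(- 1) ^ k"] by (simp add: covec_scale_def)
  have "inj_on (J_covec J k) (alt_covec k)"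
  proof
    fix x y assume xy: "x \<in> alt_covec k" "y \<in> alt_covec k" "J_covec J k x = J_covec J k y"
    then have "x (map J (map J vs)) = y (map J (map J vs))" for vs
      by (simp add: J_covec_eq[OF J] fun_eq_iff del: map_map)
    then show "x = y" using sq[OF xy(1)] sq[OF xy(2)] by (simp add: fun_eq_iff del: map_map)
  qed
  moreover have "J_covec J k ?\<alpha> = \<beta>"
    unfolding J_covec_eq[OF J a] using sq[OF b]
    by (auto simp: fun_eq_iff mult.assoc[symmetric] power_mult_distrib[symmetric] simp del: map_map)
  ultimately show ?thesis
    unfolding J_covec_inv_def using a inv_into_f_f by metis
qed

section \<open>Hermitian vector spaces\<close>

lemma nths_singleton_nth: "i < length xs \<Longrightarrow> nths xs {i} = [xs ! i]"
proof -
  assume i: "i < length xs"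
  then have "length (nths xs {i}) = 1" using length_nths_card[of "{i}" xs] by simp
  moreover have "set (nths xs {i}) = {xs ! i}" using i by (auto simp: set_nths)
  ultimately show ?thesis by (cases "nths xs {i}") auto
qed

lemma linear_of_real: "linear f \<Longrightarrow> linear (\<lambda>x. complex_of_real (f x))"
  by (simp add: linear_iff scaleR_conv_of_real)

text \<open>A single tangent space as seen in one chart; the locale is used at every point of every
  chart domain.\<close>

locale hermitian_space =
  fixes J :: "'e::euclidean_space \<Rightarrow> 'e" and g :: "'e \<Rightarrow> 'e \<Rightarrow> real" and m :: nat
  assumes J_linear: "linear J" and J_square: "J (J v) = - v"
    and g_bilinear: "bilinear g" and g_sym: "g v w = g w v"
    and g_pos: "v \<noteq> 0 \<Longrightarrow> g v v > 0" and g_J: "g (J v) (J w) = g v w"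
    and dim: "DIM('e) = 2 * m"
begin

lemma g_J_left: "g (J v) w = - g v (J w)"
  using g_J[of "J v" w] by (simp add: J_square bilinear_lneg[OF g_bilinear])

lemma g_J_self: "g (J v) v = 0" "g v (J v) = 0"
  using g_J_left[of v v] g_sym[of v "J v"] by auto

definition fundamental :: "'e \<Rightarrow> 'e \<Rightarrow> complex" where
  "fundamental v w = complex_of_real (g (J v) w)"

lemma fundamental_J: "fundamental (J v) (J w) = fundamental v w"
  by (simp add: fundamental_def g_J)

lemma g_linear: "linear (g v)" "linear (\<lambda>v. g v w)"
  using g_bilinear by (auto simp: bilinear_def)

lemma fundamental_linear: "linear (fundamental v)" "linear (\<lambda>v. fundamental v w)"
proof -
  show "linear (fundamental v)"
    unfolding fundamental_def by (intro linear_of_real g_linear)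
  have "linear (\<lambda>v. g (J v) w)"
    using linear_compose[OF J_linear g_linear(2)] by (simp add: o_def)
  then show "linear (\<lambda>v. fundamental v w)"
    unfolding fundamental_def by (rule linear_of_real)
qed

text \<open>The cut-off by length matters: \<open>pf\<close> need not vanish on shorter lists of
  even length and equals 1 on \<open>[]\<close>.\<close>

definition volume :: "'e covec" where
  "volume vs = (if length vs = DIM('e) then pf fundamental vs else 0)"

lemma volume_alt_covec: "volume \<in> alt_covec (DIM('e))"
proof -
  have "(\<lambda>vs. if length vs = DIM('e) then pf fundamental vs else 0) \<in> alt_covec (DIM('e))"
    by (rule pf_alt_covec) (auto simp: fundamental_linear, simp add: fundamental_def g_J_self)
  then show ?thesis by (simp add: volume_def[abs_def])
qed

section \<open>Unitary frames\<close>

definition orthonormal :: "'e list \<Rightarrow> bool" where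
  "orthonormal es \<longleftrightarrow>
     (\<forall>i<length es. \<forall>j<length es. g (es ! i) (es ! j) = (if i = j then 1 else 0))"

text \<open>Gram-Schmidt, adding two vectors at a time: if u is orthogonal to a span that is
  invariant under J, then so is Ju, and g(u, Ju) = 0.\<close>

lemma partial_frame_exists:
  "j \<le> m \<Longrightarrow> \<exists>es. length es = 2 * j \<and> orthonormal es \<and> (\<forall>i<j. es ! (2 * i + 1) = J (es ! (2 * i)))"
proof (induction j)
  case 0
  show ?case by (intro exI[of _ "[]"]) (simp add: orthonormal_def)
next
  case (Suc j)
  then obtain es where es: "length es = 2 * j" "orthonormal es"
    and Je: "\<forall>i<j. es ! (2 * i + 1) = J (es ! (2 * i))" by auto
  have "span (set es) \<noteq> UNIV"
  proof
    assume "span (set es) = UNIV"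
    then have "DIM('e) \<le> card (set es)"
      by (metis dim_UNIV dim_le_card' dim_span finite_set)
    also have "\<dots> \<le> 2 * j" using es(1) card_length by metis
    finally show False using dim Suc.prems by simp
  qed
  then obtain u0 where u0: "u0 \<notin> span (set es)" by auto
  define u1 where "u1 = u0 - (\<Sum>i<length es. g u0 (es ! i) *\<^sub>R es ! i)"
  have "(\<Sum>i<length es. g u0 (es ! i) *\<^sub>R es ! i) \<in> span (set es)"
    by (rule span_sum, rule span_scale, rule span_base) simp
  then have "u1 \<noteq> 0" using u0 by (auto simp: u1_def)
  then have pos: "g u1 u1 > 0" by (rule g_pos)
  have orth1: "g u1 (es ! k) = 0" if "k < length es" for k
  proof -
    have "g (\<Sum>i<length es. g u0 (es ! i) *\<^sub>R es ! i) (es ! k) =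
        (\<Sum>i<length es. g u0 (es ! i) * g (es ! i) (es ! k))"
      by (simp add: linear_sum[OF g_linear(2)] linear_cmul[OF g_linear(2)])
    also have "\<dots> = (\<Sum>i<length es. if i = k then g u0 (es ! k) else 0)"
      using es(2) that by (intro sum.cong) (auto simp: orthonormal_def)
    also have "\<dots> = g u0 (es ! k)" using that by simp
    finally show ?thesis by (simp add: u1_def bilinear_lsub[OF g_bilinear])
  qed
  define u where "u = (1 / sqrt (g u1 u1)) *\<^sub>R u1"
  have uu: "g u u = 1"
    using pos by (simp add: u_def bilinear_lmul[OF g_bilinear] bilinear_rmul[OF g_bilinear] field_simps)
  have ue: "g u (es ! k) = 0" if "k < length es" for k
    using orth1[OF that] by (simp add: u_def bilinear_lmul[OF g_bilinear])
  \<comment> \<open>The frame so far consists of pairs (e, Je), so J can be moved away from u; the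
    parity of k tells which member of the pair is met.\<close>
  have Jue: "g (J u) (es ! k) = 0" if k: "k < length es" for k
  proof (cases "even k")
    case True
    then obtain i where i: "k = 2 * i" by blast
    have "g (J u) (es ! k) = - g u (es ! (2 * i + 1))" using Je i k es(1) by (simp add: g_J_left)
    then show ?thesis using ue[of "2 * i + 1"] i k es(1) by simp
  next
    case False
    then obtain i where i: "k = 2 * i + 1" by (rule oddE)
    have "g (J u) (es ! k) = g u (es ! (2 * i))" using Je i k es(1) by (simp add: g_J)
    then show ?thesis using ue[of "2 * i"] i k es(1) by simp
  qed
  have o: "orthonormal (es @ [u, J u])"
    unfolding orthonormal_def
  proof (intro allI impI)
    fix i k assume "i < length (es @ [u, J u])" "k < length (es @ [u, J u])"
    then have "i < length es \<or> i = length es \<or> i = Suc (length es)"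
      "k < length es \<or> k = length es \<or> k = Suc (length es)" by auto
    moreover have "g (es ! a) u = 0" "g (es ! a) (J u) = 0" if "a < length es" for a
      using ue[OF that] Jue[OF that] by (simp_all add: g_sym[of "es ! a"])
    ultimately show "g ((es @ [u, J u]) ! i) ((es @ [u, J u]) ! k) = (if i = k then 1 else 0)"
      using es(2) ue Jue uu by (auto simp: nth_append orthonormal_def g_J g_J_self)
  qed
  have "(es @ [u, J u]) ! (2 * i + 1) = J ((es @ [u, J u]) ! (2 * i))" if "i < Suc j" for i
    using Je es(1) that by (cases "i = j") (auto simp: nth_append)
  with o show ?case using es(1) by (intro exI[of _ "es @ [u, J u]"]) auto
qed

text \<open>Literally the choice made inside \<open>hodge_covec\<close>, so that its unfolding can
  be folded back to this constant.\<close>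

definition frame :: "'e list" where
  "frame = (SOME es. unitary_frame J g es)"

lemma frame: "unitary_frame J g frame"
proof -
  obtain es where "length es = 2 * m" "orthonormal es" "\<forall>i<m. es ! (2 * i + 1) = J (es ! (2 * i))"
    using partial_frame_exists[of m] by auto
  then have "unitary_frame J g es"
    by (auto simp: unitary_frame_def orthonormal_def dim)
  then show ?thesis unfolding frame_def by (rule someI)
qed

lemma frame_length: "length frame = DIM('e)"
  using frame by (simp add: unitary_frame_def)

lemma frame_orthonormal:
  "i < DIM('e) \<Longrightarrow> j < DIM('e) \<Longrightarrow> g (frame ! i) (frame ! j) = (if i = j then 1 else 0)"
  using frame by (simp add: unitary_frame_def)

lemma frame_distinct: "distinct frame"
  unfolding distinct_conv_nth frame_length
proof (intro allI impI notI)
  fix i j assume "i < DIM('e)" "j < DIM('e)" "i \<noteq> j" "frame ! i = frame ! j"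
  then show False using frame_orthonormal[of i i] frame_orthonormal[of i j] by simp
qed

lemma g_frame_sum:
  "k < DIM('e) \<Longrightarrow> g (\<Sum>i<DIM('e). c i *\<^sub>R frame ! i) (frame ! k) = c k"
  by (simp add: linear_sum[OF g_linear(2)] linear_cmul[OF g_linear(2)] frame_orthonormal if_distrib cong: if_cong)

lemma frame_span: "span (set frame) = UNIV"
proof -
  have "independent (set frame)"
  proof (rule independent_if_scalars_zero)
    fix f x assume z: "(\<Sum>x\<in>set frame. f x *\<^sub>R x) = 0" and "x \<in> set frame"
    then obtain k where k: "k < DIM('e)" "x = frame ! k" by (auto simp: in_set_conv_nth frame_length)
    have "bij_betw ((!) frame) {..<DIM('e)} (set frame)"
      by (rule bij_betw_nth[OF frame_distinct]) (simp_all add: frame_length)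
    from sum.reindex_bij_betw[OF this, of "\<lambda>x. f x *\<^sub>R x"] z
    have "(\<Sum>i<DIM('e). f (frame ! i) *\<^sub>R frame ! i) = 0" by simp
    then have "g 0 (frame ! k) = f x"
      using g_frame_sum[OF k(1), of "\<lambda>i. f (frame ! i)"] k(2) by simp
    then show "f x = 0" by (simp add: bilinear_lzero[OF g_bilinear])
  qed simp
  moreover have "card (set frame) = DIM('e)"
    using distinct_card[OF frame_distinct] frame_length by simp
  ultimately show ?thesis
    using card_ge_dim_independent[of "set frame" UNIV] by auto
qed

text \<open>The difference of the two sides is orthogonal to a spanning list, hence to
  itself.\<close>

lemma frame_expand: "v = (\<Sum>i<DIM('e). g v (frame ! i) *\<^sub>R frame ! i)"
proof -
  define w where "w = v - (\<Sum>i<DIM('e). g v (frame ! i) *\<^sub>R frame ! i)"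
  have w: "g w x = 0" if x: "x \<in> set frame" for x
  proof -
    obtain k where "k < DIM('e)" "x = frame ! k" using x by (auto simp: in_set_conv_nth frame_length)
    then show ?thesis by (simp add: w_def bilinear_lsub[OF g_bilinear] g_frame_sum)
  qed
  have "g w w = 0"
    by (rule linear_eq_0_on_span[OF g_linear(1) w]) (auto simp: frame_span)
  then have "w = 0" using g_pos[of w] by auto
  then show ?thesis by (simp add: w_def)
qed

lemma volume_frame: "volume frame = 1"
proof -
  have "pf fundamental frame = 1"
  proof (rule pf_frame)
    show "length frame = 2 * m" by (simp add: frame_length dim)
    fix i j assume ij: "i < m" "2 * i < j" "j < 2 * m"
    then have "J (frame ! (2 * i)) = frame ! (2 * i + 1)"
      using frame by (simp add: unitary_frame_def dim)
    then show "fundamental (frame ! (2 * i)) (frame ! j) = (if j = 2 * i + 1 then 1 else 0)"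
      using ij by (simp add: fundamental_def frame_orthonormal dim)
  qed
  then show ?thesis by (simp add: volume_def frame_length)
qed

lemma nths_frame_UNIV:
  assumes "I \<subseteq> {..<DIM('e)}" "card I = DIM('e)"
  shows "I = {..<DIM('e)}" "nths frame I = frame"
proof -
  show "I = {..<DIM('e)}" using assms by (simp add: card_subset_eq)
  then show "nths frame I = frame" using nths_all[of frame I] frame_length by simp
qed

lemma top_covec: 
  assumes "\<alpha> \<in> alt_covec (DIM('e))"
  shows "\<alpha> = covec_scale (\<alpha> frame) volume"
proof -
  have "\<alpha> - covec_scale (\<alpha> frame) volume = 0"
  proof (rule alt_covec_eq_0I[OF _ frame_span frame_distinct])
    show "\<alpha> - covec_scale (\<alpha> frame) volume \<in> alt_covec (DIM('e))"
      by (intro alt_covec_diff alt_covec_scale assms volume_alt_covec)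
    fix I assume "I \<subseteq> {..<length frame}" "card I = DIM('e)"
    then show "(\<alpha> - covec_scale (\<alpha> frame) volume) (nths frame I) = 0"
      using nths_frame_UNIV(2)[of I] by (simp add: frame_length covec_scale_def volume_frame)
  qed
  then show ?thesis by simp
qed

text \<open>Both are top covectors with value 1 on the frame. The right-hand side no longer depends
  on which frame was chosen.\<close>

lemma vol_covec_frame: "vol_covec g frame = volume"
proof -
  have "wedge (map (\<lambda>e v. complex_of_real (g e v)) frame) \<in> alt_covec (length frame)"
    using wedge_alt_covec[of "map (\<lambda>e v. complex_of_real (g e v)) frame"]
    by (auto intro: linear_of_real g_linear)
  then have "vol_covec g frame \<in> alt_covec (DIM('e))"
    by (simp add: vol_covec_def frame_length)
  moreover have "vol_covec g frame frame = 1"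
    unfolding vol_covec_def
  proof (rule wedge_dual_self[OF _ frame_distinct])
    fix x y assume "x \<in> set frame" "y \<in> set frame"
    then obtain i j where "i < DIM('e)" "x = frame ! i" "j < DIM('e)" "y = frame ! j"
      by (auto simp: in_set_conv_nth frame_length)
    then show "complex_of_real (g x y) = (if x = y then 1 else 0)"
      by (simp add: frame_orthonormal nth_eq_iff_index_eq[OF frame_distinct] frame_length)
  qed
  ultimately show ?thesis using top_covec[of "vol_covec g frame"] by (simp add: covec_scale_def)
qed

text \<open>J preserves the fundamental form and hence its Pfaffian. In terms of types, the top
  degree is (m,m) and i^(m-m) = 1.\<close>

lemma top_covec_J:
  assumes "\<alpha> \<in> alt_covec (DIM('e))"
  shows "\<alpha> (map J vs) = \<alpha> vs"
proof -
  have "volume (map J vs) = volume vs"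
    by (simp add: volume_def pf_map fundamental_J cong: if_cong)
  then show ?thesis using top_covec[OF assms] unfolding covec_scale_def by metis
qed

lemma J_covec_top: "\<alpha> \<in> alt_covec (DIM('e)) \<Longrightarrow> J_covec J (DIM('e)) \<alpha> = \<alpha>"
  by (simp add: J_covec_eq[OF J_linear J_square] top_covec_J)

lemma J_covec_inv_top: "\<alpha> \<in> alt_covec (DIM('e)) \<Longrightarrow> J_covec_inv J (DIM('e)) \<alpha> = \<alpha>"
  by (simp add: J_covec_inv_eq[OF J_linear J_square] top_covec_J) (simp add: dim)

section \<open>The Hodge operator at a point\<close>

lemma hodge_covec_eq:
  assumes "\<alpha> \<in> alt_covec k"
  shows "hodge_covec J g \<alpha> vs =
    (\<Sum>I | I \<subseteq> {..<DIM('e)} \<and> card I = k. \<alpha> (nths frame I) * volume (nths frame I @ vs))"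
proof -
  have len: "length (nths frame I) = card I" if "I \<subseteq> {..<DIM('e)}" for I
    using that by (simp add: length_nths_card frame_length)
  have "hodge_covec J g \<alpha> vs = (\<Sum>I | I \<subseteq> {..<DIM('e)} \<and> card I + length vs = DIM('e).
      \<alpha> (nths frame I) * volume (nths frame I @ vs))"
    by (simp add: hodge_covec_def frame_def[symmetric] vol_covec_frame Let_def)
  also have "\<dots> = (\<Sum>I | I \<subseteq> {..<DIM('e)} \<and> card I = k. \<alpha> (nths frame I) * volume (nths frame I @ vs))"
  proof (cases "k + length vs = DIM('e)")
    case True
    then have "(card I + length vs = DIM('e)) = (card I = k)" for I :: "nat set" by auto
    then show ?thesis by simp
  next
    case False
    \<comment> \<open>The two index sets differ here, but in every term either \<alpha> or
      \<open>volume\<close> receives a list of the wrong length, so both sums are zero.\<close>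
    have "\<alpha> (nths frame I) = 0" if "I \<subseteq> {..<DIM('e)}" "card I + length vs = DIM('e)" for I
      using that False len alt_covec_length[OF assms] by auto
    moreover have "volume (nths frame I @ vs) = 0" if "I \<subseteq> {..<DIM('e)}" "card I = k" for I
      using that False len by (simp add: volume_def)
    ultimately show ?thesis by (auto intro!: sum.neutral[THEN trans] simp: sum.neutral)
  qed
  finally show ?thesis .
qed

lemma hodge_covec_0:
  assumes "\<alpha> \<in> alt_covec 0"
  shows "hodge_covec J g \<alpha> = covec_scale (\<alpha> []) volume"
proof
  fix vs
  have "{I. I \<subseteq> {..<DIM('e)} \<and> card I = 0} = {{}}"
    by (auto simp: card_eq_0_iff finite_subset)
  then show "hodge_covec J g \<alpha> vs = covec_scale (\<alpha> []) volume vs"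
    by (simp add: hodge_covec_eq[OF assms] covec_scale_def)
qed

lemma hodge_covec_top:
  assumes "\<alpha> \<in> alt_covec (DIM('e))"
  shows "hodge_covec J g \<alpha> vs = (if vs = [] then \<alpha> frame else 0)"
proof -
  have "{I. I \<subseteq> {..<DIM('e)} \<and> card I = DIM('e)} = {{..<DIM('e)}}"
    using nths_frame_UNIV(1) by auto
  then show ?thesis
    using nths_frame_UNIV(2)[of "{..<DIM('e)}"]
    by (simp add: hodge_covec_eq[OF assms] volume_frame) (simp add: volume_def frame_length)
qed

text \<open>The expansion of the Pfaffian along its first argument turns the frame sum into an expression
  without inverse metric.\<close>

lemma hodge_covec_1:
  assumes a: "\<alpha> \<in> alt_covec 1" and l: "length vs + 1 = DIM('e)"
  shows "hodge_covec J g \<alpha> vs =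
    - (\<Sum>j<length vs. (- 1) ^ j * (\<alpha> [J (vs ! j)] * pf fundamental (omit j vs)))"
proof -
  have lin: "linear (\<lambda>x. \<alpha> [x])" using alt_covec_linear[OF a, of "[]" "[]"] by simp
  have "{I. I \<subseteq> {..<DIM('e)} \<and> card I = 1} = (\<lambda>i. {i}) ` {..<DIM('e)}"
    by (auto simp: card_1_singleton_iff)
  then have "hodge_covec J g \<alpha> vs =
      (\<Sum>i<DIM('e). \<alpha> (nths frame {i}) * volume (nths frame {i} @ vs))"
    unfolding hodge_covec_eq[OF a] by (simp add: sum.reindex inj_on_def)
  also have "\<dots> = (\<Sum>i<DIM('e). \<alpha> [frame ! i] * (\<Sum>j<length vs. (- 1) ^ j *
      (fundamental (frame ! i) (vs ! j) * pf fundamental (omit j vs))))"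
    using l by (intro sum.cong) (auto simp: nths_singleton_nth frame_length volume_def)
  also have "\<dots> = (\<Sum>j<length vs. (- 1) ^ j *
     ((\<Sum>i<DIM('e). \<alpha> [frame ! i] * fundamental (frame ! i) (vs ! j)) * pf fundamental (omit j vs)))"
    unfolding sum_distrib_left sum_distrib_right by (subst sum.swap) (simp add: mult_ac)
  \<comment> \<open>Expanding J v_j in the frame absorbs the sum over frame vectors; the sign is
    that of g(Jv, w) = - g(v, Jw).\<close>
  also have "\<dots> = (\<Sum>j<length vs. (- 1) ^ j * (- \<alpha> [J (vs ! j)] * pf fundamental (omit j vs)))"
  proof (intro sum.cong refl arg_cong2[where f = "(*)"])
    fix j
    have "\<alpha> [J (vs ! j)] = \<alpha> [\<Sum>i<DIM('e). g (J (vs ! j)) (frame ! i) *\<^sub>R frame ! i]"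
      using frame_expand by metis
    also have "\<dots> = (\<Sum>i<DIM('e). complex_of_real (g (J (vs ! j)) (frame ! i)) * \<alpha> [frame ! i])"
      by (simp add: linear_sum[OF lin] linear_cmul[OF lin] scaleR_conv_of_real)
    also have "\<dots> = - (\<Sum>i<DIM('e). \<alpha> [frame ! i] * fundamental (frame ! i) (vs ! j))"
      by (simp add: fundamental_def g_J_left[of "frame ! _"] sum_negf[symmetric] g_sym[of "J (vs ! j)"] mult.commute)
    finally show "(\<Sum>i<DIM('e). \<alpha> [frame ! i] * fundamental (frame ! i) (vs ! j)) = - \<alpha> [J (vs ! j)]"
      by simp
  qed
  also have "\<dots> = - (\<Sum>j<length vs. (- 1) ^ j * (\<alpha> [J (vs ! j)] * pf fundamental (omit j vs)))"
    by (simp add: sum_negf[symmetric])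
  finally show ?thesis .
qed

lemma hodge_covec_alt_covec:
  assumes a: "\<alpha> \<in> alt_covec k"
  shows "hodge_covec J g \<alpha> \<in> alt_covec (DIM('e) - k)"
proof (cases "k \<le> DIM('e)")
  case True
  have len: "length (nths frame I) = card I" if "I \<subseteq> {..<DIM('e)}" for I
    using that by (simp add: length_nths_card frame_length)
  show ?thesis
  proof (rule alt_covecI)
    fix vs :: "'e list" assume "length vs \<noteq> DIM('e) - k"
    then show "hodge_covec J g \<alpha> vs = 0"
      unfolding hodge_covec_eq[OF a] using len by (auto simp: volume_def intro!: sum.neutral)
  next
    fix xs ys :: "'e list" assume l: "length xs + length ys + 1 = DIM('e) - k"
    have "linear (\<lambda>x. volume (nths frame I @ xs @ x # ys))" if "I \<subseteq> {..<DIM('e)}" "card I = k" for I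
      using alt_covec_linear[OF volume_alt_covec, of "nths frame I @ xs" ys] len that l True by simp
    then show "linear (\<lambda>x. hodge_covec J g \<alpha> (xs @ x # ys))"
      unfolding hodge_covec_eq[OF a] by (intro linear_compose_sum ballI linear_mult_left) simp
  next
    fix xs x and ys :: "'e list"
    have "volume (nths frame I @ xs @ x # x # ys) = 0" for I
      by (rule alt_covec_not_distinct[OF volume_alt_covec]) simp
    then show "hodge_covec J g \<alpha> (xs @ x # x # ys) = 0"
      unfolding hodge_covec_eq[OF a] by simp
  qed
next
  case False
  \<comment> \<open>Natural subtraction truncates \<open>DIM('e) - k\<close> to 0 here, but there is
    no nonzero k-covector.\<close>
  then have "\<alpha> = 0" using alt_covec_above_dim[OF a] by simp
  then have "hodge_covec J g \<alpha> = 0"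
    by (auto simp: fun_eq_iff hodge_covec_def Let_def)
  then show ?thesis by (simp add: alt_covec_zero)
qed

text \<open>On the frame vectors complementary to K only the term I = K survives, up to a sign. This
  injectivity is what strips the outer Hodge operator off \<open>adj\<close>.\<close>

lemma hodge_covec_eq_0D:
  assumes a: "\<alpha> \<in> alt_covec k" and z: "hodge_covec J g \<alpha> = 0"
  shows "\<alpha> = 0"
proof (rule alt_covec_eq_0I[OF a frame_span frame_distinct])
  fix K assume K: "K \<subseteq> {..<length frame}" "card K = k"
  let ?C = "{I. I \<subseteq> {..<DIM('e)} \<and> card I = k}"
  let ?K' = "{..<DIM('e)} - K"
  have fin: "finite ?C" by (rule finite_subset[of _ "Pow {..<DIM('e)}"]) auto
  have K': "K \<in> ?C" using K frame_length by simp
  have fK: "finite K" using K finite_subset by blast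
  have z': "volume (nths frame I @ nths frame ?K') = 0" if I: "I \<in> ?C - {K}" for I
  proof (rule alt_covec_not_distinct[OF volume_alt_covec])
    have "\<not> I \<subseteq> K" using I K fK card_subset_eq[of K I] by auto
    then obtain i where "i \<in> I" "i \<notin> K" by blast
    then have "frame ! i \<in> set (nths frame I) \<inter> set (nths frame ?K')"
      using I frame_length by (auto simp: set_nths)
    then show "\<not> distinct (nths frame I @ nths frame ?K')" by auto
  qed
  have "0 = hodge_covec J g \<alpha> (nths frame ?K')" by (simp add: z)
  also have "\<dots> = \<alpha> (nths frame K) * volume (nths frame K @ nths frame ?K')"
    unfolding hodge_covec_eq[OF a] using z' by (simp add: sum.remove[OF fin K'])
  finally have "\<alpha> (nths frame K) * volume (nths frame K @ nths frame ?K') = 0" by simp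
  \<comment> \<open>The list runs through the frame and has its length, so it is a permutation of it
    and \<open>volume\<close> is 1 or -1 there.\<close>
  moreover have "volume (nths frame K @ nths frame ?K') \<noteq> 0"
  proof -
    have s: "set (nths frame K @ nths frame ?K') = set frame"
      using K frame_length by (auto simp: set_nths in_set_conv_nth) (metis)
    have "length (nths frame K @ nths frame ?K') = DIM('e)"
      using K frame_length length_nths_card[of K frame] length_nths_card[of ?K' frame]
        card_mono[of "{..<DIM('e)}" K] by (simp add: card_Diff_subset[OF fK])
    then have "distinct (nths frame K @ nths frame ?K')"
      using s distinct_card[OF frame_distinct] frame_length card_distinct by metis
    then have "mset (nths frame K @ nths frame ?K') = mset frame"
      using s frame_distinct by (metis set_eq_iff_mset_eq_distinct)
    then have "volume frame = volume (nths frame K @ nths frame ?K') \<or>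
        volume frame = - volume (nths frame K @ nths frame ?K')"
      using alternating_mset[OF alt_covec_alternating[OF volume_alt_covec], of frame "nths frame K @ nths frame ?K'" "[]"]
      by (simp add: frame_length)
    then show ?thesis using volume_frame by auto
  qed
  ultimately show "\<alpha> (nths frame K) = 0" by simp
qed

end

lemma hodge_covec_zero: "hodge_covec J g 0 = 0"
  by (auto simp: fun_eq_iff hodge_covec_def Let_def)

section \<open>The exterior derivative in coordinates\<close>

text \<open>The exterior derivative for fields of covectors on the model space, so that
  \<open>ext_d\<close> in a chart becomes a statement about functions on an open subset of
  \<open>'e\<close>.\<close>

definition extd :: "('e::euclidean_space \<Rightarrow> 'e covec) \<Rightarrow> 'e \<Rightarrow> 'e covec" where
  "extd F x vs = (\<Sum>i<length vs. (- 1) ^ i * frechet_derivative (\<lambda>y. F y (omit i vs)) (at x) (vs ! i))"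

lemma extd_cong:
  assumes "open U" "x \<in> U" "\<And>y. y \<in> U \<Longrightarrow> F y = G y"
  shows "extd F x = extd G x"
proof -
  have "frechet_derivative (\<lambda>y. F y ws) (at x) = frechet_derivative (\<lambda>y. G y ws) (at x)" for ws
    using assms by (intro frechet_derivative_cong_open[of U]) auto
  then show ?thesis by (simp add: extd_def fun_eq_iff)
qed

lemma extd_const: "extd (\<lambda>y. F) x = 0"
  by (simp add: extd_def fun_eq_iff)

text \<open>The identities that define alternating covectors hold throughout the open set U, so they
  can be differentiated at x; the alternating sum then restores antisymmetry in the new
  slot.\<close>

lemma extd_alt_covec:
  assumes U: "open U" "x \<in> U" and F: "\<And>y. y \<in> U \<Longrightarrow> F y \<in> alt_covec k"
    and d: "\<And>vs. (\<lambda>y. F y vs) differentiable (at x)"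
  shows "extd F x \<in> alt_covec (k + 1)"
proof -
  define f where "f u ws = frechet_derivative (\<lambda>y. F y ws) (at x) u" for u ws
  have der: "((\<lambda>y. F y ws) has_derivative (\<lambda>u. f u ws)) (at x)" for ws
    unfolding f_def using d frechet_derivative_works by blast
  \<comment> \<open>G stands for the other side of the identity being differentiated.\<close>
  have uniq: "f u ws = f' u" if "((\<lambda>y. G y) has_derivative f') (at x)" "\<And>y. y \<in> U \<Longrightarrow> F y ws = G y" for u ws f' G
  proof -
    have "((\<lambda>y. F y ws) has_derivative f') (at x)"
      by (rule has_derivative_transform_within_open[OF that(1) U]) (simp add: that(2))
    then show ?thesis using has_derivative_unique der by metis
  qed
  have f2: "linear (\<lambda>u. f u ws)" for ws
    using der has_derivative_linear by blast
  have f1: "linear (\<lambda>z. f u (xs @ z # ys))" if "length xs + length ys + 1 = k" for u xs ys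
  proof (rule linearI)
    note lin = alt_covec_linear[OF F that]
    fix a b
    show "f u (xs @ (a + b) # ys) = f u (xs @ a # ys) + f u (xs @ b # ys)"
      by (rule uniq[OF has_derivative_add[OF der der]]) (rule linear_add[OF lin])
    fix r :: real
    show "f u (xs @ (r *\<^sub>R a) # ys) = r *\<^sub>R f u (xs @ a # ys)"
      by (rule uniq[OF has_derivative_scaleR_right[OF der]]) (rule linear_cmul[OF lin])
  qed
  have z: "f u ws = 0" if "\<And>y. y \<in> U \<Longrightarrow> F y ws = 0" for u ws
    by (rule uniq[OF has_derivative_const that])
  have e: "extd F x = (\<lambda>vs. \<Sum>i<length vs. (- 1) ^ i * f (vs ! i) (omit i vs))"
    by (simp add: extd_def f_def fun_eq_iff)
  show ?thesis
    unfolding e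
  proof (rule alt_covecI)
    fix vs :: "'a list" assume "length vs \<noteq> k + 1"
    then have "f (vs ! i) (omit i vs) = 0" if "i < length vs" for i
      using that by (intro z alt_covec_length[OF F]) auto
    then show "(\<Sum>i<length vs. (- 1) ^ i * f (vs ! i) (omit i vs)) = 0" by simp
  next
    fix xs ys :: "'a list" assume "length xs + length ys + 1 = k + 1"
    then show "linear (\<lambda>x. \<Sum>i<length (xs @ x # ys). (- 1) ^ i * f ((xs @ x # ys) ! i) (omit i (xs @ x # ys)))"
      by (intro linear_sum_omit[where k = k] f1 f2) auto
  next
    fix xs ys :: "'a list" and v
    show "(\<Sum>i<length (xs @ v # v # ys). (- 1) ^ i * f ((xs @ v # v # ys) ! i) (omit i (xs @ v # v # ys))) = 0"
      by (rule sum_omit_adjacent_eq_0[OF _ refl]) (auto intro!: z alt_covec_not_distinct[OF F])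
  qed
qed

lemma smooth_on_extd:
  "open U \<Longrightarrow> (\<And>vs. smooth_on U (\<lambda>y. F y vs)) \<Longrightarrow> smooth_on U (\<lambda>x. extd F x vs)"
  unfolding extd_def
  by (intro smooth_on_sum smooth_on_mult smooth_on_const smooth_on_frechet_derivative)

section \<open>The strong maximum principle\<close>

text \<open>Were l positive, f' would be positive just to the right of 0, and the mean value theorem
  would give a value above f 0.\<close>

lemma second_derivative_local_max:
  fixes f f' :: "real \<Rightarrow> real"
  assumes "0 < d" and f: "\<And>t. \<bar>t\<bar> < d \<Longrightarrow> (f has_real_derivative f' t) (at t)"
    and f': "(f' has_real_derivative l) (at 0)" and max: "\<And>t. \<bar>t\<bar> < d \<Longrightarrow> f t \<le> f 0"
  shows "f' 0 = 0" "l \<le> 0"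
proof -
  show z: "f' 0 = 0"
    by (rule DERIV_local_max[OF f[of 0] assms(1)]) (use assms in auto)
  show "l \<le> 0"
  proof (rule ccontr)
    assume "\<not> l \<le> 0"
    then obtain e where e: "e > 0" "\<And>h. 0 < h \<Longrightarrow> h < e \<Longrightarrow> f' 0 < f' (0 + h)"
      using DERIV_pos_inc_right[OF f'] by auto
    define h where "h = min d e / 2"
    have h: "0 < h" "h < d" "h < e" using e assms(1) by (auto simp: h_def)
    obtain s where s: "0 < s" "s < h" "f h - f 0 = (h - 0) * f' s"
      using MVT2[of 0 h f f'] f h by auto
    then have "f h - f 0 > 0" using e(2)[of s] h z by simp
    then show False using max[of h] h by simp
  qed
qed

lemma linear_eq_sum_Basis:
  assumes "linear (f :: 'e::euclidean_space \<Rightarrow> 'b::real_vector)"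
  shows "f z = (\<Sum>b\<in>Basis. (z \<bullet> b) *\<^sub>R f b)"
proof -
  have "f z = f (\<Sum>b\<in>Basis. (z \<bullet> b) *\<^sub>R b)" by (simp add: euclidean_representation)
  then show ?thesis by (simp add: linear_sum[OF assms] linear_cmul[OF assms])
qed

text \<open>The Gaussian of Hopf's lemma. The constant that makes it vanish on a sphere is
  subtracted only later, as it does not affect derivatives.\<close>

definition bump :: "real \<Rightarrow> 'e::euclidean_space \<Rightarrow> 'e \<Rightarrow> real" where
  "bump a y0 x = exp (- a * ((x - y0) \<bullet> (x - y0)))"

lemma bump_line_derivative:
  "((\<lambda>t. bump a y0 (z + t *\<^sub>R v)) has_real_derivative - 2 * a * ((z + t *\<^sub>R v - y0) \<bullet> v) * bump a y0 (z + t *\<^sub>R v)) (at t)"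
proof -
  have e: "(z + s *\<^sub>R v - y0) \<bullet> (z + s *\<^sub>R v - y0) = (z - y0) \<bullet> (z - y0) + 2 * s * ((z - y0) \<bullet> v) + s^2 * (v \<bullet> v)" for s
    by (simp add: inner_add_left inner_add_right inner_diff_left inner_diff_right inner_commute power2_eq_square algebra_simps)
  show ?thesis
    unfolding bump_def e
    by (auto intro!: derivative_eq_intros simp: inner_add_left inner_diff_left algebra_simps)
qed

context
  fixes S :: "'e::euclidean_space set" and u :: "'e \<Rightarrow> real" and J :: "'e \<Rightarrow> 'e \<Rightarrow> 'e"
  assumes S: "open S" and u: "smooth_on S u" and J: "\<And>v. smooth_on S (\<lambda>x. J x v)"
    and J_linear: "\<And>x. x \<in> S \<Longrightarrow> linear (J x)" and J_square: "\<And>x v. x \<in> S \<Longrightarrow> J x (J x v) = - v"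
begin

abbreviation (input) Du where "Du y \<equiv> frechet_derivative u (at y)"
abbreviation (input) Hu where "Hu x v w \<equiv> frechet_derivative (\<lambda>y. frechet_derivative u (at y) w) (at x) v"
abbreviation (input) DJ where "DJ x v w \<equiv> frechet_derivative (\<lambda>y. J y w) (at x) v"

lemma Du_has_derivative: "x \<in> S \<Longrightarrow> (u has_derivative Du x) (at x)"
  using smooth_on_differentiable[OF u] frechet_derivative_works by blast

lemma Hu_has_derivative: "x \<in> S \<Longrightarrow> ((\<lambda>y. Du y w) has_derivative (\<lambda>v. Hu x v w)) (at x)"
  using smooth_on_differentiable[OF smooth_on_frechet_derivative[OF u]] frechet_derivative_works by blast

lemma DJ_has_derivative: "x \<in> S \<Longrightarrow> ((\<lambda>y. J y w) has_derivative (\<lambda>v. DJ x v w)) (at x)"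
  using smooth_on_differentiable[OF J] frechet_derivative_works by blast

lemma Du_linear: "x \<in> S \<Longrightarrow> linear (Du x)"
  using Du_has_derivative has_derivative_linear by blast

text \<open>Writing the moving vector Z y in the fixed basis turns the map into a sum of products
  with known derivatives. A constant Z then gives linearity of the Hessian in its second
  slot.\<close>

lemma derivative_Du_field_sum:
  assumes x: "x \<in> S" and Z: "(Z has_derivative Z') (at x)"
  shows "frechet_derivative (\<lambda>y. Du y (Z y)) (at x) v = (\<Sum>b\<in>Basis. (Z x \<bullet> b) * Hu x v b) + Du x (Z' v)"
proof -
  have "((\<lambda>y. \<Sum>b\<in>Basis. (Z y \<bullet> b) * Du y b) has_derivative
     (\<lambda>v. \<Sum>b\<in>Basis. (Z x \<bullet> b) * Hu x v b + (Z' v \<bullet> b) * Du x b)) (at x)"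
    by (intro has_derivative_sum has_derivative_mult has_derivative_inner_left Z Hu_has_derivative x)
  then have "((\<lambda>y. Du y (Z y)) has_derivative
     (\<lambda>v. \<Sum>b\<in>Basis. (Z x \<bullet> b) * Hu x v b + (Z' v \<bullet> b) * Du x b)) (at x)"
    by (rule has_derivative_transform_within_open[OF _ S x])
      (simp add: linear_eq_sum_Basis[OF Du_linear, symmetric] flip: real_scaleR_def)
  then show ?thesis
    by (simp add: frechet_derivative_at[symmetric] sum.distrib linear_eq_sum_Basis[OF Du_linear[OF x], of "Z' v"])
qed

lemma Hu_eq_sum: "x \<in> S \<Longrightarrow> Hu x v z = (\<Sum>b\<in>Basis. (z \<bullet> b) * Hu x v b)"
  using derivative_Du_field_sum[of x "\<lambda>_. z" "\<lambda>_. 0" v] linear_0[OF Du_linear] by simp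

lemma derivative_Du_J:
  assumes "x \<in> S"
  shows "frechet_derivative (\<lambda>y. Du y (J y w)) (at x) v = Hu x v (J x w) + Du x (DJ x v w)"
  unfolding derivative_Du_field_sum[OF assms DJ_has_derivative[OF assms]]
  using Hu_eq_sum[OF assms, where v = v and z = "J x w"] by simp

text \<open>On S this is the vector field (D_v J)(Jv) - (D_Jv J)(v). The form over a basis uses only
  derivatives of J in fixed directions on fixed vectors, which makes its continuity
  immediate.\<close>

definition drift :: "'e \<Rightarrow> 'e \<Rightarrow> 'e" where
  "drift v x = (\<Sum>b\<in>Basis. (J x v \<bullet> b) *\<^sub>R (DJ x v b - DJ x b v))"

lemma drift_eq:
  assumes x: "x \<in> S"
  shows "drift v x = DJ x v (J x v) - DJ x (J x v) v"
proof -
  have "linear (\<lambda>w. DJ x w v)" using DJ_has_derivative[OF x] has_derivative_linear by blast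
  from linear_eq_sum_Basis[OF this, of "J x v"]
  have 1: "DJ x (J x v) v = (\<Sum>b\<in>Basis. (J x v \<bullet> b) *\<^sub>R DJ x b v)" .
  have "((\<lambda>y. \<Sum>b\<in>Basis. (z \<bullet> b) *\<^sub>R J y b) has_derivative (\<lambda>v. \<Sum>b\<in>Basis. (z \<bullet> b) *\<^sub>R DJ x v b)) (at x)" for z
    by (intro has_derivative_sum has_derivative_scaleR_right DJ_has_derivative x)
  then have "((\<lambda>y. J y z) has_derivative (\<lambda>v. \<Sum>b\<in>Basis. (z \<bullet> b) *\<^sub>R DJ x v b)) (at x)" for z
    by (rule has_derivative_transform_within_open[OF _ S x])
      (simp add: linear_eq_sum_Basis[OF J_linear, symmetric])
  from fun_cong[OF frechet_derivative_at[OF this]]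
  have 2: "DJ x v z = (\<Sum>b\<in>Basis. (z \<bullet> b) *\<^sub>R DJ x v b)" for z by simp
  show ?thesis unfolding drift_def 1 2[of "J x v"] by (simp add: scaleR_diff_right sum_subtractf)
qed

lemma drift_continuous: "continuous_on S (drift v)"
  unfolding drift_def[abs_def]
  by (intro continuous_intros smooth_on_continuous smooth_on_frechet_derivative J)

text \<open>The hypothesis \<open>eq\<close> is dd^c u = 0 at x. On the pair v, Jv, with JJv = -v,
  its second-order part is the sum of the two pure second derivatives; the first-order part comes
  from differentiating J.\<close>

lemma hessian_sum_eq_drift:
  assumes x: "x \<in> S" and eq: "\<And>v w. frechet_derivative (\<lambda>y. Du y (J y w)) (at x) v =
     frechet_derivative (\<lambda>y. Du y (J y v)) (at x) w"
  shows "Hu x v v + Hu x (J x v) (J x v) = Du x (drift v x)"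
proof -
  have neg: "Hu x v (- v) = - Hu x v v"
    using Hu_eq_sum[OF x, where v = v and z = "- v"] Hu_eq_sum[OF x, where v = v and z = v] by (simp add: sum_negf)
  have "Hu x v (J x (J x v)) + Du x (DJ x v (J x v)) = Hu x (J x v) (J x v) + Du x (DJ x (J x v) v)"
    using eq[of "J x v" v] by (simp only: derivative_Du_J[OF x])
  then show ?thesis
    by (simp add: neg J_square[OF x] drift_eq[OF x] linear_diff[OF Du_linear[OF x]])
qed

text \<open>At an interior maximum of the sum, its first derivative along the line z + t v vanishes
  and its second is at most 0; solving for u leaves the derivatives of the bump with reversed
  sign.\<close>

lemma max_derivatives:
  assumes T: "open T" "T \<subseteq> S" "z \<in> T" and max: "\<And>x. x \<in> T \<Longrightarrow> u x + \<epsilon> * bump a y0 x \<le> u z + \<epsilon> * bump a y0 z"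
  shows "Du z v = \<epsilon> * (2 * a * ((z - y0) \<bullet> v) * bump a y0 z)"
    and "Hu z v v \<le> - \<epsilon> * ((4 * a^2 * ((z - y0) \<bullet> v)^2 - 2 * a * (v \<bullet> v)) * bump a y0 z)"
proof -
  let ?l = "\<lambda>t. z + t *\<^sub>R v"
  have "continuous (at (0::real)) ?l" by (intro continuous_intros)
  then have "\<forall>\<^sub>F t in at 0. ?l t \<in> T"
    using T topological_tendstoD[of ?l "?l 0" "at 0" T] by (simp add: isCont_def)
  then obtain d where d: "d > 0" "\<And>t. \<bar>t\<bar> < d \<Longrightarrow> ?l t \<in> T"
    unfolding eventually_at using T(3) by (metis dist_0_norm dist_commute real_norm_def scaleR_zero_left add_0_right UNIV_I)
  have line: "((\<lambda>t. f (?l t)) has_real_derivative f' v) (at t)" if "(f has_derivative f') (at (?l t))" for f f' t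
  proof -
    have "(?l has_derivative (\<lambda>s. s *\<^sub>R v)) (at t)" by (auto intro!: derivative_eq_intros)
    then have "((\<lambda>t. f (?l t)) has_derivative (\<lambda>s. f' (s *\<^sub>R v))) (at t)"
      using that by (rule has_derivative_compose)
    then show ?thesis
      using linear_cmul[OF has_derivative_linear[OF that]]
      by (simp add: has_field_derivative_def mult_commute_abs)
  qed
  let ?f = "\<lambda>t. u (?l t) + \<epsilon> * bump a y0 (?l t)"
  let ?f' = "\<lambda>t. Du (?l t) v + \<epsilon> * (- 2 * a * ((?l t - y0) \<bullet> v) * bump a y0 (?l t))"
  have f: "(?f has_real_derivative ?f' t) (at t)" if "\<bar>t\<bar> < d" for t
    by (intro DERIV_add DERIV_cmult bump_line_derivative line[of u] Du_has_derivative) (use that d T in auto)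
  have f': "(?f' has_real_derivative
     Hu z v v + \<epsilon> * (- 2 * a * (v \<bullet> v) * bump a y0 z + - 2 * a * ((z - y0) \<bullet> v) * (- 2 * a * ((z - y0) \<bullet> v) * bump a y0 z))) (at 0)"
  proof (intro DERIV_add DERIV_cmult)
    show "((\<lambda>t. Du (?l t) v) has_real_derivative Hu z v v) (at 0)"
      using line[of "\<lambda>y. Du y v" "\<lambda>w. Hu z w v" 0] Hu_has_derivative[of z v] T by auto
    have "((\<lambda>t. - 2 * a * ((?l t - y0) \<bullet> v)) has_real_derivative - 2 * a * (v \<bullet> v)) (at 0)"
      by (auto intro!: derivative_eq_intros simp: inner_add_left inner_diff_left)
    from DERIV_mult[OF this bump_line_derivative[of a y0 z v 0]]
    show "((\<lambda>t. - 2 * a * ((?l t - y0) \<bullet> v) * bump a y0 (?l t)) has_real_derivative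
      - 2 * a * (v \<bullet> v) * bump a y0 z + - 2 * a * ((z - y0) \<bullet> v) * (- 2 * a * ((z - y0) \<bullet> v) * bump a y0 z)) (at 0)"
      by (simp add: algebra_simps)
  qed
  have mx: "?f t \<le> ?f 0" if "\<bar>t\<bar> < d" for t using max[OF d(2)[OF that]] by simp
  note s = second_derivative_local_max[OF d(1) f f' mx]
  from s(1) show "Du z v = \<epsilon> * (2 * a * ((z - y0) \<bullet> v) * bump a y0 z)" by (simp add: algebra_simps)
  from s(2) show "Hu z v v \<le> - \<epsilon> * ((4 * a^2 * ((z - y0) \<bullet> v)^2 - 2 * a * (v \<bullet> v)) * bump a y0 z)"
    by (simp add: algebra_simps power2_eq_square)
qed

text \<open>Hopf's barrier argument. At a point \<open>x1\<close> where the maximum set touches a ball, only the second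
  derivatives along the radial direction \<open>v\<close> and along \<open>Jv\<close> are needed: the barrier \<open>bump\<close> is
  strictly convex enough along \<open>v\<close> alone, so no sum over a basis occurs.\<close>

lemma strong_maximum_principle:
  assumes eq: "\<And>x v w. x \<in> S \<Longrightarrow> frechet_derivative (\<lambda>y. Du y (J y w)) (at x) v =
     frechet_derivative (\<lambda>y. Du y (J y v)) (at x) w"
    and M: "\<And>x. x \<in> S \<Longrightarrow> u x \<le> M" and p: "p \<in> S" "u p = M"
  shows "\<exists>r>0. ball p r \<subseteq> S \<and> (\<forall>x\<in>ball p r. u x = M)"
proof -
  obtain r0 where r0: "r0 > 0" "cball p r0 \<subseteq> S" using S p(1) open_contains_cball by blast
  define r where "r = r0 / 2"
  have r: "r > 0" "cball p (2 * r) \<subseteq> S" using r0 by (auto simp: r_def)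
  have u_cont: "continuous_on S u" by (rule smooth_on_continuous[OF u])
  have "u y = M" if y: "y \<in> ball p r" for y
  proof (rule ccontr)
    assume ny: "u y \<noteq> M"
    \<comment> \<open>K collects the maximum points near p, and x1 will be one closest to the
      supposed counterexample y, so the open ball about y through x1 misses K. The radius 2r keeps
      that ball inside the region where K is defined.\<close>
    define K where "K = {x \<in> cball p (2 * r). u x = M}"
    have "closed K" unfolding K_def
      by (intro continuous_closed_preimage_constant continuous_on_subset[OF u_cont] r closed_cball)
    then have "compact K" unfolding K_def
      by (metis (no_types, lifting) bounded_cball bounded_subset compact_eq_bounded_closed mem_Collect_eq subsetI)
    moreover have pK: "p \<in> K" using p r by (simp add: K_def)
    moreover have "continuous_on K (dist y)" by (intro continuous_intros)
    ultimately obtain x1 where x1: "x1 \<in> K" "\<And>x. x \<in> K \<Longrightarrow> dist y x1 \<le> dist y x"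
      using continuous_attains_inf[of K "dist y"] by blast
    define R where "R = dist y x1"
    have R: "R > 0" "R < r" using x1(1) ny x1(2)[OF pK] y by (auto simp: R_def K_def dist_commute)
    have inner: "u x < M" if "dist y x < R" for x
    proof -
      have "dist p x \<le> dist p y + dist y x" by (rule dist_triangle)
      then have "x \<in> cball p (2 * r)" using y that R by simp
      moreover have "x \<notin> K" using x1(2) that by (auto simp: R_def not_le[symmetric])
      ultimately have "x \<in> S" "u x \<noteq> M" using r by (auto simp: K_def)
      then show ?thesis using M[of x] by simp
    qed
    \<comment> \<open>The ball of half the radius about the midpoint touches the boundary of the
      first ball only at x1, so on the closed smaller ball u < M except at x1.\<close>
    define y0 where "y0 = midpoint y x1"
    define v where "v = x1 - y0"
    have nv: "norm v = R / 2" "dist y y0 = R / 2" "dist y0 x1 = R / 2"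
      by (auto simp: v_def y0_def R_def dist_midpoint dist_norm[symmetric] dist_commute)
    have touch: "u x < M" if x: "dist y0 x \<le> R / 2" "x \<noteq> x1" for x
    proof (cases "dist y x < R")
      case False
      have "dist y x \<le> dist y y0 + dist y0 x" by (rule dist_triangle)
      then have d: "dist y x = R" "dist y0 x = R / 2" using False x(1) nv by auto
      then have "dist y x = dist y y0 + dist y0 x" using nv by simp
      \<comment> \<open>Equality in the triangle inequality puts x on the ray from y through y0, at
        the same distance as x1.\<close>
      then have "norm (y0 - y) *\<^sub>R (x - y0) = norm (x - y0) *\<^sub>R (y0 - y)"
        using norm_triangle_eq[of "y0 - y" "x - y0"] by (simp add: dist_norm norm_minus_commute)
      moreover have "norm (y0 - y) = R / 2" "norm (x - y0) = R / 2"
        using nv d by (simp_all add: dist_norm norm_minus_commute)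
      ultimately have "x - y0 = y0 - y" using R by simp
      moreover have "x1 - y0 = y0 - y" by (simp add: y0_def midpoint_def algebra_simps flip: scaleR_2)
      ultimately have "x - y0 = x1 - y0" by simp
      then show ?thesis using x(2) by simp
    qed (rule inner)
    have x1p: "dist p x1 < 2 * r"
      using dist_triangle[of p x1 y] y R by (simp add: R_def)
    \<comment> \<open>The first bound keeps the ball around x1 inside S; the second keeps the
      product of x - y0 with v at least half of its value (R/2)^2 at x1.\<close>
    define \<rho> where "\<rho> = min (2 * r - dist p x1) (R / 4)"
    have \<rho>: "\<rho> > 0" "\<rho> \<le> R / 4" using x1p R unfolding \<rho>_def by linarith+
    have ball_S: "cball x1 \<rho> \<subseteq> S"
    proof
      fix x assume "x \<in> cball x1 \<rho>"
      then have "dist p x \<le> 2 * r" using dist_triangle[of p x x1] by (simp add: \<rho>_def)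
      then show "x \<in> S" using r by auto
    qed
    have s0: "(x - y0) \<bullet> v \<ge> (R / 2)\<^sup>2 / 2" if "x \<in> cball x1 \<rho>" for x
    proof -
      have "\<bar>(x - x1) \<bullet> v\<bar> \<le> norm (x - x1) * norm v" by (rule Cauchy_Schwarz_ineq2)
      also have "\<dots> \<le> (R / 4) * (R / 2)"
        using that \<rho> nv R by (intro mult_mono) (auto simp: dist_norm norm_minus_commute)
      finally have "(x - x1) \<bullet> v \<ge> - ((R / 4) * (R / 2))" by simp
      moreover have "(x - y0) \<bullet> v = (x - x1) \<bullet> v + v \<bullet> v"
        by (simp add: v_def inner_diff_left)
      moreover have "v \<bullet> v = (R / 2)\<^sup>2" by (simp add: power2_norm_eq_inner[symmetric] nv)
      ultimately show ?thesis by (simp add: power2_eq_square)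
    qed
    \<comment> \<open>The terms of the final inequality that do not grow with a; continuity bounds
      them on the compact ball.\<close>
    define \<kappa> where "\<kappa> x = v \<bullet> v + J x v \<bullet> J x v + norm (x - y0) * norm (drift v x)" for x
    have "continuous_on (cball x1 \<rho>) \<kappa>"
      unfolding \<kappa>_def
      by (intro continuous_intros continuous_on_subset[OF drift_continuous ball_S]
          continuous_on_subset[OF smooth_on_continuous[OF J] ball_S])
    then obtain k where k: "\<And>x. x \<in> cball x1 \<rho> \<Longrightarrow> \<kappa> x \<le> k"
      using continuous_attains_sup[of "cball x1 \<rho>" \<kappa>] \<rho> by (metis centre_in_cball compact_cball empty_iff less_imp_le)
    define s where "s = (R / 2)\<^sup>2 / 2"
    have s: "s > 0" using R by (simp add: s_def)
    \<comment> \<open>In the final inequality the convexity term is at least 2 a s^2 and the rest at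
      most k, so a s^2 > k gives the contradiction. The absolute value keeps a positive whatever the
      sign of k.\<close>
    define a where "a = (\<bar>k\<bar> + 1) / s\<^sup>2"
    have a: "a > 0" "a * s\<^sup>2 > k" using s by (auto simp: a_def)
    \<comment> \<open>The barrier normalised to vanish at x1: negative outside the smaller closed
      ball and below 1 everywhere.\<close>
    define h where "h x = bump a y0 x - exp (- a * (R / 2)\<^sup>2)" for x
    have h1: "h x < 1" for x
      using a by (simp add: h_def bump_def) (smt (verit, best) exp_gt_zero exp_le_one_iff inner_ge_zero mult_nonneg_nonneg mult_minus_left)
    have bump_norm: "bump a y0 x = exp (- a * (dist y0 x)\<^sup>2)" for x
      by (simp add: bump_def dist_norm norm_minus_commute power2_norm_eq_inner)
    have hneg: "h x < 0" if "dist y0 x > R / 2" for x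
      using that R a power_strict_mono[of "R / 2" "dist y0 x" 2] by (simp add: h_def bump_norm)
    have hx1: "h x1 = 0" by (simp add: h_def bump_norm nv)
    \<comment> \<open>The part of the small sphere where h can be nonnegative. There u stays below M
      by a fixed \<delta>, which can serve as the weight of the barrier because h < 1; off C the
      barrier itself is negative.\<close>
    define C where "C = sphere x1 \<rho> \<inter> cball y0 (R / 2)"
    have C: "compact C" "C \<subseteq> S" "x1 \<notin> C"
      using ball_S \<rho> by (auto simp: C_def intro: compact_Int_closed)
    have "\<exists>\<delta>>0. \<forall>x\<in>C. u x \<le> M - \<delta>"
    proof (cases "C = {}")
      case False
      then obtain c where c: "c \<in> C" "\<forall>x\<in>C. u x \<le> u c"
        using continuous_attains_sup[OF C(1) False continuous_on_subset[OF u_cont C(2)]] by blast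
      have "u c < M" using touch[of c] c(1) C(3) by (auto simp: C_def)
      then show ?thesis using c by (intro exI[of _ "M - u c"]) auto
    qed (auto intro: exI[of _ 1])
    then obtain \<delta> where \<delta>: "\<delta> > 0" "\<And>x. x \<in> C \<Longrightarrow> u x \<le> M - \<delta>" by blast
    define f where "f x = u x + \<delta> * bump a y0 x" for x
    have bd: "f x < f x1" if "x \<in> sphere x1 \<rho>" for x
    proof -
      have "u x + \<delta> * h x < M"
      proof (cases "x \<in> C")
        case True
        have "\<delta> * h x < \<delta> * 1" using \<delta>(1) h1 by (intro mult_strict_left_mono)
        then show ?thesis using \<delta>(2)[OF True] by simp
      next
        case False
        then have "h x < 0" using that by (intro hneg) (auto simp: C_def)
        then have "\<delta> * h x < 0" using \<delta>(1) by (simp add: mult_pos_neg)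
        moreover have "u x \<le> M" using ball_S that by (intro M) auto
        ultimately show ?thesis by simp
      qed
      also have "M = u x1 + \<delta> * h x1" using x1(1) hx1 by (simp add: K_def)
      finally show ?thesis by (simp add: f_def h_def right_diff_distrib)
    qed
    have "continuous_on (cball x1 \<rho>) f"
      unfolding f_def bump_def
      by (intro continuous_intros continuous_on_subset[OF u_cont ball_S])
    then obtain z where z: "z \<in> cball x1 \<rho>" "\<And>x. x \<in> cball x1 \<rho> \<Longrightarrow> f x \<le> f z"
      using continuous_attains_sup[of "cball x1 \<rho>" f] \<rho> by (metis centre_in_cball compact_cball empty_iff less_imp_le)
    have "z \<notin> sphere x1 \<rho>" using bd[of z] z(2)[of x1] \<rho> by auto
    then have zb: "z \<in> ball x1 \<rho>" using z(1) by auto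
    have zS: "z \<in> S" using z(1) ball_S by auto
    have mx: "u x + \<delta> * bump a y0 x \<le> u z + \<delta> * bump a y0 z" if "x \<in> ball x1 \<rho>" for x
      using z(2)[of x] that by (simp add: f_def)
    have bS: "ball x1 \<rho> \<subseteq> S" using ball_S by auto
    note md = max_derivatives[OF open_ball bS zb mx]
    let ?E = "bump a y0 z" and ?w = "J z v" and ?b = "drift v z"
    have E: "\<delta> * ?E > 0" using \<delta>(1) by (simp add: bump_def)
    \<comment> \<open>At z the relation between the Hessian and the drift holds for u, and the
      barrier controls both sides: the gradient exactly, the second derivatives from above. The
      positive factor \<open>\<delta> * ?E\<close> then cancels.\<close>
    have "\<delta> * (2 * a * ((z - y0) \<bullet> ?b) * ?E) = Hu z v v + Hu z ?w ?w"
      using hessian_sum_eq_drift[OF zS, of v] eq[OF zS] md(1)[of ?b] by simp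
    also have "\<dots> \<le> - \<delta> * ((4 * a\<^sup>2 * ((z - y0) \<bullet> v)\<^sup>2 - 2 * a * (v \<bullet> v)) * ?E)
        + - \<delta> * ((4 * a\<^sup>2 * ((z - y0) \<bullet> ?w)\<^sup>2 - 2 * a * (?w \<bullet> ?w)) * ?E)"
      using md(2)[of v] md(2)[of ?w] by (rule add_mono)
    finally have "(\<delta> * ?E) * (2 * a * ((z - y0) \<bullet> ?b)) \<le> (\<delta> * ?E) *
       (2 * a * (v \<bullet> v + ?w \<bullet> ?w) - 4 * a\<^sup>2 * ((z - y0) \<bullet> v)\<^sup>2 - 4 * a\<^sup>2 * ((z - y0) \<bullet> ?w)\<^sup>2)"
      by (simp add: algebra_simps)
    then have "2 * a * ((z - y0) \<bullet> ?b) \<le>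
       2 * a * (v \<bullet> v + ?w \<bullet> ?w) - 4 * a\<^sup>2 * ((z - y0) \<bullet> v)\<^sup>2 - 4 * a\<^sup>2 * ((z - y0) \<bullet> ?w)\<^sup>2"
      using E by (simp only: mult_le_cancel_left_pos)
    \<comment> \<open>The square in the direction Jv has the favourable sign and is dropped.\<close>
    then have "2 * a * (2 * a * ((z - y0) \<bullet> v)\<^sup>2) \<le> 2 * a * (v \<bullet> v + ?w \<bullet> ?w - (z - y0) \<bullet> ?b)"
      using zero_le_power2[of "2 * a * ((z - y0) \<bullet> ?w)"] by (simp add: algebra_simps power2_eq_square)
    then have "2 * a * ((z - y0) \<bullet> v)\<^sup>2 \<le> v \<bullet> v + ?w \<bullet> ?w - (z - y0) \<bullet> ?b"
      by (rule mult_left_le_imp_le) (use a in simp)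
    also have "\<dots> \<le> \<kappa> z"
      using Cauchy_Schwarz_ineq2[of "z - y0" ?b] by (simp add: \<kappa>_def)
    also have "\<dots> \<le> k" by (rule k[OF z(1)])
    finally have "2 * a * ((z - y0) \<bullet> v)\<^sup>2 \<le> k" .
    moreover have "s\<^sup>2 \<le> ((z - y0) \<bullet> v)\<^sup>2" using s0[OF z(1)] s by (intro power_mono) (auto simp: s_def)
    then have "2 * a * s\<^sup>2 \<le> 2 * a * ((z - y0) \<bullet> v)\<^sup>2" using a(1) by simp
    moreover have "a * s\<^sup>2 > 0" using a s by simp
    ultimately show False using a(2) by linarith
  qed
  then show ?thesis using r by (intro exI[of _ r]) auto
qed

end

section \<open>Forms on almost complex manifolds\<close>

lemma frechet_derivative_bounded_linear:
  assumes "bounded_linear h" "f differentiable (at x)"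
  shows "frechet_derivative (\<lambda>y. h (f y)) (at x) v = h (frechet_derivative f (at x) v)"
proof -
  have "(f has_derivative frechet_derivative f (at x)) (at x)"
    using assms(2) frechet_derivative_works by blast
  from bounded_linear.has_derivative[OF assms(1) this] show ?thesis
    by (simp add: frechet_derivative_at[symmetric])
qed

lemma smooth_on_pf:
  assumes "open S" "\<And>v w. smooth_on S (\<lambda>x. \<omega> x v w)"
  shows "smooth_on S (\<lambda>x. pf (\<omega> x) vs)"
proof (induction vs rule: length_induct)
  case (1 vs)
  show ?case
  proof (cases vs)
    case (Cons v us)
    have "smooth_on S (\<lambda>x. pf (\<omega> x) (omit j us))" for j
      using 1 Cons length_omit_le[of j us] by simp
    then show ?thesis
      unfolding Cons pf.simps by (intro smooth_on_sum smooth_on_mult smooth_on_const assms)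
  qed (simp add: smooth_on_const)
qed

lemma on_charts_idem: "on_charts A (on_charts A \<alpha>) = on_charts A \<alpha>"
  by (auto simp: on_charts_def fun_eq_iff)

lemma on_charts_eqI:
  assumes "on_charts A \<alpha> = \<alpha>" "on_charts A \<beta> = \<beta>" "\<And>c p. c \<in> A \<Longrightarrow> p \<in> fst c \<Longrightarrow> \<alpha> c p = \<beta> c p"
  shows "\<alpha> = \<beta>"
proof (intro ext)
  fix c p vs
  show "\<alpha> c p vs = \<beta> c p vs"
    using assms(3)[of c p] fun_cong[OF fun_cong[OF assms(1), of c], of p]
      fun_cong[OF fun_cong[OF assms(2), of c], of p]
    by (auto simp: on_charts_def split: if_splits)
qed

lemma on_charts_zero: "on_charts A 0 = 0"
  by (auto simp: on_charts_def fun_eq_iff)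

lemma cdim_line:
  assumes "V = range (\<lambda>z. cform_scale z X)" "X \<noteq> 0"
  shows "cdim V = 1"
proof -
  have V: "V = cform.span {X}" using assms(1) by (simp add: cform.span_singleton)
  have "cform.dim V = 1"
    using assms(2) by (simp add: V cform.dim_eq_card_independent)
  then show ?thesis
    unfolding cdim_def using V by (auto simp: one_enat_def intro: exI[of _ "{X}"])
qed

locale almost_complex_manifold =
  fixes A :: "('a::{t2_space,second_countable_topology}, 'e::euclidean_space) chart set"
    and J :: "('a, 'e) endo_field" and m :: nat
  assumes compact_M: "compact (UNIV :: 'a set)" and connected_M: "connected (UNIV :: 'a set)"
    and dim_M: "DIM('e) = 2 * m"
    and atlas: "smooth_atlas A" and acs: "almost_complex_structure A J"
begin

lemma chart: "c \<in> A \<Longrightarrow> is_chart c" using atlas by (simp add: smooth_atlas_def)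

lemma chart_exists: obtains c where "c \<in> A" "p \<in> fst c"
  using atlas unfolding smooth_atlas_def by (metis UNIV_I UN_E)

lemma chart_open: "c \<in> A \<Longrightarrow> open (snd c ` fst c)" "c \<in> A \<Longrightarrow> open (fst c)"
  using chart by (auto simp: is_chart_def)

lemma chart_inv_left: "c \<in> A \<Longrightarrow> p \<in> fst c \<Longrightarrow> chart_inv c (snd c p) = p"
  using chart unfolding is_chart_def homeomorphism_def by blast

lemma chart_inv_right:
  assumes "c \<in> A" "x \<in> snd c ` fst c"
  shows "chart_inv c x \<in> fst c" "snd c (chart_inv c x) = x"
proof -
  obtain p where "p \<in> fst c" "x = snd c p" using assms(2) by blast
  then show "chart_inv c x \<in> fst c" "snd c (chart_inv c x) = x"
    using chart_inv_left[OF assms(1)] by simp_all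
qed

lemma chart_continuous: "c \<in> A \<Longrightarrow> continuous_on (fst c) (snd c)"
  using chart unfolding is_chart_def homeomorphism_def by blast

lemma J_point:
  assumes "c \<in> A" "p \<in> fst c"
  shows "linear (J c p)" "J c p (J c p v) = - v"
  using acs assms unfolding almost_complex_structure_def by auto

lemma J_smooth: "c \<in> A \<Longrightarrow> smooth_on (snd c ` fst c) (\<lambda>x. J c (chart_inv c x) v)"
  using acs unfolding almost_complex_structure_def by blast

text \<open>The chartwise conditions of \<open>cforms\<close>. The class is stable under d without
  appeal to the naturality of d under coordinate changes.\<close>

definition local_forms :: "nat \<Rightarrow> ('a, 'e) cform set" where
  "local_forms k = {\<alpha>. on_charts A \<alpha> = \<alpha> \<and> (\<forall>c\<in>A. \<forall>p\<in>fst c. \<alpha> c p \<in> alt_covec k) \<and>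
     (\<forall>c\<in>A. \<forall>vs. smooth_on (snd c ` fst c) (\<lambda>x. \<alpha> c (chart_inv c x) vs))}"

lemma local_formsI:
  assumes "on_charts A \<alpha> = \<alpha>" "\<And>c p. c \<in> A \<Longrightarrow> p \<in> fst c \<Longrightarrow> \<alpha> c p \<in> alt_covec k"
    and "\<And>c vs. c \<in> A \<Longrightarrow> smooth_on (snd c ` fst c) (\<lambda>x. \<alpha> c (chart_inv c x) vs)"
  shows "\<alpha> \<in> local_forms k"
  using assms by (auto simp: local_forms_def)

lemma local_forms_on_charts: "\<alpha> \<in> local_forms k \<Longrightarrow> on_charts A \<alpha> = \<alpha>"
  and local_forms_alt_covec: "\<alpha> \<in> local_forms k \<Longrightarrow> c \<in> A \<Longrightarrow> p \<in> fst c \<Longrightarrow> \<alpha> c p \<in> alt_covec k"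
  and local_forms_smooth:
    "\<alpha> \<in> local_forms k \<Longrightarrow> c \<in> A \<Longrightarrow> smooth_on (snd c ` fst c) (\<lambda>x. \<alpha> c (chart_inv c x) vs)"
  by (auto simp: local_forms_def)

lemma cforms_local_forms: "\<alpha> \<in> cforms A k \<Longrightarrow> \<alpha> \<in> local_forms k"
  by (auto simp: cforms_def local_forms_def)

lemma ext_d_eq:
  assumes "c \<in> A" "p \<in> fst c"
  shows "ext_d A \<alpha> c p = extd (\<lambda>x. \<alpha> c (chart_inv c x)) (snd c p)"
  using assms by (simp add: ext_d_def on_charts_def extd_def omit_def fun_eq_iff)

lemma ext_d_on_charts: "on_charts A (ext_d A \<alpha>) = ext_d A \<alpha>"
  by (simp add: ext_d_def on_charts_idem)

lemma ext_d_local_forms: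
  assumes a: "\<alpha> \<in> local_forms k"
  shows "ext_d A \<alpha> \<in> local_forms (k + 1)"
proof (rule local_formsI[OF ext_d_on_charts])
  fix c p assume c: "c \<in> A" "p \<in> fst c"
  show "ext_d A \<alpha> c p \<in> alt_covec (k + 1)"
    unfolding ext_d_eq[OF c]
    by (rule extd_alt_covec[OF chart_open(1)[OF c(1)]])
      (use c in \<open>auto intro: local_forms_alt_covec[OF a] simp: chart_inv_left
        intro!: smooth_on_differentiable[OF local_forms_smooth[OF a c(1)]]\<close>)
next
  fix c :: "('a, 'e) chart" and vs assume c: "c \<in> A"
  have "smooth_on (snd c ` fst c) (\<lambda>x. extd (\<lambda>x. \<alpha> c (chart_inv c x)) x vs)"
    by (rule smooth_on_extd[OF chart_open(1)[OF c] local_forms_smooth[OF a c]])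
  then show "smooth_on (snd c ` fst c) (\<lambda>x. ext_d A \<alpha> c (chart_inv c x) vs)"
    by (rule smooth_on_cong[OF _ chart_open(1)[OF c]]) (simp add: ext_d_eq[OF c] chart_inv_right[OF c])
qed

lemma ext_d_top:
  assumes "\<alpha> \<in> local_forms (DIM('e))"
  shows "ext_d A \<alpha> = 0"
proof (rule on_charts_eqI[OF ext_d_on_charts on_charts_zero])
  fix c p assume c: "c \<in> A" "p \<in> fst c"
  show "ext_d A \<alpha> c p = 0 c p"
    using alt_covec_above_dim[OF local_forms_alt_covec[OF ext_d_local_forms[OF assms] c]] by simp
qed

lemma ext_d_zero: "ext_d A 0 = 0"
  by (rule on_charts_eqI[OF ext_d_on_charts on_charts_zero]) (simp add: ext_d_eq extd_const[of 0, unfolded zero_fun_def] zero_fun_def)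

lemma J_form_on_charts: "on_charts A (J_form A J k \<alpha>) = J_form A J k \<alpha>"
  by (simp add: J_form_def on_charts_idem)

lemma J_form_inv_on_charts: "on_charts A (J_form_inv A J k \<alpha>) = J_form_inv A J k \<alpha>"
  by (simp add: J_form_inv_def on_charts_idem)

lemma J_form_eq:
  assumes "\<alpha> c p \<in> alt_covec k" "c \<in> A" "p \<in> fst c"
  shows "J_form A J k \<alpha> c p = (\<lambda>vs. \<alpha> c p (map (J c p) vs))"
  using assms J_covec_eq[OF J_point] by (simp add: J_form_def on_charts_def)

lemma J_form_inv_eq:
  assumes "\<alpha> c p \<in> alt_covec k" "c \<in> A" "p \<in> fst c"
  shows "J_form_inv A J k \<alpha> c p = (\<lambda>vs. (- 1) ^ k * \<alpha> c p (map (J c p) vs))"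
  using assms J_covec_inv_eq[OF J_point] by (simp add: J_form_inv_def on_charts_def)

lemma J_form_inv_zero: "J_form_inv A J k 0 = 0"
  by (rule on_charts_eqI[OF J_form_inv_on_charts on_charts_zero])
    (simp add: J_form_inv_eq alt_covec_zero fun_eq_iff)

lemma J_form_0: "\<alpha> \<in> local_forms 0 \<Longrightarrow> J_form A J 0 \<alpha> = \<alpha>"
proof (rule on_charts_eqI[OF J_form_on_charts local_forms_on_charts])
  fix c p assume a: "\<alpha> \<in> local_forms 0" and c: "c \<in> A" "p \<in> fst c"
  note l = local_forms_alt_covec[OF a c]
  show "J_form A J 0 \<alpha> c p = \<alpha> c p"
    unfolding J_form_eq[where \<alpha> = \<alpha>, OF l c]
  proof
    fix vs show "\<alpha> c p (map (J c p) vs) = \<alpha> c p vs"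
      using alt_covec_length[OF l, of vs] alt_covec_length[OF l, of "map (J c p) vs"] by (cases vs) auto
  qed
qed

lemma dc_eq_0I: "ext_d A (J_form A J k \<alpha>) = 0 \<Longrightarrow> dc A J k \<alpha> = 0"
  by (simp add: dc_def J_form_inv_zero)

definition constant_form :: "complex \<Rightarrow> ('a, 'e) cform" where
  "constant_form z = on_charts A (\<lambda>c p vs. if vs = [] then z else 0)"

lemma constant_form_eq: "c \<in> A \<Longrightarrow> p \<in> fst c \<Longrightarrow> constant_form z c p = (\<lambda>vs. if vs = [] then z else 0)"
  by (simp add: constant_form_def on_charts_def)

lemma constant_form_cforms: "constant_form z \<in> cforms A 0"
proof -
  have s: "smooth_on (snd c ` fst c) (\<lambda>x. constant_form z c (chart_inv c x) vs)" if c: "c \<in> A" for c vs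
    by (rule smooth_on_cong[OF smooth_on_const chart_open(1)[OF c]])
      (simp add: constant_form_eq[OF c] chart_inv_right[OF c])
  have "(\<lambda>vs. if vs = [] then z else 0) \<in> alt_covec 0"
    by (rule alt_covecI) auto
  then show ?thesis
    using s by (auto simp: cforms_def constant_form_eq) (simp add: constant_form_def on_charts_idem)
qed

lemma ext_d_constant_form: "ext_d A (constant_form z) = 0"
proof (rule on_charts_eqI[OF ext_d_on_charts on_charts_zero])
  fix c p assume c: "c \<in> A" "p \<in> fst c"
  have "extd (\<lambda>x. constant_form z c (chart_inv c x)) (snd c p) = extd (\<lambda>x vs. if vs = [] then z else 0) (snd c p)"
    by (rule extd_cong[OF chart_open(1)[OF c(1)]]) (use c in \<open>auto simp: constant_form_eq chart_inv_right\<close>)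
  then show "ext_d A (constant_form z) c p = 0 c p" using c by (simp add: ext_d_eq extd_const)
qed

lemma dc_constant_form: "dc A J 0 (constant_form z) = 0"
  by (rule dc_eq_0I) (simp add: J_form_0[OF cforms_local_forms[OF constant_form_cforms]] ext_d_constant_form)

section \<open>Constancy of functions on a compact connected manifold\<close>

lemma clopen_UNIV:
  assumes "open K" "closed K" "(p :: 'a) \<in> K"
  shows "K = UNIV"
  using connected_M[unfolded connected_clopen, rule_format, of K] assms by auto

lemma locally_constant_imp_constant:
  fixes f :: "'a \<Rightarrow> 'b"
  assumes "\<And>p. \<exists>N. open N \<and> p \<in> N \<and> (\<forall>q\<in>N. f q = f p)"
  shows "f p = f q"
proof -
  have op: "open {r. P (f r)}" for P
  proof (subst open_subopen, intro ballI)
    fix r assume r: "r \<in> {r. P (f r)}"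
    obtain N where "open N" "r \<in> N" "\<forall>q\<in>N. f q = f r" using assms by blast
    moreover from this r have "N \<subseteq> {r. P (f r)}" by (metis mem_Collect_eq subsetI)
    ultimately show "\<exists>T. open T \<and> r \<in> T \<and> T \<subseteq> {r. P (f r)}" by blast
  qed
  have "closed {r. f r = f p}"
    using op[of "\<lambda>y. y \<noteq> f p"] by (simp add: closed_def Collect_neg_eq)
  then have "{r. f r = f p} = UNIV"
    using op[of "\<lambda>y. y = f p"] by (intro clopen_UNIV[of _ p]) auto
  then have "q \<in> {r. f r = f p}" by simp
  then show ?thesis by simp
qed

lemma function_continuous:
  fixes u :: "'a \<Rightarrow> 'b::real_normed_vector"
  assumes "\<And>c. c \<in> A \<Longrightarrow> smooth_on (snd c ` fst c) (\<lambda>x. u (chart_inv c x))"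
  shows "continuous_on UNIV u"
proof -
  have "continuous_on (fst c) u" if c: "c \<in> A" for c
  proof -
    have "continuous_on (fst c) (\<lambda>p. u (chart_inv c (snd c p)))"
      by (rule continuous_on_compose2[OF smooth_on_continuous[OF assms[OF c]] chart_continuous[OF c]]) simp
    then show ?thesis by (simp add: chart_inv_left[OF c] cong: continuous_on_cong)
  qed
  then have "continuous_on (\<Union>c\<in>A. fst c) u"
    by (intro continuous_on_open_UN chart_open) auto
  then show ?thesis using atlas by (simp add: smooth_atlas_def)
qed

lemma chart_neighbourhood:
  assumes "c \<in> A" "p \<in> fst c" "r > 0"
  shows "\<exists>N. open N \<and> p \<in> N \<and> N \<subseteq> fst c \<and> snd c ` N \<subseteq> ball (snd c p) r"
  using continuous_open_preimage[OF chart_continuous[OF assms(1)] chart_open(2)[OF assms(1)] open_ball, of "snd c p" r] assms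
  by (intro exI[of _ "fst c \<inter> snd c -` ball (snd c p) r"]) auto

text \<open>The assumption \<open>eq\<close> is dd^c u = 0 written in charts. The set where the
  maximum is attained is closed by continuity and open by the strong maximum principle in a
  chart.\<close>

lemma maximum_principle:
  fixes u :: "'a \<Rightarrow> real"
  assumes u: "\<And>c. c \<in> A \<Longrightarrow> smooth_on (snd c ` fst c) (\<lambda>x. u (chart_inv c x))"
    and eq: "\<And>c x v w. c \<in> A \<Longrightarrow> x \<in> snd c ` fst c \<Longrightarrow>
      frechet_derivative (\<lambda>y. frechet_derivative (\<lambda>x. u (chart_inv c x)) (at y) (J c (chart_inv c y) w)) (at x) v =
      frechet_derivative (\<lambda>y. frechet_derivative (\<lambda>x. u (chart_inv c x)) (at y) (J c (chart_inv c y) v)) (at x) w"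
  shows "u p = u q"
proof -
  have cont: "continuous_on UNIV u" by (rule function_continuous[OF u])
  obtain p0 where p0: "\<And>p. u p \<le> u p0"
    using continuous_attains_sup[OF compact_M _ cont] by auto
  let ?K = "{p. u p = u p0}"
  have "open ?K"
  proof (subst open_subopen, intro ballI)
    fix p assume p: "p \<in> ?K"
    obtain c where c: "c \<in> A" "p \<in> fst c" by (rule chart_exists)
    have "\<exists>r>0. ball (snd c p) r \<subseteq> snd c ` fst c \<and> (\<forall>x\<in>ball (snd c p) r. u (chart_inv c x) = u p0)"
    proof (rule strong_maximum_principle[OF chart_open(1)[OF c(1)] u[OF c(1)] J_smooth[OF c(1)]])
      fix x assume "x \<in> snd c ` fst c"
      then show "linear (J c (chart_inv c x))" "\<And>v. J c (chart_inv c x) (J c (chart_inv c x) v) = - v"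
        using J_point[OF c(1)] chart_inv_right[OF c(1)] by auto
    qed (use c p p0 eq in \<open>auto simp: chart_inv_left\<close>)
    then obtain r where r: "r > 0" "\<forall>x\<in>ball (snd c p) r. u (chart_inv c x) = u p0" by blast
    obtain N where N: "open N" "p \<in> N" "N \<subseteq> fst c" "snd c ` N \<subseteq> ball (snd c p) r"
      using chart_neighbourhood[OF c r(1)] by blast
    have "u q = u p0" if "q \<in> N" for q
    proof -
      have "snd c q \<in> ball (snd c p) r" "q \<in> fst c" using N that by auto
      then show ?thesis using r(2) chart_inv_left[OF c(1)] by metis
    qed
    then show "\<exists>T. open T \<and> p \<in> T \<and> T \<subseteq> ?K" using N by (intro exI[of _ N]) auto
  qed
  moreover have "closed ?K"
    using continuous_closed_preimage_constant[OF cont closed_UNIV, of "u p0"] by simp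
  ultimately have "?K = UNIV" by (intro clopen_UNIV[of _ p0]) auto
  then show ?thesis by (metis (mono_tags) UNIV_I mem_Collect_eq)
qed

lemma exact_0_form_constant:
  assumes a: "\<alpha> \<in> cforms A 0" and d: "ext_d A \<alpha> = 0"
  shows "\<exists>z. \<alpha> = constant_form z"
proof -
  note l = cforms_local_forms[OF a]
  \<comment> \<open>The chart is chosen arbitrarily at each p; on the empty list of vectors the
    transformation law says that the value does not depend on it.\<close>
  define f where "f p = \<alpha> (SOME c. c \<in> A \<and> p \<in> fst c) p []" for p
  have f: "\<alpha> c p [] = f p" if "c \<in> A" "p \<in> fst c" for c p
  proof -
    define c' where "c' = (SOME c. c \<in> A \<and> p \<in> fst c)"
    have "c' \<in> A \<and> p \<in> fst c'" unfolding c'_def by (rule someI[of _ c]) (use that in auto)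
    then have "\<alpha> c p [] = \<alpha> c' p (map (coord_change c c' p) [])"
      using a that unfolding cforms_def by blast
    then show ?thesis by (simp add: f_def c'_def)
  qed
  have "f p = f q" for p q
  proof (rule locally_constant_imp_constant)
    fix p :: 'a
    obtain c where c: "c \<in> A" "p \<in> fst c" by (rule chart_exists)
    let ?F = "\<lambda>x. \<alpha> c (chart_inv c x) []"
    obtain r where r: "r > 0" "ball (snd c p) r \<subseteq> snd c ` fst c"
      using chart_open(1)[OF c(1)] c(2) open_contains_ball by blast
    obtain N where N: "open N" "p \<in> N" "N \<subseteq> fst c" "snd c ` N \<subseteq> ball (snd c p) r"
      using chart_neighbourhood[OF c r(1)] by blast
    have "(?F has_derivative (\<lambda>v. 0)) (at x within ball (snd c p) r)" if x: "x \<in> ball (snd c p) r" for x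
    proof -
      have xc: "x \<in> snd c ` fst c" using x r by auto
      have "frechet_derivative ?F (at x) v = ext_d A \<alpha> c (chart_inv c x) [v]" for v
        using chart_inv_right[OF c(1) xc] by (simp add: ext_d_eq[OF c(1)] extd_def omit_def)
      then have "frechet_derivative ?F (at x) = (\<lambda>v. 0)" by (simp add: d fun_eq_iff)
      then show ?thesis
        using smooth_on_differentiable[OF local_forms_smooth[OF l c(1)] xc, of "[]"]
        by (metis frechet_derivative_works has_derivative_at_withinI)
    qed
    then have F: "?F x = ?F y" if "x \<in> ball (snd c p) r" "y \<in> ball (snd c p) r" for x y
      using has_derivative_zero_unique[OF convex_ball, of _ _ ?F] that by blast
    have "f q = f p" if "q \<in> N" for q
    proof -
      have "?F (snd c q) = ?F (snd c p)" using N that by (intro F) auto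
      moreover have "q \<in> fst c" using N that by auto
      ultimately show ?thesis using c by (simp add: chart_inv_left f)
    qed
    then show "\<exists>N. open N \<and> p \<in> N \<and> (\<forall>q\<in>N. f q = f p)" using N by blast
  qed
  then have fz: "f p = f undefined" for p by blast
  have "\<alpha> = constant_form (f undefined)"
  proof (rule on_charts_eqI[OF local_forms_on_charts[OF l] local_forms_on_charts[OF cforms_local_forms[OF constant_form_cforms]]])
    fix c p assume c: "c \<in> A" "p \<in> fst c"
    show "\<alpha> c p = constant_form (f undefined) c p"
      unfolding constant_form_eq[OF c]
      using f[OF c] fz[of p] alt_covec_length[OF local_forms_alt_covec[OF l c]] by (auto simp: fun_eq_iff)
  qed
  then show ?thesis ..
qed

end

section \<open>Functions with dd^c f = 0\<close>

context almost_complex_manifold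
begin

lemma function_local_form:
  assumes "\<And>c. c \<in> A \<Longrightarrow> smooth_on (snd c ` fst c) (\<lambda>x. f (chart_inv c x))"
  shows "on_charts A (\<lambda>c p vs. if vs = [] then f p else 0) \<in> local_forms 0" (is "?F \<in> _")
proof (rule local_formsI[OF on_charts_idem])
  show "?F c p \<in> alt_covec 0" if "c \<in> A" "p \<in> fst c" for c p
    unfolding on_charts_def using that by (intro alt_covecI) auto
  show "smooth_on (snd c ` fst c) (\<lambda>x. ?F c (chart_inv c x) vs)" if c: "c \<in> A" for c vs
  proof (cases "vs = []")
    case True
    show ?thesis
      by (rule smooth_on_cong[OF assms[OF c] chart_open(1)[OF c]])
        (use c in \<open>simp add: True on_charts_def chart_inv_right\<close>)
  next
    case False
    then have "(\<lambda>x. ?F c (chart_inv c x) vs) = (\<lambda>x. 0)" by (auto simp: on_charts_def)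
    then show ?thesis by (simp only: smooth_on_const)
  qed
qed

text \<open>J is trivial in degree 0, and in degree 1 its inverse is minus the pullback.\<close>

lemma dc_0:
  assumes F: "F \<in> local_forms 0" and c: "c \<in> A" "p \<in> fst c"
  shows "dc A J 0 F c p vs = - ext_d A F c p (map (J c p) vs)"
proof -
  have "ext_d A F \<in> local_forms 1" using ext_d_local_forms[OF F] by simp
  from J_form_inv_eq[where \<alpha> = "ext_d A F" and k = 1, OF local_forms_alt_covec[OF this c] c]
  show ?thesis by (simp add: dc_def J_form_0[OF F])
qed

lemma dc_0_local_forms:
  assumes F: "F \<in> local_forms 0"
  shows "dc A J 0 F \<in> local_forms 1"
proof (rule local_formsI)
  have dF: "ext_d A F \<in> local_forms 1" using ext_d_local_forms[OF F] by simp
  show "on_charts A (dc A J 0 F) = dc A J 0 F" by (simp add: dc_def J_form_inv_on_charts)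
  show "dc A J 0 F c p \<in> alt_covec 1" if c: "c \<in> A" "p \<in> fst c" for c p
  proof -
    have "dc A J 0 F c p = covec_scale (- 1) (\<lambda>vs. ext_d A F c p (map (J c p) vs))"
      by (simp add: fun_eq_iff covec_scale_def dc_0[OF F c])
    then show ?thesis
      by (simp only: alt_covec_scale alt_covec_map[OF J_point(1)[OF c] local_forms_alt_covec[OF dF c]])
  qed
  show "smooth_on (snd c ` fst c) (\<lambda>x. dc A J 0 F c (chart_inv c x) vs)" if c: "c \<in> A" for c vs
  proof (cases "length vs = 1")
    case True
    then obtain v where v: "vs = [v]" by (auto simp: length_Suc_conv)
    let ?q = "chart_inv c"
    show ?thesis
    proof (rule smooth_on_cong[OF _ chart_open(1)[OF c]])
      \<comment> \<open>Smoothness of dF is known on fixed vectors only, so the moving vector Jv is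
        expanded in the basis.\<close>
      show "smooth_on (snd c ` fst c) (\<lambda>x. - (\<Sum>b\<in>Basis. of_real (J c (?q x) v \<bullet> b) * ext_d A F c (?q x) [b]))"
        by (intro smooth_on_bounded_linear[where h = uminus] bounded_linear_minus bounded_linear_ident
            smooth_on_sum smooth_on_mult local_forms_smooth[OF dF] chart_open(1) c
            smooth_on_bounded_linear[where h = of_real] bounded_linear_of_real
            smooth_on_bounded_linear[where h = "\<lambda>x. x \<bullet> _"] bounded_linear_inner_left J_smooth)
      fix x assume x: "x \<in> snd c ` fst c"
      note q = c chart_inv_right(1)[OF c x]
      have "linear (\<lambda>v. ext_d A F c (?q x) [v])"
        using alt_covec_linear[OF local_forms_alt_covec[OF dF q], of "[]" "[]"] by simp
      from linear_eq_sum_Basis[OF this, of "J c (?q x) v"]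
      show "- (\<Sum>b\<in>Basis. of_real (J c (?q x) v \<bullet> b) * ext_d A F c (?q x) [b]) = dc A J 0 F c (?q x) vs"
        by (simp add: v dc_0[OF F q] scaleR_conv_of_real)
    qed
  next
    case False
    show ?thesis
    proof (rule smooth_on_cong[OF smooth_on_const[where c = 0] chart_open(1)[OF c]])
      fix x assume x: "x \<in> snd c ` fst c"
      note q = c chart_inv_right(1)[OF c x]
      show "0 = dc A J 0 F c (chart_inv c x) vs"
        using False alt_covec_length[OF local_forms_alt_covec[OF dF q], of "map (J c (chart_inv c x)) vs"]
        by (simp add: dc_0[OF F q])
    qed
  qed
qed

text \<open>In a chart, dd^c f = 0 says that the derivative along v of Df(Jw) is symmetric in v and
  w. The condition is real, so the maximum principle applies to real and imaginary parts separately;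
  the map h in the proof is specialised to these two.\<close>

lemma dc_closed_function_constant:
  fixes f :: "'a \<Rightarrow> complex"
  assumes f: "\<And>c. c \<in> A \<Longrightarrow> smooth_on (snd c ` fst c) (\<lambda>x. f (chart_inv c x))"
    and z: "ext_d A (dc A J 0 (on_charts A (\<lambda>c p vs. if vs = [] then f p else 0))) = 0"
  shows "f p = f q"
proof -
  define F where "F = on_charts A (\<lambda>c p vs. if vs = [] then f p else 0)"
  define D where "D c x = frechet_derivative (\<lambda>y. f (chart_inv c y)) (at x)"
    for c :: "('a, 'e) chart" and x
  have F: "F \<in> local_forms 0" unfolding F_def by (rule function_local_form[OF f])
  have dF_eq: "ext_d A F c (chart_inv c x) [v] = D c x v" if c: "c \<in> A" and x: "x \<in> snd c ` fst c" for c x v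
  proof -
    have "frechet_derivative (\<lambda>x. F c (chart_inv c x) []) (at x) = D c x"
      unfolding D_def
      by (rule frechet_derivative_cong_open[OF chart_open(1)[OF c] x])
        (use c in \<open>simp add: F_def on_charts_def chart_inv_right\<close>)
    then show ?thesis
      using chart_inv_right[OF c x] by (simp add: ext_d_eq[OF c] extd_def omit_def)
  qed
  have dc1: "dc A J 0 F c (chart_inv c x) [v] = - D c x (J c (chart_inv c x) v)"
    if c: "c \<in> A" and x: "x \<in> snd c ` fst c" for c x v
    using dc_0[OF F c chart_inv_right(1)[OF c x]] dF_eq[OF c x] by simp
  have DJ_smooth: "smooth_on (snd c ` fst c) (\<lambda>x. D c x (J c (chart_inv c x) v))" if c: "c \<in> A" for c v
  proof (rule smooth_on_cong[OF _ chart_open(1)[OF c]])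
    show "smooth_on (snd c ` fst c) (\<lambda>x. - dc A J 0 F c (chart_inv c x) [v])"
      by (intro smooth_on_bounded_linear[where h = uminus] bounded_linear_minus bounded_linear_ident
          chart_open(1) c local_forms_smooth[OF dc_0_local_forms[OF F]])
  qed (simp add: dc1[OF c])
  have eq: "frechet_derivative (\<lambda>y. D c y (J c (chart_inv c y) w)) (at x) v =
      frechet_derivative (\<lambda>y. D c y (J c (chart_inv c y) v)) (at x) w"
    if c: "c \<in> A" and x: "x \<in> snd c ` fst c" for c x v w
  proof -
    have e: "frechet_derivative (\<lambda>y. dc A J 0 F c (chart_inv c y) [w]) (at x) v =
        - frechet_derivative (\<lambda>y. D c y (J c (chart_inv c y) w)) (at x) v" for v w
    proof -
      have "frechet_derivative (\<lambda>y. dc A J 0 F c (chart_inv c y) [w]) (at x) =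
          frechet_derivative (\<lambda>y. - D c y (J c (chart_inv c y) w)) (at x)"
        by (rule frechet_derivative_cong_open[OF chart_open(1)[OF c] x]) (rule dc1[OF c])
      moreover have "frechet_derivative (\<lambda>y. - D c y (J c (chart_inv c y) w)) (at x) v = - frechet_derivative (\<lambda>y. D c y (J c (chart_inv c y) w)) (at x) v"
        by (rule frechet_derivative_bounded_linear[OF bounded_linear_minus[OF bounded_linear_ident]
            smooth_on_differentiable[OF DJ_smooth[OF c] x]])
      ultimately show ?thesis by simp
    qed
    have "0 = ext_d A (dc A J 0 F) c (chart_inv c x) [v, w]" using z by (simp add: F_def)
    also have "\<dots> = frechet_derivative (\<lambda>y. dc A J 0 F c (chart_inv c y) [w]) (at x) v -
        frechet_derivative (\<lambda>y. dc A J 0 F c (chart_inv c y) [v]) (at x) w"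
      using chart_inv_right[OF c x] by (simp add: ext_d_eq[OF c] extd_def omit_def)
    finally show ?thesis by (simp add: e)
  qed
  have "h (f p) = h (f q)" if h: "bounded_linear h" for h :: "complex \<Rightarrow> real"
  proof (rule maximum_principle)
    fix c assume c: "c \<in> A"
    show "smooth_on (snd c ` fst c) (\<lambda>x. h (f (chart_inv c x)))"
      by (rule smooth_on_bounded_linear[OF chart_open(1)[OF c] h f[OF c]])
    fix x v w assume x: "x \<in> snd c ` fst c"
    have "frechet_derivative (\<lambda>y. frechet_derivative (\<lambda>x. h (f (chart_inv c x))) (at y) (J c (chart_inv c y) w)) (at x) v =
        h (frechet_derivative (\<lambda>y. D c y (J c (chart_inv c y) w)) (at x) v)" for v w
    proof -
      have "frechet_derivative (\<lambda>y. frechet_derivative (\<lambda>x. h (f (chart_inv c x))) (at y) (J c (chart_inv c y) w)) (at x) =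
         frechet_derivative (\<lambda>y. h (D c y (J c (chart_inv c y) w))) (at x)"
        by (rule frechet_derivative_cong_open[OF chart_open(1)[OF c] x])
          (simp add: D_def frechet_derivative_bounded_linear[OF h smooth_on_differentiable[OF f[OF c]]])
      then show ?thesis
        using frechet_derivative_bounded_linear[OF h smooth_on_differentiable[OF DJ_smooth[OF c] x]] by simp
    qed
    then show "frechet_derivative (\<lambda>y. frechet_derivative (\<lambda>x. h (f (chart_inv c x))) (at y) (J c (chart_inv c y) w)) (at x) v =
      frechet_derivative (\<lambda>y. frechet_derivative (\<lambda>x. h (f (chart_inv c x))) (at y) (J c (chart_inv c y) v)) (at x) w"
      using eq[OF c x] by metis
  qed
  from this[OF bounded_linear_Re] this[OF bounded_linear_Im] show ?thesis
    by (simp add: complex_eq_iff)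
qed

end

section \<open>Volume form and Hodge operator on the manifold\<close>

locale hermitian_manifold = almost_complex_manifold A J m
  for A :: "('a::{t2_space,second_countable_topology}, 'e::euclidean_space) chart set" and J m +
  fixes g :: "('a, 'e) metric_field"
  assumes compatible: "compatible_metric A J g"
begin

abbreviation fund where "fund c p \<equiv> hermitian_space.fundamental (J c p) (g c p)"
abbreviation vol where "vol c p \<equiv> hermitian_space.volume (J c p) (g c p)"
abbreviation frm where "frm c p \<equiv> hermitian_space.frame (J c p) (g c p)"

lemma hermitian:
  assumes "c \<in> A" "p \<in> fst c"
  shows "hermitian_space (J c p) (g c p) m"
  using assms compatible J_point[OF assms] dim_M
  unfolding compatible_metric_def riemannian_metric_def hermitian_space_def by blast

lemma hodge_on_charts: "on_charts A (hodge A J g \<alpha>) = hodge A J g \<alpha>"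
  by (simp add: hodge_def on_charts_idem)

lemma hodge_eq: "c \<in> A \<Longrightarrow> p \<in> fst c \<Longrightarrow> hodge A J g \<alpha> c p = hodge_covec (J c p) (g c p) (\<alpha> c p)"
  by (simp add: hodge_def on_charts_def)

lemma hodge_zero: "hodge A J g 0 = 0"
  by (rule on_charts_eqI[OF hodge_on_charts on_charts_zero]) (simp add: hodge_eq hodge_covec_zero)

lemma adj_eq_0I: "P (hodge A J g \<alpha>) = 0 \<Longrightarrow> adj A J g P \<alpha> = 0"
  by (simp add: adj_def hodge_zero)

lemma fund_smooth:
  assumes c: "c \<in> A"
  shows "smooth_on (snd c ` fst c) (\<lambda>x. fund c (chart_inv c x) v w)"
proof (rule smooth_on_cong)
  have "smooth_on (snd c ` fst c) (\<lambda>x. g c (chart_inv c x) v w)" for v w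
    using compatible c unfolding compatible_metric_def riemannian_metric_def by blast
  then show "smooth_on (snd c ` fst c)
     (\<lambda>x. complex_of_real (\<Sum>b\<in>Basis. (J c (chart_inv c x) v \<bullet> b) * g c (chart_inv c x) b w))"
    by (intro smooth_on_bounded_linear[where h = of_real] bounded_linear_of_real smooth_on_sum smooth_on_mult
        smooth_on_bounded_linear[where h = "\<lambda>x. x \<bullet> _"] bounded_linear_inner_left J_smooth chart_open(1) c)
  fix x assume x: "x \<in> snd c ` fst c"
  interpret hermitian_space "J c (chart_inv c x)" "g c (chart_inv c x)" m
    by (rule hermitian[OF c chart_inv_right(1)[OF c x]])
  show "complex_of_real (\<Sum>b\<in>Basis. (J c (chart_inv c x) v \<bullet> b) * g c (chart_inv c x) b w) =
      fund c (chart_inv c x) v w"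
    using linear_eq_sum_Basis[OF g_linear(2), where z = "J c (chart_inv c x) v"]
    by (simp add: fundamental_def flip: of_real_mult of_real_sum)
qed (rule chart_open(1)[OF c])

lemma pf_fund_smooth: "c \<in> A \<Longrightarrow> smooth_on (snd c ` fst c) (\<lambda>x. pf (fund c (chart_inv c x)) vs)"
  by (rule smooth_on_pf[OF chart_open(1) fund_smooth])

lemma vol_smooth:
  assumes c: "c \<in> A"
  shows "smooth_on (snd c ` fst c) (\<lambda>x. vol c (chart_inv c x) vs)"
proof (rule smooth_on_cong[OF _ chart_open(1)[OF c]])
  show "smooth_on (snd c ` fst c) (\<lambda>x. if length vs = DIM('e) then pf (fund c (chart_inv c x)) vs else 0)"
    using pf_fund_smooth[OF c] by (cases "length vs = DIM('e)") (simp_all add: smooth_on_const)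
  fix x assume x: "x \<in> snd c ` fst c"
  interpret hermitian_space "J c (chart_inv c x)" "g c (chart_inv c x)" m
    by (rule hermitian[OF c chart_inv_right(1)[OF c x]])
  show "(if length vs = DIM('e) then pf (fund c (chart_inv c x)) vs else 0) = vol c (chart_inv c x) vs"
    by (simp add: volume_def)
qed

text \<open>Coordinate changes intertwine J and preserve g, hence the fundamental form and its
  Pfaffian; no frames have to be compared.\<close>

lemma vol_coord_change:
  assumes c: "c \<in> A" "c' \<in> A" "p \<in> fst c \<inter> fst c'"
  shows "vol c p vs = vol c' p (map (coord_change c c' p) vs)"
proof -
  have f: "fund c' p (coord_change c c' p v) (coord_change c c' p w) = fund c p v w" for v w
  proof -
    have "J c' p (coord_change c c' p v) = coord_change c c' p (J c p v)"
      using acs c unfolding almost_complex_structure_def by blast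
    moreover have "g c' p (coord_change c c' p (J c p v)) (coord_change c c' p w) = g c p (J c p v) w"
      using compatible c unfolding compatible_metric_def riemannian_metric_def by blast
    ultimately show ?thesis
      using hermitian_space.fundamental_def[OF hermitian] c by simp
  qed
  have "vol c p vs = (if length vs = DIM('e) then pf (fund c p) vs else 0)"
    using hermitian_space.volume_def[OF hermitian] c by blast
  moreover have "vol c' p (map (coord_change c c' p) vs) =
      (if length vs = DIM('e) then pf (fund c' p) (map (coord_change c c' p) vs) else 0)"
    using hermitian_space.volume_def[OF hermitian, of c' p "map (coord_change c c' p) vs"] c by simp
  ultimately show ?thesis by (simp add: pf_map f)
qed

definition volume_form :: "complex \<Rightarrow> ('a, 'e) cform" where
  "volume_form z = on_charts A (\<lambda>c p. covec_scale z (vol c p))"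

lemma volume_form_eq: "c \<in> A \<Longrightarrow> p \<in> fst c \<Longrightarrow> volume_form z c p = covec_scale z (vol c p)"
  by (simp add: volume_form_def on_charts_def)

lemma volume_form_cforms: "volume_form z \<in> cforms A (DIM('e))"
proof -
  have s: "smooth_on (snd c ` fst c) (\<lambda>x. volume_form z c (chart_inv c x) vs)" if c: "c \<in> A" for c vs
  proof (rule smooth_on_cong[OF _ chart_open(1)[OF c]])
    show "smooth_on (snd c ` fst c) (\<lambda>x. z * vol c (chart_inv c x) vs)"
      by (intro smooth_on_mult smooth_on_const vol_smooth c chart_open(1))
  qed (simp add: volume_form_eq[OF c chart_inv_right(1)[OF c]] covec_scale_def)
  have a: "volume_form z c p \<in> alt_covec (DIM('e))" if "c \<in> A" "p \<in> fst c" for c p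
    using hermitian_space.volume_alt_covec[OF hermitian] that by (simp add: volume_form_eq alt_covec_scale)
  have t: "volume_form z c p vs = volume_form z c' p (map (coord_change c c' p) vs)"
    if "c \<in> A" "c' \<in> A" "p \<in> fst c \<inter> fst c'" for c c' p vs
    using vol_coord_change[OF that] that by (simp add: volume_form_eq covec_scale_def)
  have "on_charts A (volume_form z) = volume_form z"
    by (simp add: volume_form_def on_charts_idem)
  with s a t show ?thesis unfolding cforms_def by blast
qed

lemma dc_top:
  assumes "\<alpha> \<in> local_forms (DIM('e))"
  shows "dc A J (DIM('e)) \<alpha> = 0"
proof (rule dc_eq_0I)
  have "J_form A J (DIM('e)) \<alpha> = \<alpha>"
  proof (rule on_charts_eqI[OF J_form_on_charts local_forms_on_charts[OF assms]])
    fix c p assume c: "c \<in> A" "p \<in> fst c"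
    show "J_form A J (DIM('e)) \<alpha> c p = \<alpha> c p"
      using hermitian_space.J_covec_top[OF hermitian[OF c] local_forms_alt_covec[OF assms c]] c
      by (simp add: J_form_def on_charts_def)
  qed
  then show "ext_d A (J_form A J (DIM('e)) \<alpha>) = 0" by (simp add: ext_d_top[OF assms])
qed

lemma hodge_constant_form: "hodge A J g (constant_form z) = volume_form z"
proof (rule on_charts_eqI[OF hodge_on_charts])
  fix c p assume c: "c \<in> A" "p \<in> fst c"
  have "constant_form z c p \<in> alt_covec 0"
    using local_forms_alt_covec[OF cforms_local_forms[OF constant_form_cforms] c] .
  from hermitian_space.hodge_covec_0[OF hermitian[OF c] this]
  show "hodge A J g (constant_form z) c p = volume_form z c p"
    by (simp add: hodge_eq[OF c] volume_form_eq[OF c] constant_form_eq[OF c])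
qed (simp add: volume_form_def on_charts_idem)

lemma hodge_volume_form: "hodge A J g (volume_form z) = constant_form z"
proof (rule on_charts_eqI[OF hodge_on_charts])
  fix c p assume c: "c \<in> A" "p \<in> fst c"
  have "volume_form z c p \<in> alt_covec (DIM('e))"
    using local_forms_alt_covec[OF cforms_local_forms[OF volume_form_cforms] c] .
  from hermitian_space.hodge_covec_top[OF hermitian[OF c] this]
  show "hodge A J g (volume_form z) c p = constant_form z c p"
    by (simp add: hodge_eq[OF c] volume_form_eq[OF c] constant_form_eq[OF c] covec_scale_def
        hermitian_space.volume_frame[OF hermitian[OF c]] fun_eq_iff)
qed (simp add: constant_form_def on_charts_idem)

section \<open>The harmonic spaces in degrees 0, 2m and 1\<close>

text \<open>For constants the third condition holds because their Hodge duals are multiples of the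
  volume form, on which d^c vanishes.\<close>

lemma harmonic_0: "harmonic_forms A J g 0 = range constant_form"
proof
  show "harmonic_forms A J g 0 \<subseteq> range constant_form"
    using exact_0_form_constant by (auto simp: harmonic_forms_def)
  have "adj A J g (\<lambda>\<beta>. ext_d A (dc A J (DIM('e) - 0) \<beta>)) (constant_form z) = 0" for z
    by (rule adj_eq_0I)
      (simp add: hodge_constant_form dc_top[OF cforms_local_forms[OF volume_form_cforms]] ext_d_zero)
  then show "range constant_form \<subseteq> harmonic_forms A J g 0"
    by (auto simp: harmonic_forms_def constant_form_cforms ext_d_constant_form dc_constant_form)
qed

lemma harmonic_top: "harmonic_forms A J g (DIM('e)) = range volume_form"
proof
  have "adj A J g (\<lambda>\<beta>. ext_d A (dc A J 0 \<beta>)) (volume_form z) = 0" for z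
    by (rule adj_eq_0I) (simp add: hodge_volume_form dc_constant_form ext_d_zero)
  moreover have l: "volume_form z \<in> local_forms (DIM('e))" for z
    by (rule cforms_local_forms[OF volume_form_cforms])
  ultimately show "range volume_form \<subseteq> harmonic_forms A J g (DIM('e))"
    by (auto simp: harmonic_forms_def volume_form_cforms ext_d_top dc_top)
  show "harmonic_forms A J g (DIM('e)) \<subseteq> range volume_form"
  proof
    fix \<alpha> assume h: "\<alpha> \<in> harmonic_forms A J g (DIM('e))"
    then have a: "\<alpha> \<in> cforms A (DIM('e))"
      and z: "hodge A J g (ext_d A (dc A J 0 (hodge A J g \<alpha>))) = 0"
      by (auto simp: harmonic_forms_def adj_def)
    note al = cforms_local_forms[OF a]
    have top: "\<alpha> c p = covec_scale (\<alpha> c p (frm c p)) (vol c p)" if c: "c \<in> A" "p \<in> fst c" for c p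
      by (rule hermitian_space.top_covec[OF hermitian[OF c] local_forms_alt_covec[OF al c]])
    \<comment> \<open>The coefficient of \<alpha> against the volume form; the transformation laws
      of both make it independent of the chart picked at p.\<close>
    define f where "f p = (let c = SOME c. c \<in> A \<and> p \<in> fst c in \<alpha> c p (frm c p))" for p
    have f: "\<alpha> c p = covec_scale (f p) (vol c p)" if c: "c \<in> A" "p \<in> fst c" for c p
    proof
      fix vs
      define c' where "c' = (SOME c. c \<in> A \<and> p \<in> fst c)"
      have c': "c' \<in> A" "p \<in> fst c'" unfolding c'_def using someI[of "\<lambda>c. c \<in> A \<and> p \<in> fst c" c] c by auto
      have "\<alpha> c p vs = \<alpha> c' p (map (coord_change c c' p) vs)"
        using a c c' unfolding cforms_def by blast
      also have "\<dots> = f p * vol c' p (map (coord_change c c' p) vs)"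
        using top[OF c'] unfolding covec_scale_def f_def Let_def c'_def by metis
      also have "\<dots> = f p * vol c p vs" using vol_coord_change[of c c' p vs] c c' by simp
      finally show "\<alpha> c p vs = covec_scale (f p) (vol c p) vs" by (simp add: covec_scale_def)
    qed
    \<comment> \<open>The chosen frames may jump from point to point, so smoothness of f is read off
      from a basis fixed in the chart, as a quotient of the values of \<alpha> and of the volume
      form on it.\<close>
    obtain es :: "'e list" where es: "set es = Basis" "distinct es"
      using finite_distinct_list[OF finite_Basis] by blast
    have les: "length es = DIM('e)" using es distinct_card by metis
    have nz: "vol c p es \<noteq> 0" if c: "c \<in> A" "p \<in> fst c" for c p
    proof
      interpret hermitian_space "J c p" "g c p" m by (rule hermitian[OF c])
      assume v: "vol c p es = 0"
      have "vol c p = 0"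
      proof (rule alt_covec_eq_0I[OF volume_alt_covec _ es(2)])
        fix I assume "I \<subseteq> {..<length es}" "card I = DIM('e)"
        then have "I = {..<length es}" using les by (simp add: card_subset_eq)
        then show "vol c p (nths es I) = 0" using v nths_all[of es I] by simp
      qed (simp add: es)
      then show False using volume_frame by simp
    qed
    have fs: "smooth_on (snd c ` fst c) (\<lambda>x. f (chart_inv c x))" if c: "c \<in> A" for c
    proof (rule smooth_on_cong)
      show "smooth_on (snd c ` fst c) (\<lambda>x. \<alpha> c (chart_inv c x) es * inverse (vol c (chart_inv c x) es))"
        by (intro smooth_on_mult smooth_on_inverse local_forms_smooth[OF al] vol_smooth chart_open(1) c nz
            chart_inv_right(1)[OF c])
      show "\<alpha> c (chart_inv c x) es * inverse (vol c (chart_inv c x) es) = f (chart_inv c x)"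
        if "x \<in> snd c ` fst c" for x
        using f[OF c chart_inv_right(1)[OF c that]] nz[OF c chart_inv_right(1)[OF c that]]
        by (simp add: covec_scale_def)
    qed (rule chart_open(1)[OF c])
    define F where "F = on_charts A (\<lambda>c p vs. if vs = [] then f p else 0)"
    have F: "F \<in> local_forms 0" unfolding F_def by (rule function_local_form[OF fs])
    have hF: "hodge A J g \<alpha> = F"
    proof (rule on_charts_eqI[OF hodge_on_charts local_forms_on_charts[OF F]])
      fix c p assume c: "c \<in> A" "p \<in> fst c"
      have "\<alpha> c p (frm c p) = f p"
        using f[OF c] hermitian_space.volume_frame[OF hermitian[OF c]] by (simp add: covec_scale_def)
      then show "hodge A J g \<alpha> c p = F c p"
        using hermitian_space.hodge_covec_top[OF hermitian[OF c] local_forms_alt_covec[OF al c]] c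
        by (simp add: hodge_eq F_def on_charts_def fun_eq_iff)
    qed
    have dF: "dc A J 0 F \<in> local_forms 1" by (rule dc_0_local_forms[OF F])
    \<comment> \<open>Harmonicity only gives this after one more Hodge operator, which is removed by
      its injectivity at each point.\<close>
    have "ext_d A (dc A J 0 F) = 0"
    proof (rule on_charts_eqI[OF ext_d_on_charts on_charts_zero])
      fix c p assume c: "c \<in> A" "p \<in> fst c"
      have "hodge_covec (J c p) (g c p) (ext_d A (dc A J 0 F) c p) = 0"
        using z c by (simp add: hF hodge_eq[symmetric])
      from hermitian_space.hodge_covec_eq_0D[OF hermitian[OF c] local_forms_alt_covec[OF ext_d_local_forms[OF dF] c] this]
      show "ext_d A (dc A J 0 F) c p = 0 c p" by simp
    qed
    from dc_closed_function_constant[OF fs this[unfolded F_def]]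
    have fz: "f p = f undefined" for p .
    have "\<alpha> = volume_form (f undefined)"
    proof (rule on_charts_eqI[OF local_forms_on_charts[OF al] local_forms_on_charts[OF cforms_local_forms[OF volume_form_cforms]]])
      fix c p assume c: "c \<in> A" "p \<in> fst c"
      show "\<alpha> c p = volume_form (f undefined) c p"
        using f[OF c] fz[of p] by (simp add: volume_form_eq[OF c])
    qed
    then show "\<alpha> \<in> range volume_form" by blast
  qed
qed

text \<open>J applied to the Hodge dual of \<alpha> is \<alpha> wedge \<omega>^(m-1) / (m-1)!, with
  \<omega> the fundamental form, and this is smooth. As J is trivial in top degree, d^c of the dual
  is simply d of that form, and a further d kills it.\<close>

lemma adj_1_form:
  assumes a: "\<alpha> \<in> local_forms 1"
  shows "adj A J g (\<lambda>\<beta>. ext_d A (dc A J (DIM('e) - 1) \<beta>)) \<alpha> = 0"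
proof (rule adj_eq_0I)
  let ?n = "DIM('e)"
  \<comment> \<open>A euclidean space has positive dimension, so m \<ge> 1 and the subtraction is
    not truncated.\<close>
  have n: "?n - 1 + 1 = ?n" using DIM_positive[where 'a = 'e] by simp
  let ?\<gamma> = "J_form A J (?n - 1) (hodge A J g \<alpha>)"
  have h: "hodge A J g \<alpha> c p \<in> alt_covec (?n - 1)" if c: "c \<in> A" "p \<in> fst c" for c p
    using hermitian_space.hodge_covec_alt_covec[OF hermitian[OF c] local_forms_alt_covec[OF a c]]
    by (simp add: hodge_eq[OF c])
  \<comment> \<open>The J in the formula for the Hodge dual meets the one from the pullback: JJ = -1
    cancels the minus sign and frees the slot of \<alpha> from J, while the Pfaffian is invariant
    under J.\<close>
  have \<gamma>: "?\<gamma> c p vs = (if length vs = ?n - 1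
      then \<Sum>j<length vs. (- 1) ^ j * (\<alpha> c p [vs ! j] * pf (fund c p) (omit j vs)) else 0)"
    if c: "c \<in> A" "p \<in> fst c" for c p vs
  proof (cases "length vs = ?n - 1")
    case True
    interpret hermitian_space "J c p" "g c p" m by (rule hermitian[OF c])
    have neg: "\<alpha> c p [- v] = - \<alpha> c p [v]" for v
      using linear_neg[OF alt_covec_linear[OF local_forms_alt_covec[OF a c], of "[]" "[]"]] by simp
    have pfJ: "pf (fund c p) (omit j (map (J c p) vs)) = pf (fund c p) (omit j vs)" for j
      by (simp add: map_omit[symmetric] pf_map fundamental_J)
    have "?\<gamma> c p vs = hodge_covec (J c p) (g c p) (\<alpha> c p) (map (J c p) vs)"
      using J_form_eq[where \<alpha> = "hodge A J g \<alpha>", OF h[OF c] c] by (simp add: hodge_eq[OF c])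
    also have "\<dots> = - (\<Sum>j<length vs. (- 1) ^ j * (\<alpha> c p [J c p (map (J c p) vs ! j)] * pf (fund c p) (omit j (map (J c p) vs))))"
      using hodge_covec_1[OF local_forms_alt_covec[OF a c], of "map (J c p) vs"] True n by simp
    also have "\<dots> = (\<Sum>j<length vs. (- 1) ^ j * (\<alpha> c p [vs ! j] * pf (fund c p) (omit j vs)))"
      by (simp add: pfJ J_square neg sum_negf)
    finally show ?thesis using True by simp
  next
    case False
    then show ?thesis
      using J_form_eq[where \<alpha> = "hodge A J g \<alpha>", OF h[OF c] c] alt_covec_length[OF h[OF c], of "map (J c p) vs"]
      by simp
  qed
  have "?\<gamma> \<in> local_forms (?n - 1)"
  proof (rule local_formsI[OF J_form_on_charts])
    show "?\<gamma> c p \<in> alt_covec (?n - 1)" if c: "c \<in> A" "p \<in> fst c" for c p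
      using alt_covec_map[OF J_point(1)[OF c] h[OF c]] J_form_eq[where \<alpha> = "hodge A J g \<alpha>", OF h[OF c] c] by simp
    show "smooth_on (snd c ` fst c) (\<lambda>x. ?\<gamma> c (chart_inv c x) vs)" if c: "c \<in> A" for c vs
    proof (rule smooth_on_cong[OF _ chart_open(1)[OF c]])
      show "smooth_on (snd c ` fst c) (\<lambda>x. if length vs = ?n - 1
         then \<Sum>j<length vs. (- 1) ^ j * (\<alpha> c (chart_inv c x) [vs ! j] * pf (fund c (chart_inv c x)) (omit j vs)) else 0)"
        by (cases "length vs = ?n - 1")
          (simp_all only: if_True if_False simp_thms smooth_on_sum smooth_on_mult smooth_on_const
            local_forms_smooth[OF a] pf_fund_smooth c chart_open(1))
    qed (simp only: \<gamma>[OF c chart_inv_right(1)[OF c]])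
  qed
  from ext_d_local_forms[OF this] have d: "ext_d A ?\<gamma> \<in> local_forms ?n" by (simp only: n)
  have "dc A J (?n - 1) (hodge A J g \<alpha>) = ext_d A ?\<gamma>"
    unfolding dc_def n
  proof (rule on_charts_eqI[OF J_form_inv_on_charts ext_d_on_charts])
    fix c p assume c: "c \<in> A" "p \<in> fst c"
    show "J_form_inv A J ?n (ext_d A ?\<gamma>) c p = ext_d A ?\<gamma> c p"
      using hermitian_space.J_covec_inv_top[OF hermitian[OF c] local_forms_alt_covec[OF d c]] c
      by (simp add: J_form_inv_def on_charts_def)
  qed
  then show "ext_d A (dc A J (?n - 1) (hodge A J g \<alpha>)) = 0" by (simp only: ext_d_top[OF d])
qed

lemma harmonic_1: "harmonic_forms A J g 1 = {\<alpha> \<in> cforms A 1. ext_d A \<alpha> = 0 \<and> dc A J 1 \<alpha> = 0}"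
  unfolding harmonic_forms_def using adj_1_form cforms_local_forms by blast

lemma harmonic_number_0: "harmonic_number A J g 0 = 1"
  unfolding harmonic_number_def
proof (rule cdim_line)
  have "(\<lambda>z. cform_scale z (constant_form 1)) = constant_form"
    by (auto simp: constant_form_def on_charts_def cform_scale_def fun_eq_iff)
  then show "harmonic_forms A J g 0 = range (\<lambda>z. cform_scale z (constant_form 1))"
    by (simp only: harmonic_0)
  obtain c where "c \<in> A" "undefined \<in> fst c" by (rule chart_exists)
  then have "constant_form 1 c undefined [] = 1" by (simp add: constant_form_eq)
  then show "constant_form 1 \<noteq> 0" by auto
qed

lemma harmonic_number_top: "harmonic_number A J g (DIM('e)) = 1"
  unfolding harmonic_number_def
proof (rule cdim_line)
  have "(\<lambda>z. cform_scale z (volume_form 1)) = volume_form"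
    by (auto simp: volume_form_def on_charts_def cform_scale_def covec_scale_def fun_eq_iff)
  then show "harmonic_forms A J g (DIM('e)) = range (\<lambda>z. cform_scale z (volume_form 1))"
    by (simp only: harmonic_top)
  obtain c where c: "c \<in> A" "undefined \<in> fst c" by (rule chart_exists)
  then have "volume_form 1 c undefined (frm c undefined) = 1"
    using hermitian_space.volume_frame[OF hermitian[OF c]] by (simp add: volume_form_eq covec_scale_def)
  then show "volume_form 1 \<noteq> 0" by auto
qed

end

theorem proposition4p7:
  fixes A :: "('a::{t2_space,second_countable_topology}, 'e::euclidean_space) chart set"
    and J :: "('a, 'e) endo_field"
    and m :: nat
  assumes "compact (UNIV :: 'a set)"
    and "connected (UNIV :: 'a set)"
    and "DIM('e) = 2 * m"
    and "smooth_atlas A"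
    and "almost_complex_structure A J"
  shows "(\<forall>g. compatible_metric A J g \<longrightarrow>
            harmonic_number A J g 0 = 1 \<and> harmonic_number A J g (2 * m) = 1) \<and>
         (\<forall>g g'. compatible_metric A J g \<longrightarrow> compatible_metric A J g' \<longrightarrow>
            harmonic_number A J g 1 = harmonic_number A J g' 1)"
proof -
  have h: "hermitian_manifold A J m g" if "compatible_metric A J g" for g
    using assms that by unfold_locales
  show ?thesis
  proof (intro conjI allI impI)
    fix g assume g: "compatible_metric A J g"
    show "harmonic_number A J g 0 = 1" by (rule hermitian_manifold.harmonic_number_0[OF h[OF g]])
    show "harmonic_number A J g (2 * m) = 1"
      using hermitian_manifold.harmonic_number_top[OF h[OF g]] assms(3) by simp
    fix g' assume g': "compatible_metric A J g'"
    show "harmonic_number A J g 1 = harmonic_number A J g' 1"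
      unfolding harmonic_number_def
      by (simp only: hermitian_manifold.harmonic_1[OF h[OF g]] hermitian_manifold.harmonic_1[OF h[OF g']])
  qed
qed

end
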